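(* Let $q$ be any prime with $q\equiv 1 \bmod 8$, and let $K=\mathbb{Q}(\sqrt{-1})$ and $M=\mathbb{Q}(\sqrt{q})$. Then there exist a quadratic character $\chi$ of $K$ and a quadratic character $\eta$ of $M$ such that $L(s,\chi,K)=L(s,\eta,M)$.
   Context: A quadratic character of a number field $F$ is an idele class character of $F$ (equivalently, via class field theory, a finite order character of the absolute Galois group $G_F=\mathrm{Gal}(\overline{\mathbb{Q}}/F)$) of order exactly $2$. $L(s,\chi,F)$ denotes the associated Hecke (equivalently Artin) L-function. *)

theory Defs
  imports
    "HOL-Complex_Analysis.Complex_Analysis"
    "HOL-Number_Theory.Cong"
    "HOL-Algebra.Bij"
    "HOL-Algebra.QuotRing"
    "HOL-Algebra.Generated_Fields"
begin

text \<open>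
  All number fields are subfields of the complex numbers, given by their underlying sets; the
  algebraic closure of the rationals is the set of algebraic complex numbers.
\<close>

definition ring_on :: "'a::comm_ring_1 set \<Rightarrow> 'a ring" where
  "ring_on S = \<lparr>carrier = S, mult = (*), one = 1, zero = 0, add = (+)\<rparr>"

definition rat_adjoin :: "complex set \<Rightarrow> complex set" where
  "rat_adjoin A = generate_field (ring_on UNIV) A"

definition Qbar :: "complex set" where
  "Qbar = {x. algebraic x}"

definition ring_of_integers :: "complex set \<Rightarrow> complex set" where
  "ring_of_integers F = {x \<in> F. algebraic_int x}"

definition primes_of :: "complex set \<Rightarrow> complex set set" where
  "primes_of F = {p. primeideal p (ring_on (ring_of_integers F)) \<and> p \<noteq> {0}}"

definition ideal_norm :: "complex set \<Rightarrow> complex set \<Rightarrow> nat" where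
  "ideal_norm F p = order (ring_on (ring_of_integers F) Quot p)"

definition primes_above :: "complex set \<Rightarrow> complex set \<Rightarrow> complex set \<Rightarrow> complex set set" where
  "primes_above F E p = {P \<in> primes_of E. P \<inter> F = p}"


definition absolute_galois_group :: "complex set \<Rightarrow> (complex \<Rightarrow> complex) monoid" where
  "absolute_galois_group F = (BijGroup Qbar)
     \<lparr>carrier := {\<sigma> \<in> Bij Qbar. \<sigma> \<in> ring_hom (ring_on Qbar) (ring_on Qbar) \<and> (\<forall>x\<in>F. \<sigma> x = x)}\<rparr>"

text \<open>
  The Krull topology is the topology of pointwise convergence on discrete \<^const>\<open>Qbar\<close>: a basis of
  neighbourhoods of an automorphism consists of the sets of automorphisms agreeing with it on a
  given finite set, equivalently on a given finite extension of the base field.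
\<close>

definition krull_topology :: "complex set \<Rightarrow> (complex \<Rightarrow> complex) topology" where
  "krull_topology F = subtopology (product_topology (\<lambda>_. discrete_topology Qbar) Qbar)
     (carrier (absolute_galois_group F))"

definition galois_character :: "complex set \<Rightarrow> ((complex \<Rightarrow> complex) \<Rightarrow> complex) \<Rightarrow> bool" where
  "galois_character F \<psi> \<longleftrightarrow>
     \<psi> \<in> hom (absolute_galois_group F) (mult_of (ring_on UNIV)) \<and>
     continuous_map (krull_topology F) euclidean \<psi>"

definition quadratic_character :: "complex set \<Rightarrow> ((complex \<Rightarrow> complex) \<Rightarrow> complex) \<Rightarrow> bool" where
  "quadratic_character F \<psi> \<longleftrightarrow>
     galois_character F \<psi> \<and>
     (\<forall>\<sigma>\<in>carrier (absolute_galois_group F). \<psi> \<sigma> ^ 2 = 1) \<and>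
     (\<exists>\<sigma>\<in>carrier (absolute_galois_group F). \<psi> \<sigma> \<noteq> 1)"


text \<open>
  The Artin L-function of a character of the absolute Galois group of \<open>F\<close>. The character is
  regarded as a character of the Galois group of \<open>E / F\<close>, where \<open>E\<close> is the fixed field of its
  kernel. Elements of that finite Galois group are represented by their extensions to
  \<^const>\<open>Qbar\<close>, so that \<open>inertia_group\<close> and \<open>frobenius_elements\<close> are the preimages, under
  restriction to \<open>E\<close>, of the inertia group and of the set of Frobenius elements at \<open>P\<close>.
\<close>

definition fixed_field :: "complex set \<Rightarrow> ((complex \<Rightarrow> complex) \<Rightarrow> complex) \<Rightarrow> complex set" where
  "fixed_field F \<psi> =
     {x \<in> Qbar. \<forall>\<sigma> \<in> kernel (absolute_galois_group F) (mult_of (ring_on UNIV)) \<psi>. \<sigma> x = x}"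

definition inertia_group :: "complex set \<Rightarrow> complex set \<Rightarrow> complex set \<Rightarrow> (complex \<Rightarrow> complex) set" where
  "inertia_group F E P =
     {\<sigma> \<in> carrier (absolute_galois_group F). \<forall>x\<in>ring_of_integers E. \<sigma> x - x \<in> P}"

definition frobenius_elements :: "complex set \<Rightarrow> complex set \<Rightarrow> complex set \<Rightarrow> (complex \<Rightarrow> complex) set" where
  "frobenius_elements F E P =
     {\<sigma> \<in> carrier (absolute_galois_group F).
        \<forall>x\<in>ring_of_integers E. \<sigma> x - x ^ ideal_norm F (P \<inter> F) \<in> P}"

definition unramified_at :: "complex set \<Rightarrow> ((complex \<Rightarrow> complex) \<Rightarrow> complex) \<Rightarrow> complex set \<Rightarrow> bool" where
  "unramified_at F \<psi> p \<longleftrightarrow>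
     (\<forall>P \<in> primes_above F (fixed_field F \<psi>) p. \<forall>\<sigma> \<in> inertia_group F (fixed_field F \<psi>) P. \<psi> \<sigma> = 1)"

text \<open>
  At unramified primes the value below does not depend on the choice of the prime above \<open>p\<close> or of
  the Frobenius element; at ramified primes the space of inertia invariants is zero, so the Euler
  factor is \<open>1\<close>, which the value \<open>0\<close> encodes.
\<close>

definition frobenius_value :: "complex set \<Rightarrow> ((complex \<Rightarrow> complex) \<Rightarrow> complex) \<Rightarrow> complex set \<Rightarrow> complex" where
  "frobenius_value F \<psi> p =
     (if unramified_at F \<psi> p
      then \<psi> (SOME \<sigma>. \<exists>P \<in> primes_above F (fixed_field F \<psi>) p.
                 \<sigma> \<in> frobenius_elements F (fixed_field F \<psi>) P)
      else 0)"

definition euler_factor ::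
    "complex \<Rightarrow> ((complex \<Rightarrow> complex) \<Rightarrow> complex) \<Rightarrow> complex set \<Rightarrow> complex set \<Rightarrow> complex" where
  "euler_factor s \<psi> F p =
     inverse (1 - frobenius_value F \<psi> p * of_nat (ideal_norm F p) powr (-s))"

text \<open>The unordered product over all nonzero primes, in analogy to \<^const>\<open>infsum\<close>.\<close>

definition euler_product ::
    "complex \<Rightarrow> ((complex \<Rightarrow> complex) \<Rightarrow> complex) \<Rightarrow> complex set \<Rightarrow> complex" where
  "euler_product s \<psi> F =
     Lim (finite_subsets_at_top (primes_of F)) (\<lambda>S. \<Prod>p\<in>S. euler_factor s \<psi> F p)"

text \<open>
  The Euler product for real part greater than \<open>1\<close>, and its meromorphic continuation elsewhere
  (with the library's convention that the value at a pole is \<open>0\<close>, which makes the continuation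
  unique as a function).
\<close>

definition L_function ::
    "complex \<Rightarrow> ((complex \<Rightarrow> complex) \<Rightarrow> complex) \<Rightarrow> complex set \<Rightarrow> complex" where
  "L_function s \<psi> F =
     (if Re s > 1 then euler_product s \<psi> F
      else (THE f. f nicely_meromorphic_on UNIV \<and>
                   (\<forall>z. Re z > 1 \<longrightarrow> f z = euler_product z \<psi> F)) s)"

end

theory Submission
  imports Defs "Jordan_Normal_Form.Char_Poly" "HOL-Number_Theory.Number_Theory"
begin

text \<open>
  Write \<open>q = A\<^sup>2 + B\<^sup>2\<close> with \<open>A \<equiv> 1\<close> and \<open>B \<equiv> 0\<close> modulo \<open>4\<close>, and put \<open>\<alpha> = A + B \<i>\<close>. The field generated by the square
  roots of \<open>\<alpha>\<close> and of its conjugate is a dihedral extension of degree \<open>8\<close> of the rationals, and its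
  irreducible two-dimensional representation is induced both from the quadratic character of
  \<open>\<rat>(\<i>)\<close> cut out by \<open>\<surd>\<alpha>\<close> and from the quadratic character of \<open>\<rat>(\<surd>q)\<close> cut out by
  \<open>\<surd>((A + \<surd>q) / 2)\<close>, because \<open>(\<surd>\<alpha> + \<surd>\<alpha>')\<^sup>2 = 2 A + 2 \<surd>q\<close> for the conjugate \<open>\<alpha>'\<close>. Instead of inducing
  representations, the Euler factors of the two characters above each rational prime \<open>p\<close> are compared
  directly: away from \<open>2 q\<close> both are Legendre symbols, linked by
  \<open>2 (A + \<surd>q) \<alpha> = (A + \<surd>q + B \<i>)\<^sup>2\<close>. Since the Euler products converge absolutely for real part
  greater than \<open>1\<close> and the meromorphic continuation is determined by its values there, equality of
  all local factors suffices.
\<close>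

text \<open>The congruences on A and B make alpha congruent to 1 modulo 4 in the Gaussian integers,
  so that the character of K is unramified at the prime above 2 and its only bad prime is (alpha),
  one of the two primes above q. The character of M has its only bad prime among the two primes
  above 2. Since 2 ramifies in K and q ramifies in M, the bad primes sit on opposite sides, and the
  Euler factors at q and at 2 need computations of their own. A second obstacle is that (A + sqrt q)
  / 2 has norm - (B / 2)^2: it lies in primes above odd divisors of B at which its character is
  unramified. There it is replaced, up to squares, by minus its conjugate. Finally,
  \<open>frobenius_value\<close> applies the character to an automorphism of \<open>Qbar\<close>
  picked by SOME. This is meaningful only if primes above and Frobenius elements exist, which is why
  automorphisms of \<open>Qbar\<close>, lying over and Frobenius elements are constructed before any
  Legendre symbol appears.\<close>

hide_const (open) up_ring.coeff up_ring.monom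

notation ring_of_integers ("\<O>")

subsection \<open>Algebraic numbers and algebraic integers\<close>

context comm_ring_hom
begin

text \<open>Coefficients pass through a ring homomorphism instead of lying in a subring, so that one
  argument serves the integers (for algebraic integers) and the rationals (for algebraic
  numbers).\<close>

definition lin_span :: "'b set \<Rightarrow> 'b set" where
  "lin_span B = {s. \<exists>f. s = (\<Sum>b\<in>B. hom (f b) * b)}"

lemma lin_span_base: "finite B \<Longrightarrow> b \<in> B \<Longrightarrow> b \<in> lin_span B"
  unfolding lin_span_def
  by (intro CollectI exI[of _ "\<lambda>c. if c = b then 1 else 0"])
     (simp add: if_distrib[of hom] if_distrib[of "\<lambda>x. x * _"] cong: if_cong)

lemma lin_span_add: "s \<in> lin_span B \<Longrightarrow> t \<in> lin_span B \<Longrightarrow> s + t \<in> lin_span B"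
proof -
  assume "s \<in> lin_span B" "t \<in> lin_span B"
  then obtain f g where "s = (\<Sum>b\<in>B. hom (f b) * b)" "t = (\<Sum>b\<in>B. hom (g b) * b)"
    by (auto simp: lin_span_def)
  then have "s + t = (\<Sum>b\<in>B. hom (f b + g b) * b)"
    by (simp add: sum.distrib ring_distribs hom_add)
  then show ?thesis
    unfolding lin_span_def by (intro CollectI exI)
qed

lemma lin_span_scale: "s \<in> lin_span B \<Longrightarrow> hom c * s \<in> lin_span B"
proof -
  assume "s \<in> lin_span B"
  then obtain f where "s = (\<Sum>b\<in>B. hom (f b) * b)"
    by (auto simp: lin_span_def)
  then have "hom c * s = (\<Sum>b\<in>B. hom (c * f b) * b)"
    by (simp add: sum_distrib_left hom_mult mult.assoc)
  then show ?thesis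
    unfolding lin_span_def by (intro CollectI exI)
qed

lemma lin_span_0: "0 \<in> lin_span B"
  unfolding lin_span_def by (intro CollectI exI[of _ "\<lambda>_. 0"]) simp

lemma lin_span_sum: "(\<And>i. i \<in> I \<Longrightarrow> f i \<in> lin_span B) \<Longrightarrow> sum f I \<in> lin_span B"
  by (induction I rule: infinite_finite_induct) (auto intro: lin_span_0 lin_span_add)

lemma lin_span_mult:
  assumes "\<And>b. b \<in> B \<Longrightarrow> z * b \<in> lin_span B" and "s \<in> lin_span B"
  shows "z * s \<in> lin_span B"
proof -
  obtain f where "s = (\<Sum>b\<in>B. hom (f b) * b)"
    using assms(2) by (auto simp: lin_span_def)
  then have "z * s = (\<Sum>b\<in>B. hom (f b) * (z * b))"
    by (simp add: sum_distrib_left mult_ac)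
  then show ?thesis
    using assms(1) by (auto intro!: lin_span_sum lin_span_scale)
qed

end

text \<open>The determinant trick: the matrix of multiplication by \<open>z\<close> on the spanning
  set \<open>B\<close> has the vector of the elements of \<open>B\<close> as an eigenvector for
  \<open>z\<close>, and characteristic polynomials are monic. The element \<open>b0\<close> keeps
  that vector from being zero.\<close>

lemma monic_root_if_lin_span:
  fixes h :: "'a::{idom} \<Rightarrow> complex"
  assumes "comm_ring_hom h" and fin: "finite B" and nz: "b0 \<in> B" "b0 \<noteq> 0"
    and mult: "\<And>b. b \<in> B \<Longrightarrow> z * b \<in> comm_ring_hom.lin_span h B"
  shows "\<exists>p. poly (map_poly h p) z = 0 \<and> lead_coeff p = 1"
proof -
  interpret comm_ring_hom h by fact
  define n where "n = card B"
  obtain e where e: "bij_betw e {..<n} B"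
    using fin unfolding n_def using ex_bij_betw_nat_finite lessThan_atLeast0 by metis
  have "\<exists>f. z * b = (\<Sum>c\<in>B. h (f c) * c)" if "b \<in> B" for b
    using mult[OF that] by (auto simp: lin_span_def)
  then obtain f where f: "\<And>b. b \<in> B \<Longrightarrow> z * b = (\<Sum>c\<in>B. h (f b c) * c)"
    by metis
  define A where "A = mat n n (\<lambda>(i, j). f (e i) (e j))"
  define v where "v = vec n e"
  have A: "A \<in> carrier_mat n n" and hA: "map_mat h A \<in> carrier_mat n n"
    by (auto simp: A_def)
  have Av: "map_mat h A *\<^sub>v v = z \<cdot>\<^sub>v v"
  proof (intro eq_vecI)
    fix i assume "i < dim_vec (z \<cdot>\<^sub>v v)"
    then have i: "i < n" by (simp add: v_def)
    then have "e i \<in> B"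
      using e by (auto simp: bij_betw_def)
    then have "z * e i = (\<Sum>c\<in>B. h (f (e i) c) * c)"
      by (rule f)
    also have "\<dots> = (\<Sum>j<n. h (f (e i) (e j)) * e j)"
      by (rule sum.reindex_bij_betw[OF e, symmetric])
    finally show "(map_mat h A *\<^sub>v v) $ i = (z \<cdot>\<^sub>v v) $ i"
      using i by (simp add: A_def v_def scalar_prod_def lessThan_atLeast0)
  qed (simp add: A_def v_def)
  obtain i0 where "i0 < n" "e i0 = b0"
    using e nz by (auto simp: bij_betw_def)
  then have "v $ i0 \<noteq> 0\<^sub>v n $ i0"
    using nz by (simp add: v_def)
  then have "v \<noteq> 0\<^sub>v n"
    by auto
  then have "eigenvalue (map_mat h A) z"
    unfolding eigenvalue_def eigenvector_def using Av A by (intro exI[of _ v]) (auto simp: v_def)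
  then have "poly (map_poly h (char_poly A)) z = 0"
    using eigenvalue_root_char_poly[OF hA] char_poly_hom[OF A] by simp
  then show ?thesis
    using degree_monic_char_poly[OF A] by auto
qed

text \<open>As \<open>p\<close> and \<open>q\<close> are monic, the top powers of \<open>x\<close>
  and \<open>y\<close> reduce to lower ones. So the finitely many monomials in \<open>B\<close> span
  a module that is stable under \<open>x\<close> and \<open>y\<close>, hence under their sum and
  product.\<close>

lemma monic_root_plus_times:
  fixes h :: "'a::{idom} \<Rightarrow> complex"
  assumes "comm_ring_hom h"
    and x: "poly (map_poly h p) x = 0" "lead_coeff p = 1"
    and y: "poly (map_poly h q) y = 0" "lead_coeff q = 1"
  shows "\<exists>p. poly (map_poly h p) (x + y) = 0 \<and> lead_coeff p = 1"
    and "\<exists>p. poly (map_poly h p) (x * y) = 0 \<and> lead_coeff p = 1"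
proof -
  interpret comm_ring_hom h by fact
  have red: "u ^ degree r = (\<Sum>i<degree r. h (- coeff r i) * u ^ i)"
    if "poly (map_poly h r) u = 0" "lead_coeff r = 1" for r u
  proof -
    have "poly (map_poly h r) u = (\<Sum>i\<le>degree r. h (coeff r i) * u ^ i)"
      using that(2) by (simp add: poly_altdef map_poly_degree_eq coeff_map_poly)
    also have "\<dots> = (\<Sum>i<degree r. h (coeff r i) * u ^ i) + u ^ degree r"
      using that(2) by (simp flip: lessThan_Suc_atMost)
    finally show ?thesis
      using that(1) by (simp add: hom_uminus sum_negf eq_neg_iff_add_eq_0 add.commute)
  qed
  have deg: "degree r > 0" if "poly (map_poly h r) u = 0" "lead_coeff r = 1" for r u
  proof (rule ccontr)
    assume "\<not> degree r > 0"
    with red[OF that] show False by simp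
  qed
  define B where "B = {x ^ i * y ^ j | i j. i < degree p \<and> j < degree q}"
  have fin: "finite B"
    unfolding B_def by (rule finite_image_set2) auto
  have one: "1 \<in> B"
    using deg[OF x] deg[OF y] unfolding B_def by (intro CollectI exI[of _ 0]) auto
  have base: "x ^ i * y ^ j \<in> lin_span B" if "i < degree p" "j < degree q" for i j
    by (rule lin_span_base[OF fin]) (use that in \<open>auto simp: B_def\<close>)
  have mx: "x * b \<in> lin_span B" if bB: "b \<in> B" for b
  proof -
    obtain i j where ij: "b = x ^ i * y ^ j" "i < degree p" "j < degree q"
      using bB unfolding B_def by blast
    show ?thesis
    proof (cases "Suc i < degree p")
      case True
      then show ?thesis
        using base[of "Suc i" j] ij by (simp add: mult.assoc)
    next
      case False
      then have "Suc i = degree p" using ij by simp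
      then have "x * b = x ^ degree p * y ^ j"
        using ij by (metis mult.assoc power_Suc)
      also have "\<dots> = (\<Sum>i<degree p. h (- coeff p i) * (x ^ i * y ^ j))"
        unfolding red[OF x] by (simp add: sum_distrib_right mult.assoc)
      finally show ?thesis
        using ij base by (auto intro!: lin_span_sum lin_span_scale)
    qed
  qed
  have my: "y * b \<in> lin_span B" if bB: "b \<in> B" for b
  proof -
    obtain i j where ij: "b = x ^ i * y ^ j" "i < degree p" "j < degree q"
      using bB unfolding B_def by blast
    show ?thesis
    proof (cases "Suc j < degree q")
      case True
      then show ?thesis
        using base[of i "Suc j"] ij by (simp add: mult_ac)
    next
      case False
      then have "Suc j = degree q" using ij by simp
      then have "y * b = y ^ degree q * x ^ i"
        using ij by (metis mult.assoc mult.commute power_Suc)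
      also have "\<dots> = (\<Sum>j<degree q. h (- coeff q j) * (x ^ i * y ^ j))"
        unfolding red[OF y] by (simp add: sum_distrib_right) (simp add: mult_ac)
      finally show ?thesis
        using ij base by (auto intro!: lin_span_sum lin_span_scale)
    qed
  qed
  have "(x + y) * b \<in> lin_span B" "(x * y) * b \<in> lin_span B" if "b \<in> B" for b
    using lin_span_add[OF mx[OF that] my[OF that]] lin_span_mult[OF mx my[OF that]]
    by (simp_all add: ring_distribs mult.assoc)
  then show "\<exists>p. poly (map_poly h p) (x + y) = 0 \<and> lead_coeff p = 1"
    and "\<exists>p. poly (map_poly h p) (x * y) = 0 \<and> lead_coeff p = 1"
    using monic_root_if_lin_span[OF assms(1) fin one] by auto
qed

lemma algebraic_int_add:
  fixes x y :: complex
  assumes "algebraic_int x" "algebraic_int y"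
  shows "algebraic_int (x + y)"
  using assms monic_root_plus_times(1)[of "of_int :: int \<Rightarrow> complex"] of_int_hom.comm_ring_hom_axioms
  unfolding algebraic_int_altdef_ipoly by blast

lemma algebraic_int_mult:
  fixes x y :: complex
  assumes "algebraic_int x" "algebraic_int y"
  shows "algebraic_int (x * y)"
  using assms monic_root_plus_times(2)[of "of_int :: int \<Rightarrow> complex"] of_int_hom.comm_ring_hom_axioms
  unfolding algebraic_int_altdef_ipoly by blast

lemma algebraic_int_diff:
  fixes x y :: complex
  assumes "algebraic_int x" "algebraic_int y"
  shows "algebraic_int (x - y)"
  using algebraic_int_add[OF assms(1) algebraic_int_minus[OF assms(2)]] by simp

lemma algebraic_int_power:
  fixes x :: complex
  assumes "algebraic_int x"
  shows "algebraic_int (x ^ n)"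
  by (induction n) (auto intro: algebraic_int_mult assms)

lemma algebraic_int_if_square: "algebraic_int (x ^ 2) \<Longrightarrow> algebraic_int x" for x :: complex
  by (rule algebraic_int_root[of _ "[:0, 0, 1:]"])
     (auto simp: power2_eq_square coeff_pCons split: nat.splits)

lemma algebraic_iff_monic_rat_poly:
  fixes x :: complex
  shows "algebraic x \<longleftrightarrow> (\<exists>p. poly (map_poly of_rat p) x = 0 \<and> lead_coeff p = 1)"
proof
  assume "algebraic x"
  then obtain p :: "int poly" where p: "p \<noteq> 0" "poly (map_poly of_int p) x = 0"
    by (rule algebraicE')
  define r where "r = Polynomial.smult (1 / of_int (lead_coeff p)) (map_poly of_int p :: rat poly)"
  have "lead_coeff r = 1"
    using p by (simp add: r_def degree_map_poly coeff_map_poly)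
  moreover have "map_poly of_rat r = Polynomial.smult (1 / of_int (lead_coeff p)) (map_poly of_int p :: complex poly)"
    by (rule poly_eqI) (simp add: r_def coeff_map_poly of_rat_mult of_rat_divide)
  ultimately show "\<exists>p. poly (map_poly of_rat p) x = 0 \<and> lead_coeff p = 1"
    using p by auto
next
  assume "\<exists>p. poly (map_poly of_rat p) x = 0 \<and> lead_coeff p = 1"
  then obtain p :: "rat poly" where p: "poly (map_poly of_rat p) x = 0" "lead_coeff p = 1"
    by auto
  have "coeff (map_poly of_rat p :: complex poly) (degree p) = 1"
    using p(2) by (simp add: coeff_map_poly)
  then have "map_poly of_rat p \<noteq> (0 :: complex poly)"
    by auto
  then show "algebraic x"
    using p by (intro algebraicI'[of "map_poly of_rat p"]) (auto simp: coeff_map_poly)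
qed

lemma algebraic_add:
  fixes x y :: complex
  assumes "algebraic x" "algebraic y"
  shows "algebraic (x + y)"
  using assms monic_root_plus_times(1)[of "of_rat :: rat \<Rightarrow> complex"] of_rat_hom.comm_ring_hom_axioms
  unfolding algebraic_iff_monic_rat_poly by blast

lemma algebraic_mult:
  fixes x y :: complex
  assumes "algebraic x" "algebraic y"
  shows "algebraic (x * y)"
  using assms monic_root_plus_times(2)[of "of_rat :: rat \<Rightarrow> complex"] of_rat_hom.comm_ring_hom_axioms
  unfolding algebraic_iff_monic_rat_poly by blast

subsection \<open>Extending automorphisms to the algebraic closure\<close>

lemma Qbar_closed [intro]:
  "x \<in> Qbar \<Longrightarrow> y \<in> Qbar \<Longrightarrow> x + y \<in> Qbar" "x \<in> Qbar \<Longrightarrow> y \<in> Qbar \<Longrightarrow> x * y \<in> Qbar"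
  "x \<in> Qbar \<Longrightarrow> - x \<in> Qbar" "x \<in> Qbar \<Longrightarrow> y \<in> Qbar \<Longrightarrow> x - y \<in> Qbar"
  "x \<in> Qbar \<Longrightarrow> inverse x \<in> Qbar" "x \<in> Qbar \<Longrightarrow> y \<in> Qbar \<Longrightarrow> x / y \<in> Qbar"
  "x \<in> Qbar \<Longrightarrow> x ^ n \<in> Qbar"
proof -
  show 1: "x + y \<in> Qbar" "x * y \<in> Qbar" if "x \<in> Qbar" "y \<in> Qbar" for x y
    using that by (auto simp: Qbar_def algebraic_add algebraic_mult)
  show 2: "- x \<in> Qbar" "inverse x \<in> Qbar" if "x \<in> Qbar" for x
    using that by (auto simp: Qbar_def)
  show "x - y \<in> Qbar" "x / y \<in> Qbar" if "x \<in> Qbar" "y \<in> Qbar" for x y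
    using 1(1)[OF that(1) 2(1)[OF that(2)]] 1(2)[OF that(1) 2(2)[OF that(2)]]
    by (simp_all add: field_simps)
  show "x ^ n \<in> Qbar" if "x \<in> Qbar" for x
    using that by (induction n) (auto intro: algebraic_mult simp: Qbar_def)
qed

lemma degree_pos_if_root: "f \<noteq> 0 \<Longrightarrow> poly f x = 0 \<Longrightarrow> degree f > 0" for f :: "complex poly"
  by (auto elim!: degree_eq_zeroE intro!: gr0I)

text \<open>Plain closure conditions on a set, so that the rationals, a quadratic field, the
  extension \<open>E\<close> of it and a generated field can all be instances.\<close>

locale algebraic_subfield =
  fixes L :: "complex set"
  assumes subset_Qbar: "L \<subseteq> Qbar"
    and one_mem [simp, intro]: "1 \<in> L"
    and add_mem [intro]: "x \<in> L \<Longrightarrow> y \<in> L \<Longrightarrow> x + y \<in> L"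
    and mult_mem [intro]: "x \<in> L \<Longrightarrow> y \<in> L \<Longrightarrow> x * y \<in> L"
    and uminus_mem [intro]: "x \<in> L \<Longrightarrow> - x \<in> L"
    and inverse_mem [intro]: "x \<in> L \<Longrightarrow> inverse x \<in> L"
begin

lemma diff_mem [intro]: "x \<in> L \<Longrightarrow> y \<in> L \<Longrightarrow> x - y \<in> L"
  using add_mem[OF _ uminus_mem, of x y] by simp

lemma divide_mem [intro]: "x \<in> L \<Longrightarrow> y \<in> L \<Longrightarrow> x / y \<in> L"
  using mult_mem[OF _ inverse_mem, of x y] by (simp add: field_simps)

lemma zero_mem [simp, intro]: "0 \<in> L"
  using diff_mem[OF one_mem one_mem] by simp

lemma power_mem [intro]: "x \<in> L \<Longrightarrow> x ^ n \<in> L"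
  by (induction n) auto

lemma of_nat_mem [simp, intro]: "of_nat n \<in> L"
  by (induction n) auto

lemma of_int_mem [simp, intro]: "of_int n \<in> L"
  by (cases n rule: int_cases2) auto

lemma Rats_mem: "x \<in> \<rat> \<Longrightarrow> x \<in> L"
  by (auto elim!: Rats_cases')

text \<open>A partial embedding over \<open>L\<close>, encoded by its graph so that unions of chains
  are again such graphs. Single-valuedness is hidden in the last clause: the graph is closed under
  differences, and 0 has only the value 0. The domain is a ring, possibly not a field.\<close>

definition emb_graph :: "(complex \<times> complex) set \<Rightarrow> bool" where
  "emb_graph G \<longleftrightarrow> (\<forall>x\<in>L. (x, x) \<in> G) \<and>
     (\<forall>a b c d. (a, b) \<in> G \<longrightarrow> (c, d) \<in> G \<longrightarrow> (a + c, b + d) \<in> G \<and> (a * c, b * d) \<in> G) \<and>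
     (\<forall>a b. (a, b) \<in> G \<longrightarrow> a \<in> Qbar \<and> (a = 0 \<longrightarrow> b = 0))"

context
  fixes G assumes G: "emb_graph G"
begin

lemma emb_id: "x \<in> L \<Longrightarrow> (x, x) \<in> G"
  and emb_add: "(a, b) \<in> G \<Longrightarrow> (c, d) \<in> G \<Longrightarrow> (a + c, b + d) \<in> G"
  and emb_mult: "(a, b) \<in> G \<Longrightarrow> (c, d) \<in> G \<Longrightarrow> (a * c, b * d) \<in> G"
  and emb_dom: "(a, b) \<in> G \<Longrightarrow> a \<in> Qbar"
  and emb_zero: "(0, b) \<in> G \<Longrightarrow> b = 0"
  using G unfolding emb_graph_def by blast+

lemma emb_uminus: "(a, b) \<in> G \<Longrightarrow> (- a, - b) \<in> G"
  using emb_mult[OF emb_id[OF uminus_mem[OF one_mem]], of a b] by simp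

lemma emb_diff: "(a, b) \<in> G \<Longrightarrow> (c, d) \<in> G \<Longrightarrow> (a - c, b - d) \<in> G"
  using emb_add[OF _ emb_uminus, of a b c d] by simp

lemma emb_fun: "(a, b) \<in> G \<Longrightarrow> (a, c) \<in> G \<Longrightarrow> b = c"
  using emb_diff[of a b a c] emb_zero by force

lemma emb_sum: "(\<And>i. i \<in> I \<Longrightarrow> (f i, g i) \<in> G) \<Longrightarrow> (sum f I, sum g I) \<in> G"
  by (induction I rule: infinite_finite_induct) (auto intro: emb_add emb_id)

lemma emb_rat_poly: "(a, b) \<in> G \<Longrightarrow> (\<And>i. coeff p i \<in> \<rat>) \<Longrightarrow> (poly p a, poly p b) \<in> G"
proof (induction p)
  case (pCons c p)
  have "c \<in> \<rat>" "coeff p i \<in> \<rat>" for i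
    using pCons.prems(2)[of 0] pCons.prems(2)[of "Suc i"] by auto
  then show ?case
    using pCons by (auto intro!: emb_add emb_mult emb_id Rats_mem)
qed (auto intro: emb_id)

lemma emb_rat_root: "(a, b) \<in> G \<Longrightarrow> (\<And>i. coeff p i \<in> \<rat>) \<Longrightarrow> poly p a = 0 \<Longrightarrow> poly p b = 0"
  using emb_rat_poly[of a b p] emb_zero by simp

text \<open>Inverses may be missing from the domain. Instead, a nonzero algebraic \<open>a\<close>
  is a root of an integer polynomial with nonzero constant term; its value is a root of the same
  polynomial and so is not 0.\<close>

lemma emb_inj: "(a, 0) \<in> G \<Longrightarrow> a = 0"
proof (rule ccontr)
  assume a: "(a, 0) \<in> G" "a \<noteq> 0"
  then have "algebraic a"
    using emb_dom by (auto simp: Qbar_def)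
  then obtain p :: "int poly" where p: "coeff p 0 \<noteq> 0" "poly (map_poly of_int p) a = 0"
    using a(2) by (elim algebraicE'_nonzero)
  have "poly (map_poly of_int p) (0::complex) = 0"
    by (rule emb_rat_root[OF a(1)]) (use p in \<open>auto simp: coeff_map_poly\<close>)
  then show False
    using p(1) by (simp add: poly_0_coeff_0 coeff_map_poly)
qed

definition poly_pairs :: "(complex poly \<times> complex poly) set" where
  "poly_pairs = {(u, v). \<forall>n. (coeff u n, coeff v n) \<in> G}"

lemma pp_add: "(u, v) \<in> poly_pairs \<Longrightarrow> (u', v') \<in> poly_pairs \<Longrightarrow> (u + u', v + v') \<in> poly_pairs"
  by (auto simp: poly_pairs_def emb_add)

lemma pp_diff: "(u, v) \<in> poly_pairs \<Longrightarrow> (u', v') \<in> poly_pairs \<Longrightarrow> (u - u', v - v') \<in> poly_pairs"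
  by (auto simp: poly_pairs_def emb_diff)

lemma pp_mult: "(u, v) \<in> poly_pairs \<Longrightarrow> (u', v') \<in> poly_pairs \<Longrightarrow> (u * u', v * v') \<in> poly_pairs"
  by (auto simp: poly_pairs_def coeff_mult intro!: emb_sum emb_mult)

lemma pp_monom: "(a, b) \<in> G \<Longrightarrow> (monom a n, monom b n) \<in> poly_pairs"
  by (auto simp: poly_pairs_def emb_id)

lemma pp_smult: "(a, b) \<in> G \<Longrightarrow> (u, v) \<in> poly_pairs \<Longrightarrow> (Polynomial.smult a u, Polynomial.smult b v) \<in> poly_pairs"
  by (auto simp: poly_pairs_def intro: emb_mult)

lemma pp_zero: "(0, v) \<in> poly_pairs \<Longrightarrow> v = 0"
  using emb_zero by (auto simp: poly_pairs_def intro!: poly_eqI)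

lemma pp_coeff: "(u, v) \<in> poly_pairs \<Longrightarrow> (coeff u n, coeff v n) \<in> G"
  by (auto simp: poly_pairs_def)

lemma pp_degree: "(u, v) \<in> poly_pairs \<Longrightarrow> degree v = degree u"
proof -
  assume uv: "(u, v) \<in> poly_pairs"
  have "coeff u n = 0 \<longleftrightarrow> coeff v n = 0" for n
    using pp_coeff[OF uv, of n] emb_zero emb_inj by force
  then show ?thesis
    by (simp add: degree_def)
qed

text \<open>Adjoining \<open>x\<close> sends \<open>poly u x\<close> to \<open>poly v y\<close>,
  which is well defined once vanishing of \<open>u\<close> at \<open>x\<close> forces vanishing of
  \<open>v\<close> at \<open>y\<close>. That follows by descent on the degree, using pseudo-division
  by \<open>f\<close> because leading coefficients need not be invertible in the domain.\<close>

lemma emb_graph_extend: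
  assumes fg: "(f, g) \<in> poly_pairs" "f \<noteq> 0" and x: "x \<in> Qbar" "poly f x = 0"
    and min: "\<And>u v. (u, v) \<in> poly_pairs \<Longrightarrow> u \<noteq> 0 \<Longrightarrow> poly u x = 0 \<Longrightarrow> degree f \<le> degree u"
    and y: "poly g y = 0"
  obtains G' where "emb_graph G'" "G \<subseteq> G'" "(x, y) \<in> G'"
proof
  define G' where "G' = (\<lambda>(u, v). (poly u x, poly v y)) ` poly_pairs"
  have lc: "coeff g (degree f) \<noteq> 0"
    using pp_coeff[OF fg(1), of "degree f"] emb_inj fg(2) by force
  have deg_pos: "degree f > 0"
    using fg(2) x(2) by (rule degree_pos_if_root)
  have zero: "poly v y = 0" if "(u, v) \<in> poly_pairs" "poly u x = 0" for u v
    using that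
  proof (induction "degree u" arbitrary: u v rule: less_induct)
    case less
    show ?case
    proof (cases "u = 0")
      case True
      then have "v = 0" using pp_zero less.prems(1) by simp
      then show ?thesis by simp
    next
      case False
      define m where "m = degree u - degree f"
      have m: "degree u = m + degree f"
        using min[OF less.prems(1) False less.prems(2)] by (simp add: m_def)
      then have m': "m \<le> degree u" "degree u - m = degree f"
        by simp_all
      define c d where "c = coeff f (degree f)" and "d = coeff u (degree u)"
      define c' d' where "c' = coeff g (degree f)" and "d' = coeff v (degree u)"
      \<comment> \<open>The leading terms cancel without a division; \<open>v1\<close> is built from
        the images of the same coefficients, so the pair stays in \<open>poly_pairs\<close>.\<close>
      define u1 where "u1 = Polynomial.smult c u - monom d m * f"
      define v1 where "v1 = Polynomial.smult c' v - monom d' m * g"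
      have pp: "(u1, v1) \<in> poly_pairs"
        unfolding u1_def v1_def c_def d_def c'_def d'_def
        by (intro pp_diff pp_smult pp_mult pp_monom pp_coeff fg less.prems)
      have x1: "poly u1 x = 0"
        by (simp add: u1_def less.prems x)
      have "degree u1 \<le> degree u"
        unfolding u1_def m
        by (intro degree_diff_le order.trans[OF degree_mult_le] add_mono degree_monom_le)
           (simp_all flip: m add: degree_smult_le)
      moreover have "coeff u1 (degree u) = 0"
        using m' by (simp add: u1_def coeff_monom_mult c_def d_def)
      moreover have "degree u > 0"
        using deg_pos m by simp
      ultimately have "degree u1 < degree u"
        by (metis degree_0 leading_coeff_0_iff order_le_less)
      then have "poly v1 y = 0"
        by (rule less.hyps[OF _ pp x1])
      then show ?thesis
        using lc y by (simp add: v1_def c'_def poly_monom)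
    qed
  qed
  show "G \<subseteq> G'"
  proof (clarify)
    fix a b assume "(a, b) \<in> G"
    then have "(monom a 0, monom b 0) \<in> poly_pairs" by (rule pp_monom)
    then show "(a, b) \<in> G'"
      unfolding G'_def by (force simp: poly_monom)
  qed
  have "(monom 1 1, monom 1 1) \<in> poly_pairs"
    by (intro pp_monom emb_id) auto
  then show "(x, y) \<in> G'"
    unfolding G'_def by (force simp: poly_monom)
  have Qb: "poly u x \<in> Qbar" if "(u, v) \<in> poly_pairs" for u v
  proof -
    have "coeff u i * x ^ i \<in> Qbar" for i
      using emb_dom[OF pp_coeff[OF that]] x by blast
    then have "(\<Sum>i\<in>I. coeff u i * x ^ i) \<in> Qbar" for I
      by (induction I rule: infinite_finite_induct) (auto simp: Qbar_def intro: algebraic_add)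
    then show ?thesis
      by (simp add: poly_altdef)
  qed
  show "emb_graph G'"
    unfolding emb_graph_def
  proof (intro conjI allI impI ballI)
    fix z assume "z \<in> L" then show "(z, z) \<in> G'"
      using \<open>G \<subseteq> G'\<close> emb_id by blast
  next
    fix a b c d assume "(a, b) \<in> G'" "(c, d) \<in> G'"
    then obtain u v u' v' where uv: "(u, v) \<in> poly_pairs" "(u', v') \<in> poly_pairs"
      "a = poly u x" "b = poly v y" "c = poly u' x" "d = poly v' y"
      by (auto simp: G'_def)
    show "(a + c, b + d) \<in> G'"
      unfolding G'_def by (rule image_eqI[OF _ pp_add[OF uv(1,2)]]) (simp add: uv)
    show "(a * c, b * d) \<in> G'"
      unfolding G'_def by (rule image_eqI[OF _ pp_mult[OF uv(1,2)]]) (simp add: uv)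
  next
    fix a b assume "(a, b) \<in> G'"
    then show "a \<in> Qbar" using Qb by (auto simp: G'_def)
  next
    fix a b assume "(a, b) \<in> G'" "a = 0"
    then show "b = 0" using zero by (auto simp: G'_def)
  qed
qed

lemma minimal_poly_pair:
  assumes x: "x \<in> Qbar"
  obtains f g where "(f, g) \<in> poly_pairs" "f \<noteq> 0" "poly f x = 0"
    "\<And>u v. (u, v) \<in> poly_pairs \<Longrightarrow> u \<noteq> 0 \<Longrightarrow> poly u x = 0 \<Longrightarrow> degree f \<le> degree u"
proof -
  define P where "P = (\<lambda>(f, g). (f, g) \<in> poly_pairs \<and> f \<noteq> 0 \<and> poly f x = 0)"
  obtain p :: "int poly" where p: "p \<noteq> 0" "poly (map_poly of_int p) x = 0"
    using x by (auto simp: Qbar_def elim: algebraicE')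
  have "P (map_poly of_int p, map_poly of_int p)"
    using p by (auto simp: P_def poly_pairs_def coeff_map_poly emb_id)
  from ex_has_least_nat[of P, OF this, of "\<lambda>(f, g). degree f"]
  obtain f g where "P (f, g)" and min: "\<forall>uv. P uv \<longrightarrow> degree f \<le> degree (fst uv)"
    by (auto simp: case_prod_unfold)
  moreover have "degree f \<le> degree u" if "(u, v) \<in> poly_pairs" "u \<noteq> 0" "poly u x = 0" for u v
    using min[rule_format, of "(u, v)"] that by (simp add: P_def)
  ultimately show ?thesis
    using that[of f g] by (simp add: P_def)
qed

lemma emb_graph_extend_dom:
  assumes x: "x \<in> Qbar"
  obtains G' y where "emb_graph G'" "G \<subseteq> G'" "(x, y) \<in> G'"
proof -
  obtain f g where fg: "(f, g) \<in> poly_pairs" "f \<noteq> 0" "poly f x = 0"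
    and min: "\<And>u v. (u, v) \<in> poly_pairs \<Longrightarrow> u \<noteq> 0 \<Longrightarrow> poly u x = 0 \<Longrightarrow> degree f \<le> degree u"
    using minimal_poly_pair[OF x] by metis
  have "degree f > 0"
    using fg(2,3) by (rule degree_pos_if_root)
  then have "\<not> constant (poly g)"
    using pp_degree[OF fg(1)] by (simp add: constant_degree)
  then obtain y where y: "poly g y = 0"
    using fundamental_theorem_of_algebra by blast
  show ?thesis
    by (rule emb_graph_extend[OF fg(1,2) x fg(3) _ y]) (use min that in auto)
qed

end

section \<open>Automorphisms of the algebraic closure that move a given element\<close>

lemma emb_graph_id: "emb_graph (Id_on L)"
  using subset_Qbar by (auto simp: emb_graph_def)

text \<open>In characteristic zero the minimal polynomial \<open>f\<close> of \<open>x\<close> is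
  separable, so the cofactor \<open>h\<close> of its factor at \<open>x\<close> does not vanish
  there. It is not constant because \<open>x\<close> is outside \<open>L\<close>, and any root of
  \<open>h\<close> can serve as \<open>y\<close>.\<close>

lemma emb_graph_moving:
  assumes x: "x \<in> Qbar" "x \<notin> L"
  obtains G y where "emb_graph G" "(x, y) \<in> G" "y \<noteq> x"
proof -
  let ?pp = "poly_pairs (Id_on L)"
  note I = emb_graph_id
  obtain f g where fg: "(f, g) \<in> ?pp" "f \<noteq> 0" "poly f x = 0"
    and min: "\<And>u v. (u, v) \<in> ?pp \<Longrightarrow> u \<noteq> 0 \<Longrightarrow> poly u x = 0 \<Longrightarrow> degree f \<le> degree u"
    using minimal_poly_pair[OF I x(1)] by metis
  have cL: "coeff f n \<in> L" for n
    using pp_coeff[OF I fg(1), of n] by auto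
  have [simp]: "g = f"
    using pp_coeff[OF I fg(1)] by (auto intro: poly_eqI)
  have "degree f > 0"
    using fg(2,3) by (rule degree_pos_if_root)
  have "poly (pderiv f) x \<noteq> 0"
  proof
    assume "poly (pderiv f) x = 0"
    moreover have "(pderiv f, pderiv f) \<in> ?pp"
      using cL by (auto simp: poly_pairs_def[OF I] coeff_pderiv)
    moreover have "pderiv f \<noteq> 0"
      using \<open>degree f > 0\<close> by (simp add: pderiv_eq_0_iff)
    ultimately show False
      using min[of "pderiv f" "pderiv f"] \<open>degree f > 0\<close> by (simp add: degree_pderiv)
  qed
  obtain h where h: "f = [:- x, 1:] * h"
    using fg(3) by (metis dvdE poly_eq_0_iff_dvd)
  have hx: "poly h x \<noteq> 0"
    using \<open>poly (pderiv f) x \<noteq> 0\<close> unfolding h pderiv_mult by (simp add: pderiv_pCons)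
  have "degree h \<noteq> 0"
  proof
    assume "degree h = 0"
    then obtain c where c: "h = [:c:]" by (rule degree_eq_zeroE)
    then have f: "f = [:- x * c, c:]" by (simp add: h)
    have "c \<in> L" "- x * c \<in> L"
      using cL[of 1] cL[of 0] by (simp_all add: f)
    moreover have "c \<noteq> 0"
      using hx c by auto
    ultimately have "x \<in> L"
      using uminus_mem[OF divide_mem[of "- x * c" c]] by simp
    with x(2) show False ..
  qed
  then have "\<not> constant (poly h)"
    by (simp add: constant_degree)
  then obtain y where y: "poly h y = 0"
    using fundamental_theorem_of_algebra by blast
  then have gy: "poly g y = 0"
    by (simp add: h)
  have yx: "y \<noteq> x"
    using hx y by blast
  show ?thesis
    by (rule emb_graph_extend[OF I fg(1,2) x(1) fg(3) _ gy]) (use min that[OF _ _ yx] in blast)+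
qed

text \<open>Zorn's lemma; a maximal graph has full domain because
  \<open>emb_graph_extend_dom\<close> would enlarge it at a missing point.\<close>

lemma emb_graph_maximal:
  assumes "emb_graph G0"
  obtains G where "emb_graph G" "G0 \<subseteq> G" "Domain G = Qbar"
proof -
  have "\<exists>M\<in>{G. emb_graph G \<and> G0 \<subseteq> G}. \<forall>X\<in>{G. emb_graph G \<and> G0 \<subseteq> G}. M \<subseteq> X \<longrightarrow> X = M"
  proof (rule subset_Zorn_nonempty)
    fix C assume C: "C \<noteq> {}" "subset.chain {G. emb_graph G \<and> G0 \<subseteq> G} C"
    then have G: "emb_graph G" "G0 \<subseteq> G" if "G \<in> C" for G
      using that by (auto simp: subset.chain_def)
    have "emb_graph (\<Union>C)"
      unfolding emb_graph_def
    proof (intro conjI allI impI ballI)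
      fix z assume "z \<in> L" then show "(z, z) \<in> \<Union>C"
        using C(1) G(1) emb_id by blast
    next
      fix a b c d assume ab: "(a, b) \<in> \<Union>C" "(c, d) \<in> \<Union>C"
      then obtain G1 G2 where G12: "G1 \<in> C" "G2 \<in> C" "(a, b) \<in> G1" "(c, d) \<in> G2" by blast
      then have "G1 \<subseteq> G2 \<or> G2 \<subseteq> G1"
        using C(2) by (fastforce simp: subset.chain_def)
      then obtain G where "G \<in> C" "(a, b) \<in> G" "(c, d) \<in> G"
        using G12 by blast
      then show "(a + c, b + d) \<in> \<Union>C" "(a * c, b * d) \<in> \<Union>C"
        using emb_add[OF G(1)] emb_mult[OF G(1)] by blast+
    next
      fix a b assume "(a, b) \<in> \<Union>C"
      then show "a \<in> Qbar" using G(1) emb_dom by blast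
    next
      fix a b assume "(a, b) \<in> \<Union>C" "a = 0"
      then show "b = 0" using G(1) emb_zero by blast
    qed
    then show "\<Union>C \<in> {G. emb_graph G \<and> G0 \<subseteq> G}"
      using C(1) G(2) by blast
  qed (use assms in auto)
  then obtain M where "emb_graph M" "G0 \<subseteq> M"
    and "\<forall>X\<in>{G. emb_graph G \<and> G0 \<subseteq> G}. M \<subseteq> X \<longrightarrow> X = M"
    by auto
  then have M: "emb_graph M" "G0 \<subseteq> M" "\<And>X. emb_graph X \<Longrightarrow> M \<subseteq> X \<Longrightarrow> X = M"
    by auto
  have "x \<in> Domain M" if x: "x \<in> Qbar" for x
    using emb_graph_extend_dom[OF M(1) x] M(3) by (metis DomainI)
  then have "Domain M = Qbar"
    using emb_dom[OF M(1)] by auto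
  then show ?thesis
    by (rule that[OF M(1,2)])
qed

lemma mem_galoisI:
  assumes G: "emb_graph G" "Domain G = Qbar"
  obtains \<sigma> where "\<sigma> \<in> carrier (absolute_galois_group L)" "\<And>x y. (x, y) \<in> G \<Longrightarrow> \<sigma> x = y"
proof
  \<comment> \<open>\<open>Bij\<close> consists of extensional maps, hence the restriction.\<close>
  define \<sigma> where "\<sigma> = restrict (\<lambda>x. THE y. (x, y) \<in> G) Qbar"
  show \<sigma>: "\<sigma> x = y" if "(x, y) \<in> G" for x y
    using that emb_fun[OF G(1)] G(2) unfolding \<sigma>_def by (auto intro!: the_equality)
  have gr: "(x, \<sigma> x) \<in> G" if "x \<in> Qbar" for x
    using that G(2) \<sigma> by (metis DomainE)
  have root: "poly (map_poly of_int p) (\<sigma> x) = 0"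
    if "x \<in> Qbar" "poly (map_poly of_int p) x = 0" for x and p :: "int poly"
    by (rule emb_rat_root[OF G(1) gr[OF that(1)] _ that(2)]) (auto simp: coeff_map_poly)
  have inj: "inj_on \<sigma> Qbar"
  proof (rule inj_onI)
    fix x y assume "x \<in> Qbar" "y \<in> Qbar" "\<sigma> x = \<sigma> y"
    then have "(x - y, 0) \<in> G"
      using emb_diff[OF G(1) gr gr, of x y] by simp
    then show "x = y"
      using emb_inj[OF G(1)] by force
  qed
  \<comment> \<open>Surjectivity: the finite root set of an integer polynomial vanishing at
    \<open>y\<close> is mapped injectively into itself, hence onto itself.\<close>
  have "y \<in> \<sigma> ` Qbar" if y: "y \<in> Qbar" for y
  proof -
    obtain p :: "int poly" where p: "p \<noteq> 0" "poly (map_poly of_int p) y = 0"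
      using y by (auto simp: Qbar_def elim: algebraicE')
    define R where "R = {z. poly (map_poly of_int p) z = (0::complex)}"
    have "finite R"
      unfolding R_def using p(1) by (intro poly_roots_finite) auto
    have RQ: "R \<subseteq> Qbar"
      using p(1) by (auto simp: R_def Qbar_def coeff_map_poly intro!: algebraicI[of "map_poly of_int p"])
    have "\<sigma> ` R \<subseteq> R"
      using root RQ by (auto simp: R_def)
    then have "\<sigma> ` R = R"
      using \<open>finite R\<close> inj_on_subset[OF inj RQ] by (intro endo_inj_surj)
    then show ?thesis
      using p(2) RQ by (auto simp: R_def)
  qed
  moreover have "\<sigma> x \<in> Qbar" if x: "x \<in> Qbar" for x
  proof -
    obtain p :: "int poly" where "p \<noteq> 0" "poly (map_poly of_int p) x = 0"
      using x by (auto simp: Qbar_def elim: algebraicE')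
    then show ?thesis
      using root[OF x] by (auto simp: Qbar_def coeff_map_poly intro!: algebraicI[of "map_poly of_int p"])
  qed
  ultimately have "bij_betw \<sigma> Qbar Qbar"
    using inj by (auto simp: bij_betw_def)
  then have "\<sigma> \<in> Bij Qbar"
    by (simp add: Bij_def \<sigma>_def)
  moreover have "\<sigma> (x + y) = \<sigma> x + \<sigma> y" "\<sigma> (x * y) = \<sigma> x * \<sigma> y"
    if "x \<in> Qbar" "y \<in> Qbar" for x y
    using \<sigma>[OF emb_add[OF G(1) gr gr]] \<sigma>[OF emb_mult[OF G(1) gr gr]] that by simp_all
  moreover have "\<sigma> 1 = 1"
    using \<sigma>[OF emb_id[OF G(1) one_mem]] .
  moreover have "\<sigma> x = x" if "x \<in> L" for x
    using \<sigma> emb_id[OF G(1) that] .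
  ultimately show "\<sigma> \<in> carrier (absolute_galois_group L)"
    using \<open>bij_betw \<sigma> Qbar Qbar\<close>
    by (auto simp: absolute_galois_group_def ring_on_def bij_betw_def intro!: Ring.ring_hom_memI)
qed

text \<open>The source of all Galois theory below: it makes \<open>L\<close> the fixed field of its
  Galois group, negates a square root lying outside the base field, and conjugates the square root
  of \<open>q\<close> over the rationals.\<close>

theorem ex_automorphism_moving:
  assumes "x \<in> Qbar" "x \<notin> L"
  obtains \<sigma> where "\<sigma> \<in> carrier (absolute_galois_group L)" "\<sigma> x \<noteq> x"
proof -
  obtain G0 y where G0: "emb_graph G0" "(x, y) \<in> G0" "y \<noteq> x"
    using emb_graph_moving[OF assms] by metis
  obtain G where G: "emb_graph G" "G0 \<subseteq> G" "Domain G = Qbar"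
    using emb_graph_maximal[OF G0(1)] by metis
  obtain \<sigma> where "\<sigma> \<in> carrier (absolute_galois_group L)" "\<And>x y. (x, y) \<in> G \<Longrightarrow> \<sigma> x = y"
    using mem_galoisI[OF G(1,3)] by metis
  then show ?thesis
    using that G0 G(2) by blast
qed

end

subsection \<open>Prime ideals of rings of integers\<close>

lemma (in algebraic_subfield) zero_int [simp, intro]: "0 \<in> \<O> L"
  and one_int [simp, intro]: "1 \<in> \<O> L"
  and add_int [intro]: "x \<in> \<O> L \<Longrightarrow> y \<in> \<O> L \<Longrightarrow> x + y \<in> \<O> L"
  and mult_int [intro]: "x \<in> \<O> L \<Longrightarrow> y \<in> \<O> L \<Longrightarrow> x * y \<in> \<O> L"
  and uminus_int [intro]: "x \<in> \<O> L \<Longrightarrow> - x \<in> \<O> L"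
  and diff_int [intro]: "x \<in> \<O> L \<Longrightarrow> y \<in> \<O> L \<Longrightarrow> x - y \<in> \<O> L"
  and power_int [intro]: "x \<in> \<O> L \<Longrightarrow> x ^ n \<in> \<O> L"
  and of_nat_int [simp, intro]: "of_nat n \<in> \<O> L"
  and of_int_int [simp, intro]: "of_int m \<in> \<O> L"
  by (auto simp: ring_of_integers_def intro: algebraic_int_add algebraic_int_mult algebraic_int_diff
      algebraic_int_power int_imp_algebraic_int)

lemma (in algebraic_subfield) cring_ring_of_integers: "cring (ring_on (\<O> L))"
proof (intro cringI abelian_groupI comm_monoidI)
  fix x assume "x \<in> carrier (ring_on (\<O> L))"
  then show "\<exists>y\<in>carrier (ring_on (\<O> L)). y \<oplus>\<^bsub>ring_on (\<O> L)\<^esub> x = \<zero>\<^bsub>ring_on (\<O> L)\<^esub>"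
    by (intro bexI[of _ "- x"]) (auto simp: ring_on_def)
qed (auto simp: ring_on_def algebra_simps)

text \<open>Later arguments about primes work with these set conditions; closure under negation is
  recovered through multiplication by \<open>- 1\<close>.\<close>

lemma (in algebraic_subfield) mem_primes_of_iff:
  "p \<in> primes_of L \<longleftrightarrow> p \<subseteq> \<O> L \<and> 0 \<in> p \<and> (\<forall>a\<in>p. \<forall>b\<in>p. a + b \<in> p) \<and>
     (\<forall>a\<in>p. \<forall>x\<in>\<O> L. x * a \<in> p) \<and> 1 \<notin> p \<and>
     (\<forall>a\<in>\<O> L. \<forall>b\<in>\<O> L. a * b \<in> p \<longrightarrow> a \<in> p \<or> b \<in> p) \<and> p \<noteq> {0}"
  (is "_ \<longleftrightarrow> ?rhs")
proof
  let ?R = "ring_on (\<O> L)"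
  assume "p \<in> primes_of L"
  then have "primeideal p ?R" and nz: "p \<noteq> {0}"
    by (auto simp: primes_of_def)
  then interpret primeideal p ?R by simp
  have "1 \<notin> p"
    using one_imp_carrier I_notcarr by (auto simp: ring_on_def)
  moreover have "a + b \<in> p" if "a \<in> p" "b \<in> p" for a b
    using additive_subgroup.a_closed[OF is_additive_subgroup that] by (simp add: ring_on_def)
  moreover have "x * a \<in> p" if "a \<in> p" "x \<in> \<O> L" for a x
    using I_l_closed[OF that(1), of x] that(2) by (simp add: ring_on_def)
  moreover have "a \<in> p \<or> b \<in> p" if "a \<in> \<O> L" "b \<in> \<O> L" "a * b \<in> p" for a b
    using I_prime[of a b] that by (simp add: ring_on_def)
  ultimately show ?rhs
    using a_subset additive_subgroup.zero_closed[OF is_additive_subgroup] nz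
    by (auto simp: ring_on_def)
next
  let ?R = "ring_on (\<O> L)"
  assume r: ?rhs
  interpret R: cring ?R by (rule cring_ring_of_integers)
  have neg: "- a \<in> p" if "a \<in> p" for a
    using r that uminus_int[OF one_int] by (metis mult_minus1)
  have inv: "\<ominus>\<^bsub>?R\<^esub> a = - a" if "a \<in> \<O> L" for a
    by (rule R.sum_zero_eq_neg[symmetric]) (use that in \<open>auto simp: ring_on_def\<close>)
  have "subgroup p (add_monoid ?R)"
  proof (rule R.add.subgroupI)
    show "\<ominus>\<^bsub>?R\<^esub> a \<in> p" if "a \<in> p" for a
      using that r neg inv by auto
  qed (use r in \<open>auto simp: ring_on_def\<close>)
  then have "ideal p ?R"
    using r by (intro idealI R.ring_axioms) (auto simp: ring_on_def mult.commute)
  then have "primeideal p ?R"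
    using r by (intro primeidealI cring_ring_of_integers) (auto simp: ring_on_def)
  then show "p \<in> primes_of L"
    using r by (auto simp: primes_of_def)
qed

locale integral_prime = algebraic_subfield +
  fixes P assumes P: "P \<in> primes_of L"
begin

abbreviation "OL \<equiv> \<O> L"

lemma prime_subset: "x \<in> P \<Longrightarrow> x \<in> OL"
  and prime_zero [simp, intro]: "0 \<in> P"
  and prime_add: "a \<in> P \<Longrightarrow> b \<in> P \<Longrightarrow> a + b \<in> P"
  and prime_mult: "a \<in> P \<Longrightarrow> x \<in> OL \<Longrightarrow> x * a \<in> P"
  and prime_one [simp]: "1 \<notin> P"
  and prime_prime: "a \<in> OL \<Longrightarrow> b \<in> OL \<Longrightarrow> a * b \<in> P \<Longrightarrow> a \<in> P \<or> b \<in> P"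
  using P unfolding mem_primes_of_iff by blast+

lemma prime_mult': "a \<in> P \<Longrightarrow> x \<in> OL \<Longrightarrow> a * x \<in> P"
  using prime_mult[of a x] by (simp add: mult.commute)

lemma prime_uminus: "a \<in> P \<Longrightarrow> - a \<in> P"
  using prime_mult[of a "- 1"] by auto

lemma prime_diff: "a \<in> P \<Longrightarrow> b \<in> P \<Longrightarrow> a - b \<in> P"
  using prime_add[OF _ prime_uminus, of a b] by simp

lemma prime_cong: "a - b \<in> P \<Longrightarrow> a \<in> P \<longleftrightarrow> b \<in> P"
  using prime_add[of "a - b" b] prime_diff[of a "a - b"] by auto

lemma prime_minus_commute: "a - b \<in> P \<Longrightarrow> b - a \<in> P"
  using prime_uminus[of "a - b"] by simp

lemma prime_trans: "a - b \<in> P \<Longrightarrow> b - c \<in> P \<Longrightarrow> a - c \<in> P"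
  using prime_add[of "a - b" "b - c"] by simp

lemma prime_cong_mult: "a - b \<in> P \<Longrightarrow> c - d \<in> P \<Longrightarrow> b \<in> OL \<Longrightarrow> c \<in> OL \<Longrightarrow> a * c - b * d \<in> P"
  using prime_add[OF prime_mult'[of "a - b" c] prime_mult[of "c - d" b]] by (simp add: algebra_simps)

lemma prime_cong_add: "a - b \<in> P \<Longrightarrow> c - d \<in> P \<Longrightarrow> (a + c) - (b + d) \<in> P"
  using prime_add[of "a - b" "c - d"] by (simp add: algebra_simps)

lemma prime_cong_power: "a - b \<in> P \<Longrightarrow> a \<in> OL \<Longrightarrow> b \<in> OL \<Longrightarrow> a ^ n - b ^ n \<in> P"
  by (induction n) (auto intro: prime_cong_mult)

lemma prime_power: "a \<in> OL \<Longrightarrow> a ^ n \<in> P \<Longrightarrow> a \<in> P"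
  by (induction n) (use prime_prime in auto)

text \<open>The prime \<open>l\<close> divides the inner binomial coefficients, and \<open>k\<close>
  rounds of this reach the exponent \<open>l ^ k\<close>. It makes the power map of a Frobenius
  element additive modulo \<open>P\<close>.\<close>

lemma freshman:
  assumes l: "prime l" "of_nat l \<in> P" and ab: "a \<in> OL" "b \<in> OL"
  shows "(a + b) ^ (l ^ k) - (a ^ (l ^ k) + b ^ (l ^ k)) \<in> P"
proof -
  have *: "(a + b) ^ l - (a ^ l + b ^ l) \<in> P" if ab: "a \<in> OL" "b \<in> OL" for a b
  proof -
    have "l > 0" using l(1) prime_gt_0_nat by simp
    have tm: "of_nat (l choose j) * a ^ j * b ^ (l - j) \<in> P" if "j \<in> {1..<l}" for j
    proof -
      have "l dvd l choose j"
        using that l(1) by (intro dvd_choose_prime) auto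
      then obtain m where "l choose j = m * l"
        by (metis dvdE mult.commute)
      then have "of_nat (l choose j) \<in> P"
        using prime_mult[OF l(2) of_nat_int[of m]] by simp
      then show ?thesis
        using ab by (intro prime_mult' power_int)
    qed
    have sum: "sum f J \<in> P" if "\<And>j. j \<in> J \<Longrightarrow> f j \<in> P" for f and J :: "nat set"
      using that by (induction J rule: infinite_finite_induct) (auto intro: prime_add)
    have "{..l} = insert 0 (insert l {1..<l})"
      using \<open>l > 0\<close> by auto
    then have "(a + b) ^ l = a ^ l + b ^ l + (\<Sum>j\<in>{1..<l}. of_nat (l choose j) * a ^ j * b ^ (l - j))"
      using \<open>l > 0\<close> unfolding binomial_ring by simp
    moreover have "(\<Sum>j\<in>{1..<l}. of_nat (l choose j) * a ^ j * b ^ (l - j)) \<in> P"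
      by (rule sum[OF tm])
    ultimately show ?thesis
      by simp
  qed
  show ?thesis
  proof (induction k)
    case (Suc k)
    have "((a + b) ^ l ^ k) ^ l - (a ^ l ^ k + b ^ l ^ k) ^ l \<in> P"
      by (rule prime_cong_power[OF Suc]) (auto intro!: ab)
    moreover have "(a ^ l ^ k + b ^ l ^ k) ^ l - ((a ^ l ^ k) ^ l + (b ^ l ^ k) ^ l) \<in> P"
      by (rule *[OF power_int[OF ab(1)] power_int[OF ab(2)]])
    moreover have "x ^ l ^ Suc k = (x ^ l ^ k) ^ l" for x :: complex
      by (metis power_Suc2 power_mult)
    ultimately show ?case
      by (metis prime_trans)
  qed simp
qed

end

context algebraic_subfield
begin

text \<open>An ideal that is maximal among those containing \<open>I\<close> and missing 1 is prime.
  This supplies the primes of an extension above a given prime of the base.\<close>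

lemma ex_prime_containing:
  assumes I: "I \<subseteq> \<O> L" "0 \<in> I" "\<And>a b. a \<in> I \<Longrightarrow> b \<in> I \<Longrightarrow> a + b \<in> I"
    "\<And>a x. a \<in> I \<Longrightarrow> x \<in> \<O> L \<Longrightarrow> x * a \<in> I" "1 \<notin> I" "I \<noteq> {0}"
  obtains P where "P \<in> primes_of L" "I \<subseteq> P"
proof -
  define A where "A = {J. I \<subseteq> J \<and> J \<subseteq> \<O> L \<and> (\<forall>a\<in>J. \<forall>b\<in>J. a + b \<in> J) \<and>
    (\<forall>a\<in>J. \<forall>x\<in>\<O> L. x * a \<in> J) \<and> 1 \<notin> J}"
  have AD: "I \<subseteq> J" "J \<subseteq> \<O> L" "\<And>a b. a \<in> J \<Longrightarrow> b \<in> J \<Longrightarrow> a + b \<in> J"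
    "\<And>a x. a \<in> J \<Longrightarrow> x \<in> \<O> L \<Longrightarrow> x * a \<in> J" "1 \<notin> J" if "J \<in> A" for J
    using that unfolding A_def by blast+
  have "\<exists>M\<in>A. \<forall>X\<in>A. M \<subseteq> X \<longrightarrow> X = M"
  proof (rule subset_Zorn_nonempty)
    have "I \<in> A"
      unfolding A_def using I(1,3-5) by simp
    then show "A \<noteq> {}"
      by auto
    fix C assume C: "C \<noteq> {}" "subset.chain A C"
    then have CA: "J \<in> A" if "J \<in> C" for J
      using that by (auto simp: subset.chain_def)
    have "a + b \<in> \<Union>C" if ab: "a \<in> \<Union>C" "b \<in> \<Union>C" for a b
    proof -
      obtain J1 J2 where J: "J1 \<in> C" "J2 \<in> C" "a \<in> J1" "b \<in> J2"
        using ab by blast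
      then have "J1 \<subseteq> J2 \<or> J2 \<subseteq> J1"
        using C(2) by (fastforce simp: subset.chain_def)
      then show ?thesis
        using J AD(3)[OF CA] by blast
    qed
    moreover have "x * a \<in> \<Union>C" if "a \<in> \<Union>C" "x \<in> \<O> L" for a x
      using that AD(4)[OF CA] by blast
    moreover have "I \<subseteq> \<Union>C"
      using C(1) AD(1)[OF CA] by blast
    moreover have "\<Union>C \<subseteq> \<O> L" "1 \<notin> \<Union>C"
      using AD(2,5)[OF CA] by blast+
    ultimately show "\<Union>C \<in> A"
      unfolding A_def by (intro CollectI conjI ballI)
  qed
  then obtain M where M: "M \<in> A" "\<forall>X\<in>A. M \<subseteq> X \<longrightarrow> X = M"
    by blast
  note MD = AD[OF M(1)]
  have "a \<in> M \<or> b \<in> M" if ab: "a \<in> \<O> L" "b \<in> \<O> L" "a * b \<in> M" for a b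
  proof (rule ccontr)
    assume nm: "\<not> (a \<in> M \<or> b \<in> M)"
    \<comment> \<open>The ideal generated by \<open>M\<close> and \<open>a\<close>: by maximality it
      contains 1, and multiplying that relation by \<open>b\<close> puts \<open>b\<close> into
      \<open>M\<close>.\<close>
    define J where "J = {m + a * x | m x. m \<in> M \<and> x \<in> \<O> L}"
    have J1: "M \<subseteq> J"
      unfolding J_def using zero_int by force
    have "0 \<in> M"
      using MD(1) I(2) by blast
    then have "a \<in> J"
      unfolding J_def using one_int by force
    then have "J \<noteq> M" using nm by blast
    then have "J \<notin> A" using M(2) J1 by blast
    moreover have "J \<subseteq> \<O> L"
      using MD(2) ab(1) by (auto simp: J_def)
    moreover have "u + v \<in> J" if uv: "u \<in> J" "v \<in> J" for u v
    proof -
      obtain m x m' x' where "u = m + a * x" "v = m' + a * x'" and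
        *: "m \<in> M" "x \<in> \<O> L" "m' \<in> M" "x' \<in> \<O> L"
        using uv unfolding J_def by blast
      then have "u + v = (m + m') + a * (x + x')"
        by (simp add: algebra_simps)
      then show ?thesis
        unfolding J_def using * MD(3) by blast
    qed
    moreover have "y * u \<in> J" if u: "u \<in> J" and y: "y \<in> \<O> L" for u y
    proof -
      obtain m x where "u = m + a * x" and *: "m \<in> M" "x \<in> \<O> L"
        using u unfolding J_def by blast
      then have "y * u = y * m + a * (y * x)"
        by (simp add: algebra_simps)
      then show ?thesis
        unfolding J_def using * MD(4) y by blast
    qed
    moreover have "I \<subseteq> J"
      using MD(1) J1 by simp
    ultimately have "1 \<in> J"
      unfolding A_def by simp
    then obtain m x where mx: "1 = m + a * x" "m \<in> M" "x \<in> \<O> L"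
      unfolding J_def by blast
    have "b = b * (m + a * x)"
      by (simp flip: mx(1))
    also have "\<dots> = b * m + x * (a * b)"
      by (simp add: algebra_simps)
    finally have "b \<in> M"
      using MD(3)[OF MD(4)[OF mx(2) ab(2)] MD(4)[OF ab(3) mx(3)]] by simp
    with nm show False by blast
  qed
  moreover have "M \<noteq> {0}"
    using MD(1) I(2,6) by auto
  moreover have "0 \<in> M"
    using MD(1) I(2) by auto
  ultimately have "M \<in> primes_of L"
    unfolding mem_primes_of_iff using MD(2-5) by simp
  then show ?thesis
    using that MD(1) by blast
qed

lemma ideal_norm_eq_card:
  assumes "p \<in> primes_of L" and S: "finite S" "S \<subseteq> \<O> L"
    and ex: "\<And>x. x \<in> \<O> L \<Longrightarrow> \<exists>s\<in>S. x - s \<in> p"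
    and uniq: "\<And>s t. s \<in> S \<Longrightarrow> t \<in> S \<Longrightarrow> s - t \<in> p \<Longrightarrow> s = t"
  shows "ideal_norm L p = card S"
proof -
  let ?R = "ring_on (\<O> L)"
  interpret p: integral_prime L p
    by unfold_locales fact
  have coset: "p +>\<^bsub>?R\<^esub> x = {y. y - x \<in> p}" for x
  proof -
    have "p +>\<^bsub>?R\<^esub> x = (\<lambda>h. h + x) ` p"
      by (auto simp: a_r_coset_def r_coset_def ring_on_def)
    also have "\<dots> = {y. y - x \<in> p}"
      by (force simp: image_iff)
    finally show ?thesis .
  qed
  have "bij_betw (\<lambda>s. p +>\<^bsub>?R\<^esub> s) S (a_rcosets\<^bsub>?R\<^esub> p)"
    unfolding bij_betw_def
  proof
    show "inj_on (\<lambda>s. p +>\<^bsub>?R\<^esub> s) S"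
    proof (rule inj_onI)
      fix s t assume st: "s \<in> S" "t \<in> S" "p +>\<^bsub>?R\<^esub> s = p +>\<^bsub>?R\<^esub> t"
      have "s \<in> p +>\<^bsub>?R\<^esub> s" by (simp add: coset)
      with st have "s - t \<in> p" by (simp add: coset)
      then show "s = t" using uniq st by blast
    qed
    show "(\<lambda>s. p +>\<^bsub>?R\<^esub> s) ` S = a_rcosets\<^bsub>?R\<^esub> p"
    proof
      show "(\<lambda>s. p +>\<^bsub>?R\<^esub> s) ` S \<subseteq> a_rcosets\<^bsub>?R\<^esub> p"
        using S(2) by (auto simp: A_RCOSETS_def RCOSETS_def a_r_coset_def ring_on_def)
      show "a_rcosets\<^bsub>?R\<^esub> p \<subseteq> (\<lambda>s. p +>\<^bsub>?R\<^esub> s) ` S"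
      proof
        fix c assume "c \<in> a_rcosets\<^bsub>?R\<^esub> p"
        then obtain x where x: "x \<in> \<O> L" "c = p +>\<^bsub>?R\<^esub> x"
          by (auto simp: A_RCOSETS_def RCOSETS_def a_r_coset_def ring_on_def)
        obtain s where s: "s \<in> S" "x - s \<in> p" using ex x by blast
        have "y - x \<in> p \<longleftrightarrow> y - s \<in> p" for y
          using s(2) p.prime_trans p.prime_minus_commute by blast
        then have "c = p +>\<^bsub>?R\<^esub> s"
          by (simp add: x coset)
        then show "c \<in> (\<lambda>s. p +>\<^bsub>?R\<^esub> s) ` S" using s by blast
      qed
    qed
  qed
  then have "card S = card (a_rcosets\<^bsub>?R\<^esub> p)"
    by (rule bij_betw_same_card)
  then show ?thesis
    by (simp add: ideal_norm_def Coset.order_def FactRing_def)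
qed

end

subsection \<open>Quadratic characters and their Frobenius values\<close>

context algebraic_subfield
begin

abbreviation "Gal \<equiv> carrier (absolute_galois_group L)"

lemma gal_iff:
  "\<sigma> \<in> Gal \<longleftrightarrow> \<sigma> \<in> extensional Qbar \<and> bij_betw \<sigma> Qbar Qbar \<and> \<sigma> 1 = 1 \<and>
     (\<forall>x\<in>Qbar. \<forall>y\<in>Qbar. \<sigma> (x + y) = \<sigma> x + \<sigma> y \<and> \<sigma> (x * y) = \<sigma> x * \<sigma> y) \<and> (\<forall>x\<in>L. \<sigma> x = x)"
  by (auto simp: absolute_galois_group_def Bij_def Ring.ring_hom_def ring_on_def Pi_iff dest: bij_betwE)

context
  fixes \<sigma> assumes \<sigma>: "\<sigma> \<in> Gal"
begin

lemma gal_closed [intro]: "x \<in> Qbar \<Longrightarrow> \<sigma> x \<in> Qbar"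
  and gal_add: "x \<in> Qbar \<Longrightarrow> y \<in> Qbar \<Longrightarrow> \<sigma> (x + y) = \<sigma> x + \<sigma> y"
  and gal_mult: "x \<in> Qbar \<Longrightarrow> y \<in> Qbar \<Longrightarrow> \<sigma> (x * y) = \<sigma> x * \<sigma> y"
  and gal_fix: "x \<in> L \<Longrightarrow> \<sigma> x = x"
  and gal_inj: "x \<in> Qbar \<Longrightarrow> y \<in> Qbar \<Longrightarrow> \<sigma> x = \<sigma> y \<longleftrightarrow> x = y"
  using \<sigma> unfolding gal_iff by (auto simp: bij_betw_def inj_on_def)

lemma gal_uminus: "x \<in> Qbar \<Longrightarrow> \<sigma> (- x) = - \<sigma> x"
  using gal_mult[of "- 1" x] gal_fix[OF uminus_mem[OF one_mem]] subset_Qbar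
    uminus_mem[OF one_mem] by auto

lemma gal_diff: "x \<in> Qbar \<Longrightarrow> y \<in> Qbar \<Longrightarrow> \<sigma> (x - y) = \<sigma> x - \<sigma> y"
  using gal_add[of x "- y"] gal_uminus[of y] Qbar_closed(3)[of y] by simp

lemma gal_inverse: "x \<in> Qbar \<Longrightarrow> \<sigma> (inverse x) = inverse (\<sigma> x)"
proof (cases "x = 0")
  case False
  assume x: "x \<in> Qbar"
  have "\<sigma> x * \<sigma> (inverse x) = 1"
    using gal_mult[of x "inverse x"] x False gal_fix[OF one_mem] by auto
  then show ?thesis
    by (simp add: inverse_unique)
qed (use gal_fix[OF zero_mem] in simp)

lemma gal_algebraic_int:
  assumes "algebraic_int x"
  shows "algebraic_int (\<sigma> x)"
proof -
  have x: "x \<in> Qbar"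
    using assms by (auto simp: Qbar_def)
  have "poly (map_poly of_int p) x \<in> Qbar \<and>
    \<sigma> (poly (map_poly of_int p) x) = poly (map_poly of_int p) (\<sigma> x)" for p :: "int poly"
  proof (induction p)
    case 0
    show ?case using gal_fix[OF zero_mem] by (auto simp: Qbar_def)
  next
    case (pCons c p)
    have "of_int c \<in> Qbar" using of_int_mem subset_Qbar by blast
    then show ?case
      using pCons x by (auto simp: map_poly_pCons gal_add gal_mult gal_fix Qbar_closed)
  qed
  then show ?thesis
    using assms gal_fix[OF zero_mem] unfolding algebraic_int_altdef_ipoly by metis
qed

end

lemma gal_compose:
  assumes "\<sigma> \<in> Gal" "\<tau> \<in> Gal"
  shows "\<sigma> \<otimes>\<^bsub>absolute_galois_group L\<^esub> \<tau> = compose Qbar \<sigma> \<tau>" "compose Qbar \<sigma> \<tau> \<in> Gal"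
proof -
  show "\<sigma> \<otimes>\<^bsub>absolute_galois_group L\<^esub> \<tau> = compose Qbar \<sigma> \<tau>"
    using assms by (auto simp: absolute_galois_group_def BijGroup_def)
  have "compose Qbar \<sigma> \<tau> x = \<sigma> (\<tau> x)" if "x \<in> Qbar" for x
    using that by (simp add: compose_def)
  moreover have "L \<subseteq> Qbar" "1 \<in> Qbar" using subset_Qbar one_mem by auto
  moreover have "bij_betw (compose Qbar \<sigma> \<tau>) Qbar Qbar"
    using assms by (intro bij_betw_compose) (auto simp: gal_iff)
  moreover have "compose Qbar \<sigma> \<tau> \<in> extensional Qbar"
    by (simp add: compose_def)
  ultimately show "compose Qbar \<sigma> \<tau> \<in> Gal"
    using assms gal_closed[OF assms(2)] subset_Qbar unfolding gal_iff
    by (auto simp: Qbar_closed subset_iff)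
qed

lemma gal_inverse_ex:
  assumes "\<sigma> \<in> Gal"
  obtains \<tau> where "\<tau> \<in> Gal" "\<And>x. x \<in> Qbar \<Longrightarrow> \<tau> (\<sigma> x) = x"
proof
  define \<tau> where "\<tau> = restrict (inv_into Qbar \<sigma>) Qbar"
  have bij: "bij_betw \<sigma> Qbar Qbar"
    using assms by (simp add: gal_iff)
  show inv: "\<tau> (\<sigma> x) = x" if "x \<in> Qbar" for x
    using that bij gal_closed[OF assms that] by (simp add: \<tau>_def bij_betw_def)
  have ex: "\<exists>x'\<in>Qbar. x = \<sigma> x'" if "x \<in> Qbar" for x
    using bij that by (auto simp: bij_betw_def)
  have "\<tau> x = x" if "x \<in> L" for x
    using inv[of x] gal_fix[OF assms that] that subset_Qbar by auto
  moreover have "\<tau> (x + y) = \<tau> x + \<tau> y \<and> \<tau> (x * y) = \<tau> x * \<tau> y" if xy: "x \<in> Qbar" "y \<in> Qbar" for x y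
  proof -
    obtain x' y' where "x' \<in> Qbar" "y' \<in> Qbar" "x = \<sigma> x'" "y = \<sigma> y'"
      using ex xy by metis
    then show ?thesis
      using inv[of "x' + y'"] inv[of "x' * y'"] inv[of x'] inv[of y']
      by (simp add: gal_add[OF assms] gal_mult[OF assms] Qbar_closed)
  qed
  moreover have "bij_betw \<tau> Qbar Qbar"
    using bij_betw_inv_into[OF bij] unfolding \<tau>_def by (rule bij_betw_cong[THEN iffD1, rotated]) auto
  moreover have "\<tau> \<in> extensional Qbar"
    by (simp add: \<tau>_def)
  ultimately show "\<tau> \<in> Gal"
    using one_mem unfolding gal_iff by blast
qed

lemma fixed_by_gal: "x \<in> Qbar \<Longrightarrow> (\<And>\<sigma>. \<sigma> \<in> Gal \<Longrightarrow> \<sigma> x = x) \<Longrightarrow> x \<in> L"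
  using ex_automorphism_moving[of x] by metis

end

section \<open>The quadratic character cut out by a square root\<close>

locale quadratic_extension = algebraic_subfield F for F +
  fixes \<delta> :: complex
  assumes delta_Qbar: "\<delta> \<in> Qbar" and delta_notin: "\<delta> \<notin> F" and delta_square: "\<delta> ^ 2 \<in> F"
begin

text \<open>The Kummer character of \<open>\<delta>\<close>; its values are signs because
  \<open>\<delta> ^ 2\<close> is fixed.\<close>

definition \<psi> :: "(complex \<Rightarrow> complex) \<Rightarrow> complex" where
  "\<psi> \<sigma> = \<sigma> \<delta> / \<delta>"

text \<open>This is the field generated by \<open>\<delta>\<close> over \<open>F\<close>, described
  through the stabilizer of \<open>\<delta>\<close> so that it agrees with
  \<open>fixed_field F \<psi>\<close> by mere unfolding.\<close>

definition E :: "complex set" where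
  "E = {x \<in> Qbar. \<forall>\<sigma>\<in>Gal. \<sigma> \<delta> = \<delta> \<longrightarrow> \<sigma> x = x}"

lemma delta_nz [simp]: "\<delta> \<noteq> 0"
  using delta_notin by auto

lemma gal_delta: "\<sigma> \<in> Gal \<Longrightarrow> \<sigma> \<delta> = \<delta> \<or> \<sigma> \<delta> = - \<delta>"
proof -
  assume \<sigma>: "\<sigma> \<in> Gal"
  have "\<sigma> \<delta> ^ 2 = \<delta> ^ 2"
    using gal_mult[OF \<sigma> delta_Qbar delta_Qbar] gal_fix[OF \<sigma> delta_square] by (simp add: power2_eq_square)
  then show ?thesis
    by (simp add: power2_eq_iff)
qed

lemma psi_cases: "\<sigma> \<in> Gal \<Longrightarrow> \<psi> \<sigma> = 1 \<and> \<sigma> \<delta> = \<delta> \<or> \<psi> \<sigma> = - 1 \<and> \<sigma> \<delta> = - \<delta>"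
  using gal_delta[of \<sigma>] by (auto simp: \<psi>_def)

lemma psi_eq_1_iff: "\<psi> \<sigma> = 1 \<longleftrightarrow> \<sigma> \<delta> = \<delta>"
  by (simp add: \<psi>_def)

lemma ex_tau: obtains \<tau> where "\<tau> \<in> Gal" "\<tau> \<delta> = - \<delta>"
  using ex_automorphism_moving[OF delta_Qbar delta_notin] gal_delta by metis

lemma quadratic_character_psi: "quadratic_character F \<psi>"
proof -
  have sq: "\<psi> \<sigma> ^ 2 = 1" "\<psi> \<sigma> \<noteq> 0" if "\<sigma> \<in> Gal" for \<sigma>
    using psi_cases[OF that] by auto
  have "\<psi> (\<sigma> \<otimes>\<^bsub>absolute_galois_group F\<^esub> \<tau>) = \<psi> \<sigma> * \<psi> \<tau>" if st: "\<sigma> \<in> Gal" "\<tau> \<in> Gal" for \<sigma> \<tau>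
  proof -
    have "\<sigma> (\<tau> \<delta>) / \<delta> = (\<sigma> \<delta> / \<delta>) * (\<tau> \<delta> / \<delta>)"
      using psi_cases[OF st(2)] gal_uminus[OF st(1) delta_Qbar] by auto
    then show ?thesis
      by (simp add: \<psi>_def gal_compose[OF st] compose_def delta_Qbar)
  qed
  then have "\<psi> \<in> hom (absolute_galois_group F) (mult_of (ring_on UNIV))"
    using sq by (auto simp: hom_def ring_on_def)
  moreover have "continuous_map (krull_topology F) euclidean \<psi>"
  proof -
    \<comment> \<open>The character factors through evaluation at \<open>\<delta>\<close>, which is
      a coordinate projection onto a discrete space.\<close>
    have "continuous_map (krull_topology F) (discrete_topology Qbar) (\<lambda>\<sigma>. \<sigma> \<delta>)"
      unfolding krull_topology_def
      by (intro continuous_map_from_subtopology continuous_map_product_projection delta_Qbar)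
    moreover have "continuous_map (discrete_topology Qbar) euclidean (\<lambda>x. x / \<delta>)"
      by simp
    ultimately show ?thesis
      using continuous_map_compose unfolding \<psi>_def comp_def by blast
  qed
  moreover obtain \<tau> where "\<tau> \<in> Gal" "\<tau> \<delta> = - \<delta>"
    by (rule ex_tau)
  then have "\<exists>\<sigma>\<in>Gal. \<psi> \<sigma> \<noteq> 1"
    by (intro bexI[of _ \<tau>]) (auto simp: psi_eq_1_iff)
  ultimately show ?thesis
    unfolding quadratic_character_def galois_character_def using sq by auto
qed

lemma fixed_field_psi: "fixed_field F \<psi> = E"
  unfolding fixed_field_def E_def kernel_def by (auto simp: ring_on_def psi_eq_1_iff)

text \<open>Following \<open>\<sigma>\<close> by an inverse of \<open>\<tau>\<close> fixes
  \<open>\<delta>\<close>, hence all of \<open>E\<close>. So the sign at \<open>\<delta>\<close>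
  determines the action on \<open>E\<close>.\<close>

lemma same_action:
  assumes "\<sigma> \<in> Gal" "\<tau> \<in> Gal" "\<sigma> \<delta> = \<tau> \<delta>" "x \<in> E"
  shows "\<sigma> x = \<tau> x"
proof -
  obtain \<rho> where \<rho>: "\<rho> \<in> Gal" "\<And>x. x \<in> Qbar \<Longrightarrow> \<rho> (\<tau> x) = x"
    using gal_inverse_ex[OF assms(2)] by metis
  have x: "x \<in> Qbar" using assms(4) by (simp add: E_def)
  have "compose Qbar \<rho> \<sigma> \<delta> = \<delta>"
    using assms(3) \<rho>(2) delta_Qbar by (simp add: compose_def)
  then have "compose Qbar \<rho> \<sigma> x = x"
    using gal_compose(2)[OF \<rho>(1) assms(1)] assms(4) unfolding E_def by blast
  then have "\<rho> (\<sigma> x) = \<rho> (\<tau> x)"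
    using x \<rho>(2) by (simp add: compose_def)
  then show ?thesis
    using gal_inj[OF \<rho>(1)] gal_closed[OF assms(1) x] gal_closed[OF assms(2) x] by blast
qed

sublocale E: algebraic_subfield E
proof
  show "1 \<in> E" "E \<subseteq> Qbar"
    using one_mem subset_Qbar by (auto simp: E_def gal_fix)
qed (auto simp: E_def gal_add gal_mult gal_uminus gal_inverse)

lemma F_subset_E: "F \<subseteq> E"
  using subset_Qbar by (auto simp: E_def gal_fix)

lemma delta_mem_E: "\<delta> \<in> E"
  using delta_Qbar by (auto simp: E_def)

lemma int_F_subset_E: "x \<in> \<O> F \<Longrightarrow> x \<in> \<O> E"
  using F_subset_E by (auto simp: ring_of_integers_def)

lemma E_Qbar: "x \<in> E \<Longrightarrow> x \<in> Qbar"
  by (simp add: E_def)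

context
  fixes \<tau> assumes \<tau>: "\<tau> \<in> Gal" "\<tau> \<delta> = - \<delta>"
begin

lemma gal_E_cases: "\<sigma> \<in> Gal \<Longrightarrow> x \<in> E \<Longrightarrow> \<psi> \<sigma> = 1 \<and> \<sigma> x = x \<or> \<psi> \<sigma> = - 1 \<and> \<sigma> x = \<tau> x"
  using psi_cases[of \<sigma>] same_action[OF _ \<tau>(1), of \<sigma> x] \<tau>(2) by (auto simp: E_def)

lemma tau_tau: "x \<in> E \<Longrightarrow> \<tau> (\<tau> x) = x"
proof -
  assume x: "x \<in> E"
  have "compose Qbar \<tau> \<tau> \<delta> = \<delta>"
    using \<tau> gal_uminus[OF \<tau>(1) delta_Qbar] delta_Qbar by (simp add: compose_def)
  then have "compose Qbar \<tau> \<tau> x = x"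
    using gal_compose(2)[OF \<tau>(1) \<tau>(1)] x unfolding E_def by blast
  then show ?thesis
    using E_Qbar[OF x] by (simp add: compose_def)
qed

lemma tau_E: "x \<in> E \<Longrightarrow> \<tau> x \<in> E"
proof -
  assume x: "x \<in> E"
  have "\<sigma> (\<tau> x) = \<tau> x" if s: "\<sigma> \<in> Gal" "\<sigma> \<delta> = \<delta>" for \<sigma>
  proof -
    have "compose Qbar \<sigma> \<tau> \<delta> = \<tau> \<delta>"
      using s \<tau> gal_uminus[OF s(1) delta_Qbar] delta_Qbar by (simp add: compose_def)
    then have "compose Qbar \<sigma> \<tau> x = \<tau> x"
      by (rule same_action[OF gal_compose(2)[OF s(1) \<tau>(1)] \<tau>(1) _ x])
    then show ?thesis
      using E_Qbar[OF x] by (simp add: compose_def)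
  qed
  then show ?thesis
    using gal_closed[OF \<tau>(1) E_Qbar[OF x]] by (auto simp: E_def)
qed

lemma tau_invariant: "x \<in> E \<Longrightarrow> \<tau> x = x \<Longrightarrow> x \<in> F"
  by (rule fixed_by_gal) (auto intro: E_Qbar dest: gal_E_cases[of _ x])

lemma tau_int: "x \<in> \<O> E \<Longrightarrow> \<tau> x \<in> \<O> E"
  using tau_E gal_algebraic_int[OF \<tau>(1)] by (auto simp: ring_of_integers_def)

lemma trace_int: "x \<in> \<O> E \<Longrightarrow> x + \<tau> x \<in> \<O> F"
  and norm_int: "x \<in> \<O> E \<Longrightarrow> x * \<tau> x \<in> \<O> F"
proof -
  assume x: "x \<in> \<O> E"
  then have xE: "x \<in> E" and "\<tau> x \<in> E"
    using tau_E by (auto simp: ring_of_integers_def)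
  then have "\<tau> (x + \<tau> x) = x + \<tau> x" "\<tau> (x * \<tau> x) = x * \<tau> x"
    by (simp_all add: gal_add[OF \<tau>(1)] gal_mult[OF \<tau>(1)] E_Qbar tau_tau)
  then have "x + \<tau> x \<in> F" "x * \<tau> x \<in> F"
    using xE \<open>\<tau> x \<in> E\<close> by (auto intro!: tau_invariant)
  moreover have "x + \<tau> x \<in> \<O> E" "x * \<tau> x \<in> \<O> E"
    using x tau_int[OF x] by auto
  ultimately show "x + \<tau> x \<in> \<O> F" "x * \<tau> x \<in> \<O> F"
    by (auto simp: ring_of_integers_def)
qed

end

section \<open>Frobenius elements, and character values at ramified, tame and dyadic primes\<close>

lemma prime_below:
  assumes "P \<in> primes_above F E p"
  shows "integral_prime E P" "x \<in> \<O> F \<Longrightarrow> x \<in> P \<longleftrightarrow> x \<in> p" "p \<subseteq> P" "P \<inter> F = p"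
proof -
  show "integral_prime E P"
    using assms by unfold_locales (auto simp: primes_above_def)
  show "x \<in> P \<longleftrightarrow> x \<in> p" if "x \<in> \<O> F"
    using assms that by (auto simp: primes_above_def ring_of_integers_def)
  show "p \<subseteq> P" "P \<inter> F = p"
    using assms by (auto simp: primes_above_def)
qed

text \<open>
  Modulo \<open>P\<close>, the \<open>N\<close>-th power of \<open>x\<close> is a root of the characteristic polynomial of \<open>x\<close>, hence
  congruent to \<open>x\<close> or to \<open>\<tau> x\<close>. Each alternative holds on an additive subgroup, and a group is not
  the union of two proper subgroups.
\<close>

lemma ex_frobenius:
  assumes P: "P \<in> primes_above F E p" and l: "prime l" "of_nat l \<in> p"
    and N: "ideal_norm F p = l ^ k"
    and fermat: "\<And>a. a \<in> \<O> F \<Longrightarrow> a ^ (l ^ k) - a \<in> p"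
  shows "frobenius_elements F E P \<noteq> {}"
proof -
  let ?O = "\<O> E" and ?N = "l ^ k"
  interpret P: integral_prime E P
    using prime_below(1)[OF P] .
  obtain \<tau> where \<tau>: "\<tau> \<in> Gal" "\<tau> \<delta> = - \<delta>"
    using ex_tau by metis
  have lP: "of_nat l \<in> P" and fermatP: "\<And>a. a \<in> \<O> F \<Longrightarrow> a ^ ?N - a \<in> P"
    using l(2) fermat prime_below(3)[OF P] by auto
  have N0: "?N > 0"
    using l(1) prime_gt_0_nat by simp
  have root: "x ^ ?N - x \<in> P \<or> x ^ ?N - \<tau> x \<in> P" if x: "x \<in> ?O" for x
  proof -
    define s where "s = x + \<tau> x"
    define n where "n = x * \<tau> x"
    note tx = tau_int[OF \<tau> x]
    have s: "s \<in> \<O> F" "s \<in> ?O" and n: "n \<in> \<O> F" "n \<in> ?O"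
      using trace_int[OF \<tau> x] norm_int[OF \<tau> x] int_F_subset_E by (auto simp: s_def n_def)
    have 1: "(x + \<tau> x) ^ ?N - (x ^ ?N + \<tau> x ^ ?N) \<in> P"
      by (rule P.freshman[OF l(1) lP x tx])
    have 2: "s ^ ?N - s \<in> P" "n ^ ?N - n \<in> P"
      using fermatP s n by auto
    \<comment> \<open>Up to the defect of additivity, the product is \<open>x ^ ?N\<close> times
      \<open>s ^ ?N - s\<close>, minus \<open>n ^ ?N - n\<close>; both differences lie in
      \<open>P\<close> by the congruence \<open>fermat\<close> for the trace \<open>s\<close> and
      the norm \<open>n\<close>.\<close>
    have "(x ^ ?N - x) * (x ^ ?N - \<tau> x) =
      x ^ ?N * (s ^ ?N - s) - x ^ ?N * ((x + \<tau> x) ^ ?N - (x ^ ?N + \<tau> x ^ ?N)) - (n ^ ?N - n)"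
      by (simp add: s_def n_def algebra_simps power_mult_distrib)
    also have "\<dots> \<in> P"
      by (intro P.prime_diff[OF P.prime_diff[OF P.prime_mult[OF 2(1)] P.prime_mult[OF 1]] 2(2)] E.power_int x)
    finally show ?thesis
      using x tx by (intro P.prime_prime) auto
  qed
  have "(\<forall>x\<in>?O. x ^ ?N - x \<in> P) \<or> (\<forall>x\<in>?O. x ^ ?N - \<tau> x \<in> P)"
  proof (rule ccontr)
    assume "\<not> ?thesis"
    then obtain x y where x: "x \<in> ?O" "x ^ ?N - x \<notin> P" and y: "y \<in> ?O" "y ^ ?N - \<tau> y \<notin> P"
      by blast
    have x': "x ^ ?N - \<tau> x \<in> P" and y': "y ^ ?N - y \<in> P"
      using root x y by auto
    have xy: "(x + y) ^ ?N - (x ^ ?N + y ^ ?N) \<in> P"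
      by (rule P.freshman[OF l(1) lP x(1) y(1)])
    have e: "x ^ ?N - x = ((x + y) ^ ?N - (x + y)) - ((x + y) ^ ?N - (x ^ ?N + y ^ ?N)) - (y ^ ?N - y)"
      "y ^ ?N - \<tau> y = ((x + y) ^ ?N - \<tau> (x + y)) - ((x + y) ^ ?N - (x ^ ?N + y ^ ?N)) - (x ^ ?N - \<tau> x)"
      using x y by (simp_all add: gal_add[OF \<tau>(1)] E_Qbar ring_of_integers_def)
    have "(x + y) ^ ?N - (x + y) \<notin> P"
      using x(2) P.prime_diff[OF P.prime_diff[OF _ xy] y'] unfolding e(1) by blast
    moreover have "(x + y) ^ ?N - \<tau> (x + y) \<notin> P"
      using y(2) P.prime_diff[OF P.prime_diff[OF _ xy] x'] unfolding e(2) by blast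
    ultimately show False
      using root x y by blast
  qed
  then have "\<exists>\<sigma>\<in>Gal. \<forall>x\<in>?O. x ^ ?N - \<sigma> x \<in> P"
  proof
    \<comment> \<open>An element acting trivially on \<open>E\<close> is wanted;
      \<open>\<tau>\<close> composed with itself is one.\<close>
    obtain \<iota> where "\<iota> \<in> Gal" "\<iota> \<delta> = \<delta>"
      using gal_compose(2)[OF \<tau>(1) \<tau>(1)] tau_tau[OF \<tau> delta_mem_E] delta_Qbar
      by (metis compose_eq)
    then have "\<iota> x = x" if "x \<in> ?O" for x
      using that by (auto simp: ring_of_integers_def E_def)
    moreover assume "\<forall>x\<in>?O. x ^ ?N - x \<in> P"
    ultimately show ?thesis
      using \<open>\<iota> \<in> Gal\<close> by (intro bexI[of _ \<iota>]) auto
  qed (use \<tau> in blast)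
  then obtain \<sigma> where \<sigma>: "\<sigma> \<in> Gal" "\<And>x. x \<in> ?O \<Longrightarrow> x ^ ?N - \<sigma> x \<in> P"
    by blast
  then have "\<sigma> \<in> frobenius_elements F E P"
    using prime_below(4)[OF P] N P.prime_minus_commute by (auto simp: frobenius_elements_def)
  then show ?thesis
    by blast
qed

text \<open>Existence of a prime above \<open>p\<close> and of Frobenius elements gives the SOME in
  \<open>frobenius_value\<close> a meaning. Whatever it picks satisfies the Frobenius congruence
  modulo some \<open>P\<close>, and later lemmas compute the character from that congruence.\<close>

lemma frobenius_value_unramified:
  assumes "unramified_at F \<psi> p" "primes_above F E p \<noteq> {}"
    "\<And>P. P \<in> primes_above F E p \<Longrightarrow> frobenius_elements F E P \<noteq> {}"
  obtains P \<sigma> where "P \<in> primes_above F E p" "\<sigma> \<in> Gal"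
    "\<And>x. x \<in> \<O> E \<Longrightarrow> \<sigma> x - x ^ ideal_norm F p \<in> P" "frobenius_value F \<psi> p = \<psi> \<sigma>"
proof -
  define \<sigma> where "\<sigma> = (SOME \<sigma>. \<exists>P \<in> primes_above F E p. \<sigma> \<in> frobenius_elements F E P)"
  have "\<exists>\<sigma>. \<exists>P \<in> primes_above F E p. \<sigma> \<in> frobenius_elements F E P"
    using assms(2,3) by blast
  then have "\<exists>P \<in> primes_above F E p. \<sigma> \<in> frobenius_elements F E P"
    unfolding \<sigma>_def by (rule someI_ex)
  then obtain P where P: "P \<in> primes_above F E p" "\<sigma> \<in> frobenius_elements F E P"
    by blast
  moreover have "frobenius_value F \<psi> p = \<psi> \<sigma>"
    using assms(1) by (simp add: frobenius_value_def fixed_field_psi \<sigma>_def)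
  ultimately show ?thesis
    using that prime_below(4)[OF P(1)] by (auto simp: frobenius_elements_def)
qed

text \<open>For integral \<open>x\<close> in \<open>E\<close>, the difference
  \<open>\<tau> x - x\<close> has the form \<open>v * \<delta>\<close> with \<open>v\<close> in
  \<open>F\<close>, and its square is the trace squared minus four times the norm. If all such
  discriminants lie in \<open>p\<close>, then \<open>\<tau>\<close> belongs to the inertia group
  although its character value is \<open>- 1\<close>.\<close>

lemma frobenius_value_ramified:
  assumes "primes_above F E p \<noteq> {}"
    and ram: "\<And>v s n. v \<in> F \<Longrightarrow> s \<in> \<O> F \<Longrightarrow> n \<in> \<O> F \<Longrightarrow>
      v ^ 2 * \<delta> ^ 2 = s ^ 2 - 4 * n \<Longrightarrow> v ^ 2 * \<delta> ^ 2 \<in> p"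
  shows "frobenius_value F \<psi> p = 0"
proof -
  obtain P where P: "P \<in> primes_above F E p"
    using assms(1) by blast
  interpret P: integral_prime E P
    using prime_below(1)[OF P] .
  obtain \<tau> where \<tau>: "\<tau> \<in> Gal" "\<tau> \<delta> = - \<delta>"
    using ex_tau by metis
  have "\<tau> x - x \<in> P" if x: "x \<in> \<O> E" for x
  proof -
    define v where "v = (\<tau> x - x) / \<delta>"
    note tx = tau_int[OF \<tau> x]
    have xE: "x \<in> E" "\<tau> x \<in> E" "x \<in> Qbar" "\<tau> x \<in> Qbar"
      using x tx by (auto simp: ring_of_integers_def E_Qbar)
    have d: "\<tau> (inverse \<delta>) = - inverse \<delta>"
      using gal_inverse[OF \<tau>(1) delta_Qbar] \<tau>(2) by simp
    have v: "v = (\<tau> x - x) * inverse \<delta>"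
      by (simp add: v_def field_simps)
    \<comment> \<open>Numerator and denominator of \<open>v\<close> both change sign.\<close>
    have "\<tau> v = v"
      unfolding v using xE d delta_Qbar by (simp add: gal_mult[OF \<tau>(1)] gal_diff[OF \<tau>(1)] Qbar_closed tau_tau[OF \<tau>] algebra_simps)
    moreover have "v \<in> E"
      unfolding v_def using xE delta_mem_E by blast
    ultimately have "v \<in> F"
      by (intro tau_invariant[OF \<tau>])
    moreover have eq: "v ^ 2 * \<delta> ^ 2 = (\<tau> x - x) ^ 2"
      by (simp add: v_def power_divide)
    moreover have "(\<tau> x - x) ^ 2 = (x + \<tau> x) ^ 2 - 4 * (x * \<tau> x)"
      by (simp add: power2_eq_square algebra_simps)
    ultimately have "(\<tau> x - x) ^ 2 \<in> p"
      using ram[of v, OF _ trace_int[OF \<tau> x] norm_int[OF \<tau> x]] by simp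
    then have "(\<tau> x - x) ^ 2 \<in> P"
      using prime_below(3)[OF P] by blast
    then show ?thesis
      using P.prime_power x tx by blast
  qed
  then have "\<tau> \<in> inertia_group F E P"
    using \<tau> by (simp add: inertia_group_def)
  moreover have "\<psi> \<tau> \<noteq> 1"
    using \<tau> by (simp add: \<psi>_def)
  ultimately have "\<not> unramified_at F \<psi> p"
    using P by (auto simp: unramified_at_def fixed_field_psi)
  then show ?thesis
    by (simp add: frobenius_value_def)
qed

lemma square_int:
  assumes "\<delta>1 \<in> \<O> E" "v \<in> F" "\<delta>1 = v * \<delta>"
  shows "\<delta>1 ^ 2 \<in> \<O> F"
proof -
  have "\<delta>1 ^ 2 \<in> F"
    using assms(2) delta_square unfolding assms(3) power_mult_distrib by blast
  then show ?thesis
    using assms(1) by (simp add: ring_of_integers_def algebraic_int_power)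
qed

text \<open>An inertia element negating \<open>\<delta>\<close> would put twice
  \<open>\<delta>1\<close> into \<open>P\<close>. The freedom to choose the multiple
  \<open>\<delta>1\<close> handles unramified primes that contain
  \<open>\<delta> ^ 2\<close>.\<close>

lemma tame_unramified:
  assumes "\<delta>1 \<in> \<O> E" "v \<in> F" "\<delta>1 = v * \<delta>" "\<delta>1 ^ 2 \<notin> p" "2 \<notin> p"
  shows "unramified_at F \<psi> p"
  unfolding unramified_at_def fixed_field_psi
proof (intro ballI)
  fix P \<sigma> assume P: "P \<in> primes_above F E p" and \<sigma>: "\<sigma> \<in> inertia_group F E P"
  interpret P: integral_prime E P
    using prime_below(1)[OF P] .
  have \<sigma>': "\<sigma> \<in> Gal" "\<sigma> \<delta>1 - \<delta>1 \<in> P"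
    using \<sigma> assms(1) by (auto simp: inertia_group_def)
  have vQ: "v \<in> Qbar" using assms(2) subset_Qbar by blast
  note d1 = square_int[OF assms(1-3)]
  show "\<psi> \<sigma> = 1"
  proof (rule ccontr)
    assume "\<psi> \<sigma> \<noteq> 1"
    then have "\<sigma> \<delta> = - \<delta>"
      using psi_cases[OF \<sigma>'(1)] by auto
    then have "\<sigma> \<delta>1 = - \<delta>1"
      using gal_mult[OF \<sigma>'(1) vQ delta_Qbar] gal_fix[OF \<sigma>'(1) assms(2)] assms(3) by simp
    then have "(- 2) * \<delta>1 \<in> P"
      using \<sigma>'(2) by simp
    then have "- 2 \<in> P \<or> \<delta>1 \<in> P"
      using assms(1) E.of_int_int[of "- 2"] by (intro P.prime_prime) auto
    moreover have "(2::complex) \<in> \<O> F"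
      using of_nat_int[of 2] by simp
    ultimately show False
      using P.prime_mult[of \<delta>1 \<delta>1] P.prime_uminus[of "- 2"] prime_below(2)[OF P] d1 assms(1,4,5)
      by (auto simp: power2_eq_square)
  qed
qed

text \<open>Euler's criterion: \<open>\<sigma>\<close> multiplies \<open>\<delta>1\<close> by
  \<open>\<psi> \<sigma>\<close>, and the Frobenius congruence at \<open>\<delta>1\<close> may be
  divided by \<open>\<delta>1\<close>, which is outside \<open>P\<close>.\<close>

lemma tame_frobenius:
  assumes P: "P \<in> primes_above F E p" and \<sigma>: "\<sigma> \<in> Gal"
    and frob: "\<And>x. x \<in> \<O> E \<Longrightarrow> \<sigma> x - x ^ N \<in> P" and N: "odd N"
    and d1: "\<delta>1 \<in> \<O> E" "v \<in> F" "\<delta>1 = v * \<delta>" "\<delta>1 ^ 2 \<notin> p"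
  shows "(\<delta>1 ^ 2) ^ ((N - 1) div 2) - \<psi> \<sigma> \<in> p"
proof -
  interpret P: integral_prime E P
    using prime_below(1)[OF P] .
  have vQ: "v \<in> Qbar" using d1 subset_Qbar by blast
  note d1F = square_int[OF d1(1-3)]
  have "\<sigma> \<delta>1 = \<psi> \<sigma> * \<delta>1"
    using gal_mult[OF \<sigma> vQ delta_Qbar] gal_fix[OF \<sigma> d1(2)] d1(3) by (simp add: \<psi>_def)
  moreover have "\<delta>1 ^ N = (\<delta>1 ^ 2) ^ ((N - 1) div 2) * \<delta>1"
  proof -
    have "N = 2 * ((N - 1) div 2) + 1"
      using N by (elim oddE) simp
    then have "\<delta>1 ^ N = \<delta>1 ^ (2 * ((N - 1) div 2) + 1)"
      by simp
    then show ?thesis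
      by (simp add: power_mult)
  qed
  ultimately have "((\<delta>1 ^ 2) ^ ((N - 1) div 2) - \<psi> \<sigma>) * \<delta>1 \<in> P"
    using P.prime_minus_commute[OF frob[OF d1(1)]] by (simp add: algebra_simps)
  moreover have "\<psi> \<sigma> \<in> \<O> F"
    using psi_cases[OF \<sigma>] uminus_int[OF one_int] by auto
  then have "(\<delta>1 ^ 2) ^ ((N - 1) div 2) - \<psi> \<sigma> \<in> \<O> F"
    using d1F by auto
  moreover have "\<delta>1 \<notin> P"
    using P.prime_mult[of \<delta>1 \<delta>1] prime_below(2)[OF P d1F] d1 by (auto simp: power2_eq_square)
  ultimately show ?thesis
    using P.prime_prime[of "(\<delta>1 ^ 2) ^ ((N - 1) div 2) - \<psi> \<sigma>" \<delta>1] d1(1) int_F_subset_E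
      prime_below(2)[OF P] by blast
qed

text \<open>At primes containing 2 an Artin-Schreier type equation replaces the square root. Its
  roots \<open>x\<close> and \<open>b - x\<close> stay distinct modulo \<open>P\<close>, so inertia
  cannot swap them. Moreover \<open>x ^ 2\<close> is congruent to \<open>x - c\<close>, so a
  Frobenius element fixes \<open>x\<close> exactly when \<open>c\<close> lies in
  \<open>p\<close>.\<close>

lemma dyadic_unramified:
  assumes x: "x \<in> \<O> E" "x \<notin> F" and b: "b \<in> \<O> F" "b - 1 \<in> p"
    and c: "c \<in> \<O> F" and eq: "x ^ 2 - b * x + c = 0" and two: "2 \<in> p"
  shows "unramified_at F \<psi> p"
    and "P \<in> primes_above F E p \<Longrightarrow> \<sigma> \<in> Gal \<Longrightarrow> \<sigma> x - x ^ 2 \<in> P \<Longrightarrow> \<psi> \<sigma> = (if c \<in> p then 1 else - 1)"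
proof -
  have xE: "x \<in> E" "x \<in> Qbar" and bF: "b \<in> F" "b \<in> Qbar" and cF: "c \<in> F" "c \<in> Qbar"
    using x b c subset_Qbar by (auto simp: ring_of_integers_def E_Qbar)
  have act: "\<psi> \<sigma> = 1 \<and> \<sigma> x = x \<or> \<psi> \<sigma> = - 1 \<and> \<sigma> x = b - x" if \<sigma>: "\<sigma> \<in> Gal" for \<sigma>
  proof -
    obtain \<tau> where \<tau>: "\<tau> \<in> Gal" "\<tau> \<delta> = - \<delta>"
      using ex_tau by metis
    have "\<tau> (x ^ 2 - b * x + c) = \<tau> x ^ 2 - b * \<tau> x + c"
      using xE bF cF
      by (simp add: gal_add[OF \<tau>(1)] gal_diff[OF \<tau>(1)] gal_mult[OF \<tau>(1)] gal_fix[OF \<tau>(1)] Qbar_closed power2_eq_square)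
    then have "\<tau> x ^ 2 - b * \<tau> x + c = 0"
      using gal_fix[OF \<tau>(1) zero_mem] eq by simp
    \<comment> \<open>\<open>\<tau> x\<close> solves the same quadratic equation; being different
      from \<open>x\<close>, it is the other root.\<close>
    moreover have "(\<tau> x - x) * (\<tau> x - (b - x)) = (\<tau> x ^ 2 - b * \<tau> x + c) - (x ^ 2 - b * x + c)"
      by (simp add: power2_eq_square algebra_simps)
    ultimately have "(\<tau> x - x) * (\<tau> x - (b - x)) = 0"
      using eq by simp
    moreover have "\<tau> x \<noteq> x"
      using tau_invariant[OF \<tau> xE(1)] x(2) by blast
    ultimately have "\<tau> x = b - x" by simp
    then show ?thesis
      using gal_E_cases[OF \<tau> \<sigma> xE(1)] by auto
  qed
  have notin: "b - 2 * x \<notin> P" if P: "P \<in> primes_above F E p" for P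
  proof
    interpret P: integral_prime E P
      using prime_below(1)[OF P] .
    assume "b - 2 * x \<in> P"
    moreover have "2 * x \<in> P"
      using two prime_below(3)[OF P] x by (intro P.prime_mult') auto
    moreover have "b - 1 \<in> P"
      using b(2) prime_below(3)[OF P] by auto
    ultimately have "(b - 2 * x) + 2 * x - (b - 1) \<in> P"
      by (rule P.prime_diff[OF P.prime_add])
    then show False by simp
  qed
  show "unramified_at F \<psi> p"
    unfolding unramified_at_def fixed_field_psi
  proof (intro ballI)
    fix P \<sigma> assume P: "P \<in> primes_above F E p" and \<sigma>: "\<sigma> \<in> inertia_group F E P"
    then have \<sigma>': "\<sigma> \<in> Gal" "\<sigma> x - x \<in> P"
      using x by (auto simp: inertia_group_def)
    then show "\<psi> \<sigma> = 1"
      using act[OF \<sigma>'(1)] notin[OF P] by auto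
  qed
  show "\<psi> \<sigma> = (if c \<in> p then 1 else - 1)"
    if P: "P \<in> primes_above F E p" and \<sigma>: "\<sigma> \<in> Gal" "\<sigma> x - x ^ 2 \<in> P"
  proof -
    interpret P: integral_prime E P
      using prime_below(1)[OF P] .
    have bP: "b - 1 \<in> P" and twoP: "2 * x \<in> P"
      using b(2) two prime_below(3)[OF P] x by (auto intro: P.prime_mult')
    have "x * (b - 1) \<in> P"
      using bP x(1) by (rule P.prime_mult)
    have x2: "x ^ 2 = b * x - c"
      using eq by (simp add: algebra_simps)
    show ?thesis
      using act[OF \<sigma>(1)]
    proof (elim disjE conjE)
      assume s: "\<psi> \<sigma> = 1" "\<sigma> x = x"
      have "c = (\<sigma> x - x ^ 2) + x * (b - 1)"
        unfolding s x2 by (simp add: algebra_simps)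
      then have "c \<in> P"
        using P.prime_add \<sigma>(2) \<open>x * (b - 1) \<in> P\<close> by metis
      then show ?thesis
        using s prime_below(2)[OF P c] by simp
    next
      assume s: "\<psi> \<sigma> = - 1" "\<sigma> x = b - x"
      have "1 + c = (\<sigma> x - x ^ 2) + x * (b - 1) + 2 * x - (b - 1)"
        unfolding s x2 by (simp add: algebra_simps)
      also have "\<dots> \<in> P"
        by (rule P.prime_diff[OF P.prime_add[OF P.prime_add[OF \<sigma>(2) \<open>x * (b - 1) \<in> P\<close>] twoP] bP])
      finally have "c \<notin> P"
        using P.prime_diff[of "1 + c" c] by auto
      then show ?thesis
        using s prime_below(2)[OF P c] by simp
    qed
  qed
qed

end

subsection \<open>Quadratic fields\<close>

text \<open>\<open>t\<close> and \<open>n\<close> are the trace and norm of \<open>\<omega>\<close>,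
  and the last assumption makes \<open>1, \<omega>\<close> an integral basis. The instances are the
  Gaussian integers with \<open>t = 0\<close>, \<open>n = 1\<close> and the integers of the field of
  the square root of \<open>q\<close> with \<open>t = 1\<close>,
  \<open>n = (1 - q) / 4\<close>.\<close>

locale quadratic_order =
  fixes \<omega> :: complex and t n :: int
  assumes omega_square: "\<omega> ^ 2 = of_int t * \<omega> - of_int n"
    and omega_irrational: "\<omega> \<notin> \<rat>"
    and integrally_closed:
      "a \<in> \<rat> \<Longrightarrow> b \<in> \<rat> \<Longrightarrow> algebraic_int (a + b * \<omega>) \<Longrightarrow> a \<in> \<int> \<and> b \<in> \<int>"
begin

definition F :: "complex set" where
  "F = {a + b * \<omega> | a b. a \<in> \<rat> \<and> b \<in> \<rat>}"

definition elem :: "int \<Rightarrow> int \<Rightarrow> complex" where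
  "elem a b = of_int a + of_int b * \<omega>"

lemma omega_int: "algebraic_int \<omega>"
proof
  have "poly [:of_int n, - of_int t, 1:] \<omega> = \<omega> ^ 2 - of_int t * \<omega> + of_int n"
    by (simp add: algebra_simps power2_eq_square)
  then show "poly [:of_int n, - of_int t, 1:] \<omega> = 0"
    by (simp add: omega_square)
qed (auto simp: coeff_pCons split: nat.splits)

lemma rat_combination_unique:
  assumes "a \<in> \<rat>" "b \<in> \<rat>" "c \<in> \<rat>" "d \<in> \<rat>" "a + b * \<omega> = c + d * \<omega>"
  shows "a = c \<and> b = d"
proof -
  have "(b - d) * \<omega> = c - a"
    using assms(5) by (simp add: algebra_simps)
  then have "b - d \<noteq> 0 \<Longrightarrow> \<omega> = (c - a) / (b - d)"
    by (simp add: field_simps)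
  then have "b = d"
    using omega_irrational assms(1-4) by (metis Rats_diff Rats_divide right_minus_eq)
  then show ?thesis
    using assms(5) by simp
qed

lemma elem_eq_iff: "elem a b = elem c d \<longleftrightarrow> a = c \<and> b = d"
  using rat_combination_unique[of "of_int a" "of_int b" "of_int c" "of_int d"] by (auto simp: elem_def)

lemma elem_add: "elem a b + elem c d = elem (a + c) (b + d)"
  and elem_diff: "elem a b - elem c d = elem (a - c) (b - d)"
  by (simp_all add: elem_def algebra_simps)

lemma elem_mult: "elem a b * elem c d = elem (a * c - n * b * d) (a * d + b * c + t * b * d)"
proof -
  have "elem a b * elem c d = of_int (a * c) + of_int (a * d + b * c) * \<omega> + of_int (b * d) * \<omega> ^ 2"
    by (simp add: elem_def algebra_simps power2_eq_square)
  then show ?thesis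
    by (simp add: omega_square elem_def algebra_simps)
qed

lemma elem_of_int: "of_int a = elem a 0" and elem_of_nat: "of_nat k = elem (int k) 0"
  by (simp_all add: elem_def)

sublocale algebraic_subfield F
proof
  have rat: "a + b * \<omega> \<in> F" if "a \<in> \<rat>" "b \<in> \<rat>" for a b
    using that by (auto simp: F_def)
  have E: "\<exists>a b. x = a + b * \<omega> \<and> a \<in> \<rat> \<and> b \<in> \<rat>" if "x \<in> F" for x
    using that by (auto simp: F_def)
  show "F \<subseteq> Qbar"
    by (auto simp: F_def Qbar_def intro!: algebraic_add[OF rat_imp_algebraic
        algebraic_mult[OF rat_imp_algebraic algebraic_int_imp_algebraic[OF omega_int]]])
  show "1 \<in> F"
    using rat[of 1 0] by simp
  fix x assume "x \<in> F"
  then obtain a b where x: "x = a + b * \<omega>" "a \<in> \<rat>" "b \<in> \<rat>" using E by blast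
  show "- x \<in> F"
    using rat[of "- a" "- b"] x by (simp add: x(1))
  show "inverse x \<in> F"
  proof (cases "x = 0")
    case False
    define N where "N = a ^ 2 + of_int t * a * b + of_int n * b ^ 2"
    have N: "x * ((a + of_int t * b) + (- b) * \<omega>) = N"
    proof -
      have "x * ((a + of_int t * b) + (- b) * \<omega>) = a ^ 2 + of_int t * a * b + of_int t * b ^ 2 * \<omega> - b ^ 2 * \<omega> ^ 2"
        by (simp add: x algebra_simps power2_eq_square)
      then show ?thesis
        by (simp add: omega_square N_def algebra_simps)
    qed
    have "(a + of_int t * b) + (- b) * \<omega> \<noteq> 0"
    proof
      assume "(a + of_int t * b) + (- b) * \<omega> = 0"
      then have "(a + of_int t * b) + (- b) * \<omega> = 0 + 0 * \<omega>"
        by (simp only: mult_zero_left add_0_right)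
      then have "a + of_int t * b = 0 \<and> - b = 0"
        by (rule rat_combination_unique[rotated 4]) (use x in auto)
      then have "b = 0" "a = 0" by auto
      with False show False by (simp add: x(1))
    qed
    then have "N \<noteq> 0"
      using N False by auto
    have "inverse x = ((a + of_int t * b) + (- b) * \<omega>) / N"
      using N False \<open>N \<noteq> 0\<close> by (metis divide_inverse inverse_unique mult.assoc right_inverse)
    also have "\<dots> = (a + of_int t * b) / N + (- b / N) * \<omega>"
      by (simp add: add_divide_distrib diff_divide_distrib)
    also have "\<dots> \<in> F"
      using x by (intro rat) (auto simp: N_def)
    finally show ?thesis .
  qed (use rat[of 0 0] in simp)
  fix y assume "y \<in> F"
  then obtain c d where y: "y = c + d * \<omega>" "c \<in> \<rat>" "d \<in> \<rat>" using E by blast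
  have "x + y = (a + c) + (b + d) * \<omega>"
    by (simp add: x y algebra_simps)
  also have "\<dots> \<in> F"
    using x y by (intro rat) auto
  finally show "x + y \<in> F" .
  have "x * y = a * c + (a * d + b * c) * \<omega> + (b * d) * \<omega> ^ 2"
    by (simp add: x y algebra_simps power2_eq_square)
  also have "\<dots> = (a * c - of_int n * (b * d)) + (a * d + b * c + of_int t * (b * d)) * \<omega>"
    by (simp add: omega_square algebra_simps)
  also have "\<dots> \<in> F"
    using x y by (intro rat) auto
  finally show "x * y \<in> F" .
qed

lemma ring_of_integers_F: "\<O> F = {elem a b | a b. True}"
proof
  show "\<O> F \<subseteq> {elem a b | a b. True}"
  proof
    fix x assume x: "x \<in> \<O> F"
    then obtain a b where ab: "x = a + b * \<omega>" "a \<in> \<rat>" "b \<in> \<rat>"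
      by (auto simp: ring_of_integers_def F_def)
    then have "a \<in> \<int>" "b \<in> \<int>"
      using integrally_closed x by (auto simp: ring_of_integers_def)
    then show "x \<in> {elem a b | a b. True}"
      unfolding ab elem_def by (auto elim!: Ints_cases)
  qed
  have "elem a b \<in> F" for a b
    unfolding elem_def F_def by (intro CollectI exI conjI) auto
  moreover have "algebraic_int (elem a b)" for a b
    unfolding elem_def
    by (intro algebraic_int_add algebraic_int_mult omega_int int_imp_algebraic_int) auto
  ultimately show "{elem a b | a b. True} \<subseteq> \<O> F"
    by (auto simp: ring_of_integers_def)
qed

lemma elem_int [simp, intro]: "elem a b \<in> \<O> F"
  unfolding ring_of_integers_F by blast

lemma elem_cases: "x \<in> \<O> F \<Longrightarrow> \<exists>a b. x = elem a b"
  unfolding ring_of_integers_F by blast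

definition nrm :: "int \<Rightarrow> int \<Rightarrow> int" where
  "nrm a b = a ^ 2 + t * a * b + n * b ^ 2"

lemma elem_conj: "elem a b * elem (a + t * b) (- b) = of_int (nrm a b)"
  unfolding elem_mult nrm_def elem_of_int elem_eq_iff by (simp add: algebra_simps power2_eq_square)

lemma nrm_mult: "nrm (a * c - n * b * d) (a * d + b * c + t * b * d) = nrm a b * nrm c d"
  unfolding nrm_def by (simp add: algebra_simps power2_eq_square)

definition root_mod :: "nat \<Rightarrow> int \<Rightarrow> bool" where
  "root_mod p r \<longleftrightarrow> int p dvd r ^ 2 - t * r + n"

text \<open>The kernel of the reduction modulo \<open>p\<close> that sends \<open>\<omega>\<close>
  to \<open>r\<close>. When \<open>root_mod p r\<close> holds, it is the ideal generated by
  \<open>p\<close> and \<open>\<omega> - r\<close>.\<close>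

definition deg1_prime :: "nat \<Rightarrow> int \<Rightarrow> complex set" where
  "deg1_prime p r = {elem a b | a b. int p dvd a + b * r}"

definition deg2_prime :: "nat \<Rightarrow> complex set" where
  "deg2_prime p = {elem a b | a b. int p dvd a \<and> int p dvd b}"

lemma elem_mem_deg1 [simp]: "elem a b \<in> deg1_prime p r \<longleftrightarrow> int p dvd a + b * r"
  by (auto simp: deg1_prime_def elem_eq_iff)

lemma elem_mem_deg2 [simp]: "elem a b \<in> deg2_prime p \<longleftrightarrow> int p dvd a \<and> int p dvd b"
  by (auto simp: deg2_prime_def elem_eq_iff)

lemma mem_deg1_int: "x \<in> deg1_prime p r \<Longrightarrow> x \<in> \<O> F"
  and mem_deg2_int: "x \<in> deg2_prime p \<Longrightarrow> x \<in> \<O> F"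
  by (auto simp: deg1_prime_def deg2_prime_def)

lemma of_int_mem_deg1 [simp]: "of_int a \<in> deg1_prime p r \<longleftrightarrow> int p dvd a"
  and of_int_mem_deg2 [simp]: "of_int a \<in> deg2_prime p \<longleftrightarrow> int p dvd a"
  by (simp_all add: elem_of_int)

section \<open>Primes above a rational prime, their norms and their power maps\<close>

lemma root_mod_conj: "root_mod p r \<Longrightarrow> root_mod p (t - r)"
  by (simp add: root_mod_def power2_eq_square algebra_simps)

lemma deg1_prime_cong: "int p dvd r - r' \<Longrightarrow> deg1_prime p r = deg1_prime p r'"
proof -
  assume "int p dvd r - r'"
  then have "int p dvd (a + b * r) - (a + b * r')" for a b
    by (simp flip: right_diff_distrib)
  then have "int p dvd a + b * r \<longleftrightarrow> int p dvd a + b * r'" for a b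
    using dvd_diff_left_iff by (metis dvd_add_right_iff diff_add_cancel)
  then show ?thesis
    by (simp add: deg1_prime_def)
qed

context
  fixes p :: nat assumes p: "prime p"
begin

lemma prime_int_p: "prime (int p)"
  using p by simp

lemma deg1_prime_mem:
  assumes r: "root_mod p r"
  shows "deg1_prime p r \<in> primes_of F"
  unfolding mem_primes_of_iff
proof (intro conjI ballI impI)
  \<comment> \<open>Evaluation at \<open>r\<close> respects products modulo \<open>p\<close> because
    \<open>r\<close> is a root of the polynomial of \<open>\<omega>\<close>.\<close>
  have ev: "int p dvd (a * c - n * b * d) + (a * d + b * c + t * b * d) * r - (a + b * r) * (c + d * r)"
    for a b c d
  proof -
    have "(a * c - n * b * d) + (a * d + b * c + t * b * d) * r - (a + b * r) * (c + d * r) =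
      - (b * d) * (r ^ 2 - t * r + n)"
      by (simp add: algebra_simps power2_eq_square)
    then show ?thesis
      using r by (simp add: root_mod_def)
  qed
  have ev': "int p dvd (a * c - n * b * d) + (a * d + b * c + t * b * d) * r \<longleftrightarrow>
      int p dvd (a + b * r) * (c + d * r)" for a b c d
    using ev[of a c b d] by (metis dvd_add_right_iff diff_add_cancel)
  show "deg1_prime p r \<subseteq> \<O> F"
    by (auto simp: deg1_prime_def)
  show "0 \<in> deg1_prime p r" "1 \<notin> deg1_prime p r"
    using of_int_mem_deg1[of 0 p r] of_int_mem_deg1[of 1 p r] p by (simp_all add: prime_nat_iff)
  have "of_int (int p) \<in> deg1_prime p r" "of_int (int p) \<noteq> (0 :: complex)"
    using prime_gt_0_nat[OF p] by (simp_all only: of_int_mem_deg1 dvd_refl of_int_eq_0_iff)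
  then show "deg1_prime p r \<noteq> {0}"
    by blast
  show "x + y \<in> deg1_prime p r" if xy: "x \<in> deg1_prime p r" "y \<in> deg1_prime p r" for x y
  proof -
    obtain a b c d where *: "x = elem a b" "y = elem c d" "int p dvd a + b * r" "int p dvd c + d * r"
      using xy by (auto simp: deg1_prime_def)
    show ?thesis
      using dvd_add[OF *(3,4)] by (simp add: * elem_add algebra_simps)
  qed
  show "y * x \<in> deg1_prime p r" if xy: "x \<in> deg1_prime p r" "y \<in> \<O> F" for x y
  proof -
    obtain a b where x: "x = elem a b" "int p dvd a + b * r"
      using xy by (auto simp: deg1_prime_def)
    obtain c d where y: "y = elem c d"
      using elem_cases[OF xy(2)] by blast
    show ?thesis
      using x unfolding x(1) y elem_mult elem_mem_deg1 ev' by simp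
  qed
  show "x \<in> deg1_prime p r \<or> y \<in> deg1_prime p r"
    if xy: "x \<in> \<O> F" "y \<in> \<O> F" "x * y \<in> deg1_prime p r" for x y
  proof -
    obtain a b c d where *: "x = elem a b" "y = elem c d"
      using elem_cases xy by meson
    show ?thesis
      using xy(3) unfolding * elem_mult elem_mem_deg1 ev'
      using prime_dvd_multD[OF prime_int_p] by blast
  qed
qed

text \<open>If \<open>b\<close> were invertible modulo \<open>p\<close>, then \<open>- a / b\<close>
  would be a root of the polynomial of \<open>\<omega>\<close>. So the norm form is anisotropic
  modulo an inert prime.\<close>

lemma deg2_if_nrm:
  assumes noroot: "\<And>r. \<not> root_mod p r" and dvd: "int p dvd nrm a b"
  shows "int p dvd a \<and> int p dvd b"
proof -
  have "int p dvd b"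
  proof (rule ccontr)
    assume "\<not> int p dvd b"
    then have "Rings.coprime b (int p)"
      using prime_imp_coprime[OF prime_int_p] by (simp add: coprime_commute)
    then obtain c where c: "[b * c = 1] (mod int p)"
      using cong_solve_coprime_int by blast
    define r where "r = - a * c"
    have "[b ^ 2 * (r ^ 2 - t * r + n) = (b * c * a) ^ 2 + t * (b * c * a) * b + n * b ^ 2] (mod int p)"
      by (simp add: r_def power2_eq_square algebra_simps)
    also have "[(b * c * a) ^ 2 + t * (b * c * a) * b + n * b ^ 2 = (1 * a) ^ 2 + t * (1 * a) * b + n * b ^ 2] (mod int p)"
      by (intro cong_add cong_mult cong_pow c cong_refl)
    also have "(1 * a) ^ 2 + t * (1 * a) * b + n * b ^ 2 = nrm a b"
      by (simp add: nrm_def)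
    finally have "int p dvd b ^ 2 * (r ^ 2 - t * r + n)"
      using dvd by (simp add: cong_dvd_iff)
    then have "root_mod p r"
      using \<open>\<not> int p dvd b\<close> prime_int_p unfolding root_mod_def
      by (metis prime_dvd_multD prime_dvd_power)
    then show False
      using noroot by blast
  qed
  then have "int p dvd nrm a b - (t * a + n * b) * b"
    using dvd by simp
  then have "int p dvd a ^ 2"
    by (simp add: nrm_def algebra_simps power2_eq_square)
  then show ?thesis
    using \<open>int p dvd b\<close> prime_dvd_power[OF prime_int_p] by blast
qed

lemma deg2_prime_mem:
  assumes noroot: "\<And>r. \<not> root_mod p r"
  shows "deg2_prime p \<in> primes_of F"
  unfolding mem_primes_of_iff
proof (intro conjI ballI impI)
  show "deg2_prime p \<subseteq> \<O> F"
    by (auto simp: deg2_prime_def)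
  show "0 \<in> deg2_prime p" "1 \<notin> deg2_prime p"
    using of_int_mem_deg2[of 0 p] of_int_mem_deg2[of 1 p] p by (simp_all add: prime_nat_iff)
  have "of_int (int p) \<in> deg2_prime p" "of_int (int p) \<noteq> (0 :: complex)"
    using prime_gt_0_nat[OF p] by (simp_all only: of_int_mem_deg2 dvd_refl of_int_eq_0_iff)
  then show "deg2_prime p \<noteq> {0}"
    by blast
  show "x + y \<in> deg2_prime p" if "x \<in> deg2_prime p" "y \<in> deg2_prime p" for x y
    using that by (auto simp: deg2_prime_def elem_add elem_eq_iff)
  show "y * x \<in> deg2_prime p" if xy: "x \<in> deg2_prime p" "y \<in> \<O> F" for x y
    using xy(1) elem_cases[OF xy(2)] by (auto simp: deg2_prime_def elem_mult elem_eq_iff)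
  show "x \<in> deg2_prime p \<or> y \<in> deg2_prime p"
    if xy: "x \<in> \<O> F" "y \<in> \<O> F" "x * y \<in> deg2_prime p" for x y
  proof -
    obtain a b c d where *: "x = elem a b" "y = elem c d"
      using elem_cases xy by meson
    have "int p dvd nrm (a * c - n * b * d) (a * d + b * c + t * b * d)"
      using xy(3) unfolding * elem_mult elem_mem_deg2 nrm_def by (simp add: power2_eq_square)
    then have "int p dvd nrm a b \<or> int p dvd nrm c d"
      unfolding nrm_mult using prime_dvd_multD[OF prime_int_p] by blast
    then show ?thesis
      unfolding * elem_mem_deg2 using deg2_if_nrm[OF noroot] by metis
  qed
qed

text \<open>By Bezout, a proper ideal containing \<open>p\<close> contains no integer coprime to it.
  The field \<open>L\<close> is arbitrary, so that both the quadratic field and its extension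
  \<open>E\<close> are covered.\<close>

lemma of_int_mem_prime_iff:
  assumes "integral_prime L P" "of_nat p \<in> P"
  shows "of_int a \<in> P \<longleftrightarrow> int p dvd a"
proof -
  interpret P: integral_prime L P by fact
  show ?thesis
  proof
    assume a: "of_int a \<in> P"
    show "int p dvd a"
    proof (rule ccontr)
      assume "\<not> int p dvd a"
      then have "Rings.coprime (int p) a"
        using prime_imp_coprime[OF prime_int_p] by blast
      then obtain u v where "u * int p + v * a = 1"
        using bezout_int[of "int p" a] by auto
      then have "of_int u * of_nat p + of_int v * of_int a = (1 :: complex)"
        by (metis of_int_1 of_int_add of_int_mult of_int_of_nat_eq)
      moreover have "of_int u * of_nat p + of_int v * of_int a \<in> P"
        by (intro P.prime_add P.prime_mult a assms(2)) auto
      ultimately show False by simp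
    qed
  next
    assume "int p dvd a"
    then obtain k where "a = int p * k" by blast
    then show "of_int a \<in> P"
      using P.prime_mult'[OF assms(2) P.of_int_int[of k]] by simp
  qed
qed

text \<open>The product of \<open>\<omega> - r\<close> and \<open>\<omega> - (t - r)\<close> is a
  multiple of \<open>p\<close>, so \<open>P\<close> contains a factor; knowing
  \<open>\<omega>\<close> modulo \<open>P\<close> then decides membership of every integer of the
  field.\<close>

lemma prime_over_cases:
  assumes P: "P \<in> primes_of F" "of_nat p \<in> P" and r: "root_mod p r"
  shows "P = deg1_prime p r \<or> P = deg1_prime p (t - r)"
proof -
  interpret P: integral_prime F P
    by unfold_locales fact
  have int: "of_int a \<in> P \<longleftrightarrow> int p dvd a" for a
    by (rule of_int_mem_prime_iff[OF P.integral_prime_axioms P(2)])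
  have eq: "P = deg1_prime p s" if s: "elem (- s) 1 \<in> P" for s
  proof -
    have "elem a b \<in> P \<longleftrightarrow> int p dvd a + b * s" for a b
    proof -
      have "elem a b - of_int (a + b * s) = of_int b * elem (- s) 1"
        by (simp add: elem_def algebra_simps)
      also have "\<dots> \<in> P"
        using s by (intro P.prime_mult) auto
      finally show ?thesis
        using P.prime_cong int by blast
    qed
    then have "x \<in> P \<longleftrightarrow> x \<in> deg1_prime p s" for x
      using P.prime_subset elem_cases by (metis elem_mem_deg1 mem_deg1_int)
    then show ?thesis
      by blast
  qed
  have "elem (- r) 1 * elem (- (t - r)) 1 = of_int (- (r ^ 2 - t * r + n))"
    unfolding elem_mult elem_of_int by (simp add: power2_eq_square algebra_simps)
  also have "\<dots> \<in> P"
    unfolding int using r by (simp only: root_mod_def dvd_minus_iff)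
  finally have "elem (- r) 1 \<in> P \<or> elem (- (t - r)) 1 \<in> P"
    by (intro P.prime_prime) auto
  then show ?thesis
    using eq by blast
qed

lemma prime_over_inert:
  assumes P: "P \<in> primes_of F" "of_nat p \<in> P" and noroot: "\<And>r. \<not> root_mod p r"
  shows "P = deg2_prime p"
proof -
  interpret P: integral_prime F P
    by unfold_locales fact
  have int: "of_int a \<in> P \<longleftrightarrow> int p dvd a" for a
    by (rule of_int_mem_prime_iff[OF P.integral_prime_axioms P(2)])
  have "elem a b \<in> P \<longleftrightarrow> int p dvd a \<and> int p dvd b" for a b
  proof
    assume "elem a b \<in> P"
    then have "of_int (nrm a b) \<in> P"
      unfolding elem_conj[symmetric] by (intro P.prime_mult') auto
    then show "int p dvd a \<and> int p dvd b"
      using deg2_if_nrm[OF noroot] int by blast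
  next
    assume "int p dvd a \<and> int p dvd b"
    then have "of_int a \<in> P" "of_int b * elem 0 1 \<in> P"
      using int by (auto intro: P.prime_mult')
    then show "elem a b \<in> P"
      using P.prime_add by (fastforce simp: elem_def)
  qed
  then have "x \<in> P \<longleftrightarrow> x \<in> deg2_prime p" for x
    using P.prime_subset elem_cases by (metis elem_mem_deg2 mem_deg2_int)
  then show ?thesis
    by blast
qed

lemma ideal_norm_deg1:
  assumes r: "root_mod p r"
  shows "ideal_norm F (deg1_prime p r) = p"
proof -
  have p0: "int p > 0" using p prime_gt_0_nat by simp
  define S :: "complex set" where "S = of_int ` {0..<int p}"
  have "ideal_norm F (deg1_prime p r) = card S"
  proof (rule ideal_norm_eq_card)
    show "deg1_prime p r \<in> primes_of F" by (rule deg1_prime_mem[OF r])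
    show "finite S" "S \<subseteq> \<O> F" by (auto simp: S_def)
    fix x assume "x \<in> \<O> F"
    then obtain a b where x: "x = elem a b" using elem_cases by blast
    have "int p dvd (a - (a + b * r) mod int p) + b * r"
      by (metis add_diff_eq add.commute diff_add_eq dvd_minus_mod)
    then have "x - of_int ((a + b * r) mod int p) \<in> deg1_prime p r"
      unfolding x elem_of_int elem_diff by simp
    then show "\<exists>s\<in>S. x - s \<in> deg1_prime p r"
      using p0 by (intro bexI[of _ "of_int ((a + b * r) mod int p)"]) (auto simp: S_def)
  next
    fix u v assume uv: "u \<in> S" "v \<in> S" "u - v \<in> deg1_prime p r"
    then obtain a b where ab: "u = of_int a" "v = of_int b" "a \<in> {0..<int p}" "b \<in> {0..<int p}"
      by (auto simp: S_def)
    then have "int p dvd a - b"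
      using uv(3) of_int_mem_deg1[of "a - b" p r] by simp
    then have "a mod int p = b mod int p"
      by (simp add: mod_eq_dvd_iff)
    then show "u = v"
      using ab by simp
  qed
  also have "card S = p"
    unfolding S_def by (subst card_image) (auto simp: inj_on_def)
  finally show ?thesis .
qed

lemma ideal_norm_deg2:
  assumes noroot: "\<And>r. \<not> root_mod p r"
  shows "ideal_norm F (deg2_prime p) = p ^ 2"
proof -
  have p0: "int p > 0" using p prime_gt_0_nat by simp
  define S where "S = (\<lambda>(a, b). elem a b) ` ({0..<int p} \<times> {0..<int p})"
  have "ideal_norm F (deg2_prime p) = card S"
  proof (rule ideal_norm_eq_card)
    show "deg2_prime p \<in> primes_of F" by (rule deg2_prime_mem[OF noroot])
    show "finite S" "S \<subseteq> \<O> F" by (auto simp: S_def)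
    fix x assume "x \<in> \<O> F"
    then obtain a b where x: "x = elem a b" using elem_cases by blast
    have "x - elem (a mod int p) (b mod int p) \<in> deg2_prime p"
      unfolding x elem_diff by simp
    then show "\<exists>s\<in>S. x - s \<in> deg2_prime p"
      using p0 by (intro bexI[of _ "elem (a mod int p) (b mod int p)"]) (auto simp: S_def)
  next
    fix u v assume uv: "u \<in> S" "v \<in> S" "u - v \<in> deg2_prime p"
    then obtain a b c d where ab: "u = elem a b" "v = elem c d"
      "a \<in> {0..<int p}" "b \<in> {0..<int p}" "c \<in> {0..<int p}" "d \<in> {0..<int p}"
      by (auto simp: S_def)
    then have "int p dvd a - c" "int p dvd b - d"
      using uv(3) by (simp_all add: elem_diff)
    then have "a mod int p = c mod int p" "b mod int p = d mod int p"
      by (simp_all add: mod_eq_dvd_iff)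
    then show "u = v"
      using ab by simp
  qed
  also have "card S = p ^ 2"
    unfolding S_def by (subst card_image) (auto simp: inj_on_def elem_eq_iff power2_eq_square)
  finally show ?thesis .
qed

lemma fermat_int: "int p dvd a ^ p - a"
proof (cases "int p dvd a")
  case True
  then show ?thesis
    using prime_gt_0_nat[OF p] by (meson dvd_diff dvd_power dvd_trans)
next
  case False
  define m where "m = nat (a mod int p)"
  have am: "[a = int m] (mod int p)"
    using prime_gt_0_nat[OF p] by (simp add: m_def cong_def)
  then have "\<not> p dvd m"
    using False by (simp add: cong_dvd_iff)
  then have "[int m ^ (p - 1) = 1] (mod int p)"
    using fermat_theorem[OF p, of m] cong_int_iff[of "m ^ (p - 1)" 1 p] by simp
  then have "[a ^ (p - 1) = 1] (mod int p)"
    using cong_trans[OF cong_pow[OF am]] by blast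
  then have "[a * a ^ (p - 1) = a * 1] (mod int p)"
    by (intro cong_mult cong_refl)
  moreover have "a * a ^ (p - 1) = a ^ p"
    using p prime_gt_0_nat by (metis power_eq_if less_numeral_extra(3))
  ultimately show ?thesis
    by (simp add: cong_iff_dvd_diff)
qed

lemma fermat_deg1:
  assumes r: "root_mod p r" and x: "x \<in> \<O> F"
  shows "x ^ p - x \<in> deg1_prime p r"
proof -
  interpret P: integral_prime F "deg1_prime p r"
    by unfold_locales (rule deg1_prime_mem[OF r])
  obtain a b where ab: "x = elem a b" using elem_cases[OF x] by blast
  have 1: "x - of_int (a + b * r) \<in> deg1_prime p r"
    unfolding ab elem_of_int elem_diff by simp
  have 2: "x ^ p - of_int (a + b * r) ^ p \<in> deg1_prime p r"
    by (rule P.prime_cong_power[OF 1 x of_int_int])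
  have 3: "of_int (a + b * r) ^ p - of_int (a + b * r) \<in> deg1_prime p r"
    using fermat_int[of "a + b * r"] of_int_mem_deg1[of "(a + b * r) ^ p - (a + b * r)" p r] by simp
  show ?thesis
    using P.prime_trans[OF P.prime_trans[OF 2 3] P.prime_minus_commute[OF 1]] .
qed

text \<open>A square root \<open>y\<close> of the discriminant, with \<open>y = 0\<close> included,
  would yield the root \<open>(t + y) / 2\<close>. Euler's criterion turns its absence into the
  congruence.\<close>

lemma disc_nonresidue:
  assumes noroot: "\<And>r. \<not> root_mod p r" and odd: "odd p"
  shows "int p dvd (t ^ 2 - 4 * n) ^ ((p - 1) div 2) + 1"
proof -
  have p2: "p > 2"
    using p odd prime_gt_1_nat[OF p] by (cases "p = 2") auto
  have no: False if y: "[y ^ 2 = t ^ 2 - 4 * n] (mod int p)" for y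
  proof -
    obtain k :: nat where k: "p = 2 * k + 1"
      using odd by (rule oddE)
    \<comment> \<open>With \<open>p = 2 * k + 1\<close>, the factor \<open>k + 1\<close> is an
      inverse of 2.\<close>
    define r where "r = (t + y) * (int k + 1)"
    have "2 * r - (t + y) = int p * (t + y)"
      by (simp add: r_def k algebra_simps)
    then have "[2 * r = t + y] (mod int p)"
      by (simp add: cong_iff_dvd_diff)
    then have "[2 * r - t = t + y - t] (mod int p)"
      by (intro cong_diff cong_refl)
    then have "[(2 * r - t) ^ 2 = y ^ 2] (mod int p)"
      using cong_pow[of "2 * r - t" y "int p" 2] by simp
    then have "[(2 * r - t) ^ 2 = t ^ 2 - 4 * n] (mod int p)"
      using y cong_trans by blast
    then have "int p dvd (2 * r - t) ^ 2 - (t ^ 2 - 4 * n)"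
      by (simp add: cong_iff_dvd_diff)
    also have "(2 * r - t) ^ 2 - (t ^ 2 - 4 * n) = 4 * (r ^ 2 - t * r + n)"
      by (simp add: power2_eq_square algebra_simps)
    finally have "int p dvd 4 \<or> root_mod p r"
      using prime_dvd_multD[OF prime_int_p] unfolding root_mod_def by blast
    moreover have "\<not> int p dvd 2 ^ 2"
      using prime_dvd_power[OF prime_int_p, of 2 2] p2 zdvd_imp_le[of "int p" 2] by auto
    ultimately show False
      using noroot by simp
  qed
  have "\<not> [t ^ 2 - 4 * n = 0] (mod int p)"
    using no[of 0] by (auto simp: cong_sym_eq)
  moreover have "\<not> QuadRes (int p) (t ^ 2 - 4 * n)"
    using no by (auto simp: QuadRes_def)
  ultimately have "Legendre (t ^ 2 - 4 * n) (int p) = - 1"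
    by (simp add: Legendre_def)
  then have "[- 1 = (t ^ 2 - 4 * n) ^ ((p - 1) div 2)] (mod int p)"
    using euler_criterion[OF p p2, of "t ^ 2 - 4 * n"] by simp
  then show ?thesis
    by (metis cong_iff_dvd_diff cong_sym diff_minus_eq_add)
qed

text \<open>The square root \<open>d = 2 \<omega> - t\<close> of the discriminant is negated by the
  \<open>p\<close>-th power map, by \<open>disc_nonresidue\<close>, so this map is conjugation
  modulo \<open>p\<close>. Twice the element has integer coordinates in \<open>1, d\<close>; the
  factor 2 is cancelled at the end.\<close>

lemma frobenius_deg2:
  assumes noroot: "\<And>r. \<not> root_mod p r" and odd: "odd p"
  shows "elem a b ^ p - elem (a + t * b) (- b) \<in> deg2_prime p"
proof -
  interpret P: integral_prime F "deg2_prime p"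
    by unfold_locales (rule deg2_prime_mem[OF noroot])
  let ?P = "deg2_prime p"
  define d where "d = elem (- t) 2"
  obtain k where k: "p = 2 * k + 1" using odd by (rule oddE)
  have d2: "d ^ 2 = of_int (t ^ 2 - 4 * n)"
    unfolding d_def power2_eq_square elem_mult elem_of_int by (simp add: elem_eq_iff algebra_simps)
  have "d ^ p = of_int ((t ^ 2 - 4 * n) ^ ((p - 1) div 2)) * d"
    unfolding k by (simp add: power_mult d2)
  then have "d ^ p - (- d) = of_int ((t ^ 2 - 4 * n) ^ ((p - 1) div 2) + 1) * d"
    by (simp add: algebra_simps)
  also have "\<dots> \<in> ?P"
    using disc_nonresidue[OF noroot odd] by (intro P.prime_mult') (simp_all add: d_def del: of_int_add)
  finally have dp: "d ^ p - (- d) \<in> ?P" .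
  have int: "of_int c ^ p - of_int c \<in> ?P" for c
    using fermat_int[of c] of_int_mem_deg2[of "c ^ p - c" p] by simp
  have pP: "of_nat p \<in> ?P"
    using of_int_mem_deg2[of "int p" p] by simp
  have two: "2 * elem a b = of_int (2 * a + t * b) + of_int b * d"
    by (simp add: d_def elem_def algebra_simps)
  have dO: "d \<in> \<O> F" by (simp add: d_def)
  have "(of_int (2 * a + t * b) + of_int b * d) ^ p - (of_int (2 * a + t * b) ^ p + (of_int b * d) ^ p) \<in> ?P"
    using P.freshman[OF p pP of_int_int[of "2 * a + t * b"] mult_int[OF of_int_int[of b] dO], of 1]
    by (simp only: power_one_right)
  moreover have "(of_int (2 * a + t * b) ^ p + (of_int b * d) ^ p) - (of_int (2 * a + t * b) + of_int b * (- d)) \<in> ?P"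
    unfolding power_mult_distrib
    by (intro P.prime_cong_add P.prime_cong_mult int dp of_int_int power_int dO)
  ultimately have "(2 * elem a b) ^ p - (of_int (2 * a + t * b) + of_int b * (- d)) \<in> ?P"
    unfolding two by (rule P.prime_trans)
  moreover have "of_int (2 * a + t * b) + of_int b * (- d) = 2 * elem (a + t * b) (- b)"
    by (simp add: d_def elem_def algebra_simps)
  ultimately have 1: "2 ^ p * elem a b ^ p - 2 * elem (a + t * b) (- b) \<in> ?P"
    by (simp add: power_mult_distrib)
  have "(2 ^ p - 2) * elem a b ^ p \<in> ?P"
    using int[of 2] by (intro P.prime_mult') auto
  from P.prime_diff[OF 1 this] have "2 * (elem a b ^ p - elem (a + t * b) (- b)) \<in> ?P"
    by (simp add: algebra_simps)
  moreover have "p \<noteq> 1"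
    using p by (auto simp: prime_nat_iff)
  with odd have "\<not> int p dvd 2"
    using two_is_prime_nat unfolding prime_nat_iff
    by (metis dvd_refl int_dvd_int_iff of_nat_numeral)
  then have "(2::complex) \<in> \<O> F" "(2::complex) \<notin> ?P"
    using of_int_int[of 2] of_int_mem_deg2[of 2 p] by simp_all
  ultimately show ?thesis
    using P.prime_prime[of 2 "elem a b ^ p - elem (a + t * b) (- b)"] by blast
qed

lemma fermat_deg2:
  assumes noroot: "\<And>r. \<not> root_mod p r" and odd: "odd p" and x: "x \<in> \<O> F"
  shows "x ^ (p ^ 2) - x \<in> deg2_prime p"
proof -
  interpret P: integral_prime F "deg2_prime p"
    by unfold_locales (rule deg2_prime_mem[OF noroot])
  obtain a b where ab: "x = elem a b" using elem_cases[OF x] by blast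
  have "(elem a b ^ p) ^ p - elem (a + t * b) (- b) ^ p \<in> deg2_prime p"
    by (intro P.prime_cong_power frobenius_deg2[OF noroot odd]) auto
  moreover have "elem (a + t * b) (- b) ^ p - elem a b \<in> deg2_prime p"
    using frobenius_deg2[OF noroot odd, of "a + t * b" "- b"] by simp
  ultimately show ?thesis
    unfolding ab power2_eq_square power_mult by (rule P.prime_trans)
qed

end

text \<open>The norm of a nonzero element of \<open>P\<close> is a nonzero integer in
  \<open>P\<close>, and primality passes membership down to one of its prime factors.\<close>

lemma ex_prime_below:
  assumes P: "P \<in> primes_of F"
  obtains p where "prime p" "of_nat p \<in> P"
proof -
  interpret P: integral_prime F P
    by unfold_locales fact
  obtain x where x: "x \<in> P" "x \<noteq> 0"
    using P unfolding mem_primes_of_iff by blast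
  then obtain a b where ab: "x = elem a b"
    using elem_cases P.prime_subset by blast
  have "of_int (nrm a b) \<in> P"
    using P.prime_mult'[OF x(1), of "elem (a + t * b) (- b)"] elem_conj[of a b] by (simp add: ab)
  moreover have "nrm a b \<noteq> 0"
  proof
    assume "nrm a b = 0"
    then have "elem (a + t * b) (- b) = elem 0 0"
      using elem_conj[of a b] x ab by (simp add: elem_def)
    then have "b = 0" "a = 0"
      by (auto simp: elem_eq_iff)
    then show False
      using x(2) ab by (simp add: elem_def)
  qed
  ultimately have "of_nat (nat \<bar>nrm a b\<bar>) \<in> P" "nat \<bar>nrm a b\<bar> > 0"
    using P.prime_uminus[of "of_int (nrm a b)"] by (auto simp: abs_if)
  moreover have "\<exists>p. prime p \<and> of_nat p \<in> P" if "of_nat k \<in> P" "k > 0" for k :: nat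
    using that
  proof (induction k rule: less_induct)
    case (less k)
    have "k \<noteq> 1" using less.prems by (auto intro: ccontr)
    then obtain p where p: "prime p" "p dvd k"
      using prime_factor_nat by blast
    then obtain m where m: "k = p * m" by blast
    then have "of_nat p \<in> P \<or> of_nat m \<in> P"
      using less.prems by (intro P.prime_prime) auto
    moreover have "m < k" "m > 0"
      using less.prems m prime_gt_1_nat[OF p(1)] by auto
    ultimately show ?case
      using less.IH p by blast
  qed
  ultimately show ?thesis
    using that by blast
qed

lemma prime_below_unique:
  assumes P: "P \<in> primes_of F" and p: "prime p" "of_nat p \<in> P"
    and p': "prime p'" "of_nat p' \<in> P"
  shows "p = p'"
proof -
  interpret P: integral_prime F P
    by unfold_locales fact
  have "int p dvd int p'"
    using of_int_mem_prime_iff[OF p(1) P.integral_prime_axioms p(2), of "int p'"] p'(2) by simp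
  then show ?thesis
    using p(1) p'(1) primes_dvd_imp_eq by (simp add: int_dvd_int_iff)
qed

end

subsection \<open>Frobenius values of quadratic characters of quadratic fields\<close>

lemma eq_if_cong_sign:
  assumes "(a::int) \<in> {- 1, 1}" "b \<in> {- 1, 1}" "int p dvd a - b" "p > 2"
  shows "a = b"
  using assms zdvd_imp_le[of "int p" 2] by auto

locale quadratic_order_extension =
  quadratic_order + quadratic_extension F \<delta> for \<delta>
begin

section \<open>Lying over and character values above a given rational prime\<close>

context
  fixes p :: nat assumes p: "prime p"
begin

text \<open>In both uses \<open>I\<close> is the ideal of \<open>\<O> E\<close> generated by
  \<open>q\<close>. A prime of \<open>E\<close> containing it meets \<open>F\<close> exactly in
  \<open>q\<close>, since \<open>eq\<close> settles membership of all integers of \<open>F\<close>;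
  what remains is to show that \<open>I\<close> is proper.\<close>

lemma primes_above_eqI:
  assumes I: "I \<subseteq> \<O> E" "0 \<in> I" "\<And>a b. a \<in> I \<Longrightarrow> b \<in> I \<Longrightarrow> a + b \<in> I"
    "\<And>a x. a \<in> I \<Longrightarrow> x \<in> \<O> E \<Longrightarrow> x * a \<in> I" "1 \<notin> I"
    and pI: "of_nat p \<in> I"
    and eq: "\<And>P a b. P \<in> primes_of E \<Longrightarrow> I \<subseteq> P \<Longrightarrow> elem a b \<in> P \<longleftrightarrow> elem a b \<in> q"
    and q: "q \<subseteq> \<O> F"
  shows "primes_above F E q \<noteq> {}"
proof -
  have "I \<noteq> {0}"
    using pI prime_gt_0_nat[OF p] by auto
  then obtain P where P: "P \<in> primes_of E" "I \<subseteq> P"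
    using E.ex_prime_containing[OF I] by metis
  interpret P: integral_prime E P
    by unfold_locales (rule P)
  have "x \<in> P \<inter> F \<longleftrightarrow> x \<in> q" for x
  proof -
    have "x \<in> \<O> F" if "x \<in> P \<inter> F"
      using that P.prime_subset[of x] by (auto simp: ring_of_integers_def)
    moreover have "x \<in> F" if "x \<in> q"
      using that q by (auto simp: ring_of_integers_def)
    moreover have "x \<in> P \<longleftrightarrow> x \<in> q" if "x \<in> \<O> F"
      using elem_cases[OF that] eq[OF P] by blast
    ultimately show ?thesis
      using q by blast
  qed
  then have "P \<inter> F = q" by blast
  then show ?thesis
    using P(1) by (auto simp: primes_above_def)
qed

lemma primes_above_deg1:
  assumes r: "root_mod p r"
  shows "primes_above F E (deg1_prime p r) \<noteq> {}"
proof -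
  define I where "I = {of_nat p * x + elem (- r) 1 * y | x y. x \<in> \<O> E \<and> y \<in> \<O> E}"
  have el: "elem a b \<in> \<O> E" for a b
    by (rule int_F_subset_E) simp
  have mem: "of_nat p * x + elem (- r) 1 * y \<in> I" if "x \<in> \<O> E" "y \<in> \<O> E" for x y
    unfolding I_def using that by blast
  show ?thesis
  proof (rule primes_above_eqI)
    show "I \<subseteq> \<O> E"
      unfolding I_def using el by (auto intro!: E.add_int E.mult_int)
    show "0 \<in> I"
      using mem[of 0 0] by simp
    show pI: "of_nat p \<in> I"
      using mem[of 1 0] by simp
    show "u + v \<in> I" if uv: "u \<in> I" "v \<in> I" for u v
    proof -
      obtain x y x' y' where *: "u = of_nat p * x + elem (- r) 1 * y" "v = of_nat p * x' + elem (- r) 1 * y'"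
        "x \<in> \<O> E" "y \<in> \<O> E" "x' \<in> \<O> E" "y' \<in> \<O> E"
        using uv unfolding I_def by blast
      then have "u + v = of_nat p * (x + x') + elem (- r) 1 * (y + y')"
        by (simp add: algebra_simps)
      then show ?thesis
        using mem[of "x + x'" "y + y'"] * by auto
    qed
    show "z * u \<in> I" if u: "u \<in> I" and z: "z \<in> \<O> E" for u z
    proof -
      obtain x y where *: "u = of_nat p * x + elem (- r) 1 * y"
        "x \<in> \<O> E" "y \<in> \<O> E"
        using u unfolding I_def by blast
      then have "z * u = of_nat p * (z * x) + elem (- r) 1 * (z * y)"
        by (simp add: algebra_simps)
      then show ?thesis
        using mem[of "z * x" "z * y"] * z by auto
    qed
    \<comment> \<open>Multiplying the relation by the conjugate \<open>c\<close> of
      \<open>elem (- r) 1\<close> would make \<open>c / p\<close> integral, but its coefficient at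
      \<open>\<omega>\<close> is \<open>- 1 / p\<close>.\<close>
    show "1 \<notin> I"
    proof
      assume "1 \<in> I"
      then obtain x y where xy: "1 = of_nat p * x + elem (- r) 1 * y"
        "x \<in> \<O> E" "y \<in> \<O> E"
        unfolding I_def by blast
      obtain k where k: "r ^ 2 - t * r + n = int p * k"
        using r unfolding root_mod_def by blast
      define c where "c = elem (t - r) (- 1)"
      have c: "elem (- r) 1 * c = of_nat p * of_int k"
      proof -
        have "elem (- r) 1 * c = of_int (r ^ 2 - t * r + n)"
          unfolding c_def elem_mult elem_of_int elem_eq_iff by (simp add: algebra_simps power2_eq_square)
        then show ?thesis
          by (simp add: k)
      qed
      have "c = of_nat p * x * c + (elem (- r) 1 * c) * y"
        using arg_cong[OF xy(1), of "\<lambda>z. z * c"] by (simp add: algebra_simps)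
      also have "\<dots> = of_nat p * (x * c + of_int k * y)"
        unfolding c by (simp add: algebra_simps)
      finally have c': "c = of_nat p * (x * c + of_int k * y)" .
      define w where "w = x * c + of_int k * y"
      have "w \<in> \<O> E"
        unfolding w_def using xy el by (auto simp: c_def intro!: E.add_int E.mult_int)
      moreover have "w = c / of_nat p"
        using c' prime_gt_0_nat[OF p] unfolding w_def[symmetric] by (simp add: field_simps)
      then have "w \<in> F"
        using elem_int[of "t - r" "- 1"] by (auto simp: c_def ring_of_integers_def)
      ultimately have "w \<in> \<O> F"
        by (auto simp: ring_of_integers_def)
      then obtain a b where "w = elem a b"
        using elem_cases by blast
      then have "c = of_nat p * elem a b"
        using c' by (simp only: w_def)
      also have "\<dots> = elem (int p * a) (int p * b)"
        by (simp add: elem_def algebra_simps)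
      finally have "elem (t - r) (- 1) = elem (int p * a) (int p * b)"
        by (simp only: c_def)
      then have "int p dvd - 1"
        unfolding elem_eq_iff by (metis dvd_triv_left)
      then show False
        using p by (auto simp: prime_nat_iff)
    qed
    show "elem a b \<in> P \<longleftrightarrow> elem a b \<in> deg1_prime p r" if P: "P \<in> primes_of E" "I \<subseteq> P" for P a b
    proof -
      interpret P: integral_prime E P
        by unfold_locales (rule P)
      have "elem (- r) 1 \<in> P"
        using mem[of 0 1] P(2) by auto
      then have "of_int b * elem (- r) 1 \<in> P"
        by (intro P.prime_mult) auto
      also have "of_int b * elem (- r) 1 = elem a b - of_int (a + b * r)"
        by (simp add: elem_def algebra_simps)
      finally have "elem a b \<in> P \<longleftrightarrow> of_int (a + b * r) \<in> P"
        by (rule P.prime_cong)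
      also have "\<dots> \<longleftrightarrow> int p dvd a + b * r"
        using pI P(2) by (intro of_int_mem_prime_iff[OF p P.integral_prime_axioms]) auto
      finally show ?thesis by simp
    qed
    show "deg1_prime p r \<subseteq> \<O> F"
      using mem_deg1_int by blast
  qed
qed

lemma primes_above_deg2:
  assumes noroot: "\<And>r. \<not> root_mod p r"
  shows "primes_above F E (deg2_prime p) \<noteq> {}"
proof -
  define I where "I = {of_nat p * x | x. x \<in> \<O> E}"
  have mem: "of_nat p * x \<in> I" if "x \<in> \<O> E" for x
    unfolding I_def using that by blast
  show ?thesis
  proof (rule primes_above_eqI)
    show "I \<subseteq> \<O> E"
      unfolding I_def by auto
    show "0 \<in> I"
      using mem[of 0] by simp
    show pI: "of_nat p \<in> I"
      using mem[of 1] by simp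
    show "u + v \<in> I" if "u \<in> I" "v \<in> I" for u v
      using that mem unfolding I_def by (auto simp flip: distrib_left)
    show "z * u \<in> I" if "u \<in> I" and "z \<in> \<O> E" for u z
      using that mem unfolding I_def by (auto simp: mult.left_commute)
    show "1 \<notin> I"
    proof
      assume "1 \<in> I"
      then obtain x where x: "1 = of_nat p * x" "x \<in> \<O> E"
        unfolding I_def by blast
      then have "x = 1 / of_nat p"
        using prime_gt_0_nat[OF p] by (simp add: field_simps)
      then have "x \<in> \<int>"
        using x(2) by (intro rational_algebraic_int_is_int) (auto simp: ring_of_integers_def)
      then obtain k where "x = of_int k" by (auto elim: Ints_cases)
      then have "int p * k = 1"
        using x(1) by (metis of_int_1 of_int_eq_iff of_int_mult of_int_of_nat_eq)
      then have "int p dvd 1"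
        by (metis dvd_triv_left)
      then show False
        using p by (auto simp: prime_nat_iff)
    qed
    show "elem a b \<in> P \<longleftrightarrow> elem a b \<in> deg2_prime p" if P: "P \<in> primes_of E" "I \<subseteq> P" for P a b
    proof -
      interpret P: integral_prime E P
        by unfold_locales (rule P)
      have int: "of_int a \<in> P \<longleftrightarrow> int p dvd a" for a
        using pI P(2) by (intro of_int_mem_prime_iff[OF p P.integral_prime_axioms]) auto
      have el: "elem a b \<in> \<O> E" for a b
        by (rule int_F_subset_E) simp
      show ?thesis
      proof
        assume "elem a b \<in> P"
        then have "of_int (nrm a b) \<in> P"
          unfolding elem_conj[symmetric] using el by (intro P.prime_mult') auto
        then have "int p dvd nrm a b"
          by (simp only: int)
        then show "elem a b \<in> deg2_prime p"
          unfolding elem_mem_deg2 by (rule deg2_if_nrm[OF p noroot])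
      next
        assume "elem a b \<in> deg2_prime p"
        then obtain c d where "a = int p * c" "b = int p * d"
          by (auto elim!: dvdE)
        then have "elem a b = of_nat p * elem c d"
          by (simp add: elem_def algebra_simps)
        then show "elem a b \<in> P"
          using mem[OF el] P(2) by auto
      qed
    qed
    show "deg2_prime p \<subseteq> \<O> F"
      using mem_deg2_int by blast
  qed
qed

lemma ex_frobenius_deg1:
  assumes r: "root_mod p r" and unr: "unramified_at F \<psi> (deg1_prime p r)"
  obtains P \<sigma> where "P \<in> primes_above F E (deg1_prime p r)" "\<sigma> \<in> Gal"
    "\<And>x. x \<in> \<O> E \<Longrightarrow> \<sigma> x - x ^ p \<in> P" "frobenius_value F \<psi> (deg1_prime p r) = \<psi> \<sigma>"
proof (rule frobenius_value_unramified[OF unr primes_above_deg1[OF r]])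
  have "of_nat p \<in> deg1_prime p r"
    using of_int_mem_deg1[of "int p" p r] by simp
  then show "frobenius_elements F E P \<noteq> {}" if "P \<in> primes_above F E (deg1_prime p r)" for P
    using ex_frobenius[OF that p, of 1] ideal_norm_deg1[OF p r] fermat_deg1[OF p r] by simp
qed (use that ideal_norm_deg1[OF p r] in auto)

lemma ex_frobenius_deg2:
  assumes noroot: "\<And>r. \<not> root_mod p r" and odd: "odd p" and unr: "unramified_at F \<psi> (deg2_prime p)"
  obtains P \<sigma> where "P \<in> primes_above F E (deg2_prime p)" "\<sigma> \<in> Gal"
    "\<And>x. x \<in> \<O> E \<Longrightarrow> \<sigma> x - x ^ (p ^ 2) \<in> P" "frobenius_value F \<psi> (deg2_prime p) = \<psi> \<sigma>"
proof (rule frobenius_value_unramified[OF unr primes_above_deg2[OF noroot]])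
  have "of_nat p \<in> deg2_prime p"
    using of_int_mem_deg2[of "int p" p] by simp
  then show "frobenius_elements F E P \<noteq> {}" if "P \<in> primes_above F E (deg2_prime p)" for P
    using ex_frobenius[OF that p, of 2] ideal_norm_deg2[OF p noroot] fermat_deg2[OF p noroot odd] by simp
qed (use that ideal_norm_deg2[OF p noroot] in auto)

lemma psi_of_int: "\<sigma> \<in> Gal \<Longrightarrow> \<exists>e\<in>{- 1, 1::int}. \<psi> \<sigma> = of_int e"
  using psi_cases[of \<sigma>] by auto

lemma Legendre_eqI:
  assumes "odd p" "\<not> int p dvd a" "e \<in> {- 1, 1}" "int p dvd a ^ ((p - 1) div 2) - e"
  shows "e = Legendre a (int p)"
proof -
  have p2: "p > 2"
    using p assms(1) prime_gt_1_nat[OF p] by (cases "p = 2") auto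
  have "[Legendre a (int p) = a ^ ((p - 1) div 2)] (mod int p)"
    by (rule euler_criterion[OF p p2])
  then have "int p dvd a ^ ((p - 1) div 2) - Legendre a (int p)"
    by (simp add: cong_iff_dvd_diff dvd_diff_commute)
  then have "int p dvd e - Legendre a (int p)"
    using dvd_diff[OF _ assms(4)] by fastforce
  moreover have "Legendre a (int p) \<in> {- 1, 1}"
    using assms(2) by (auto simp: Legendre_def cong_0_iff)
  ultimately show ?thesis
    using eq_if_cong_sign[OF assms(3)] p2 by blast
qed

text \<open>Modulo \<open>deg1_prime p r\<close> the element \<open>elem a b\<close> is the integer
  \<open>a + b * r\<close>, so the power from \<open>tame_frobenius\<close> becomes an ordinary
  Legendre symbol.\<close>

lemma frobenius_value_deg1:
  assumes r: "root_mod p r" and odd: "odd p"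
    and d: "\<delta>1 \<in> \<O> E" "v \<in> F" "\<delta>1 = v * \<delta>"
    and sq: "\<delta>1 ^ 2 = elem a b" and nz: "\<not> int p dvd a + b * r"
  shows "frobenius_value F \<psi> (deg1_prime p r) = of_int (Legendre (a + b * r) (int p))"
proof -
  let ?p = "deg1_prime p r"
  interpret P: integral_prime F ?p
    by unfold_locales (rule deg1_prime_mem[OF p r])
  have "\<not> int p dvd 2"
    using odd p by (metis int_dvd_int_iff of_nat_numeral primes_dvd_imp_eq two_is_prime_nat even_numeral)
  then have two: "2 \<notin> ?p"
    using of_int_mem_deg1[of 2 p r] by simp
  have notin: "\<delta>1 ^ 2 \<notin> ?p"
    using nz by (simp add: sq)
  obtain P \<sigma> where P: "P \<in> primes_above F E ?p" and \<sigma>: "\<sigma> \<in> Gal"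
    and frob: "\<And>x. x \<in> \<O> E \<Longrightarrow> \<sigma> x - x ^ p \<in> P"
    and val: "frobenius_value F \<psi> ?p = \<psi> \<sigma>"
    using ex_frobenius_deg1[OF r tame_unramified[OF d notin two]] by metis
  obtain e where e: "e \<in> {- 1, 1}" "\<psi> \<sigma> = of_int e"
    using psi_of_int[OF \<sigma>] by blast
  have 1: "elem a b ^ ((p - 1) div 2) - \<psi> \<sigma> \<in> ?p"
    using tame_frobenius[OF P \<sigma> frob odd d notin] by (simp add: sq)
  have "elem a b - of_int (a + b * r) \<in> ?p"
    unfolding elem_of_int elem_diff by simp
  then have 2: "elem a b ^ ((p - 1) div 2) - of_int (a + b * r) ^ ((p - 1) div 2) \<in> ?p"
    by (intro P.prime_cong_power) auto
  have "of_int (a + b * r) ^ ((p - 1) div 2) - \<psi> \<sigma> \<in> ?p"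
    using P.prime_trans[OF P.prime_minus_commute[OF 2] 1] .
  then have "of_int ((a + b * r) ^ ((p - 1) div 2) - e) \<in> ?p"
    by (simp add: e)
  then show ?thesis
    unfolding val e(2) of_int_mem_deg1 using Legendre_eqI[OF odd nz e(1)] by simp
qed

text \<open>The exponent \<open>(p ^ 2 - 1) div 2\<close> is \<open>p + 1\<close> times
  \<open>(p - 1) div 2\<close>, and by \<open>frobenius_deg2\<close> the power with exponent
  \<open>p + 1\<close> is the norm modulo \<open>p\<close>. What is left is Euler's criterion for
  the norm.\<close>

lemma frobenius_value_deg2:
  assumes noroot: "\<And>r. \<not> root_mod p r" and odd: "odd p"
    and d: "\<delta> \<in> \<O> E"
    and sq: "\<delta> ^ 2 = elem a b" and nz: "\<not> int p dvd nrm a b"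
  shows "frobenius_value F \<psi> (deg2_prime p) = of_int (Legendre (nrm a b) (int p))"
proof -
  let ?p = "deg2_prime p"
  interpret P: integral_prime F ?p
    by unfold_locales (rule deg2_prime_mem[OF p noroot])
  have "\<not> int p dvd 2"
    using odd p by (metis int_dvd_int_iff of_nat_numeral primes_dvd_imp_eq two_is_prime_nat even_numeral)
  then have two: "2 \<notin> ?p"
    using of_int_mem_deg2[of 2 p] by simp
  have "\<not> (int p dvd a \<and> int p dvd b)"
    using nz by (auto simp: nrm_def power2_eq_square)
  then have notin: "\<delta> ^ 2 \<notin> ?p"
    by (simp add: sq)
  have d': "1 \<in> F" "\<delta> = 1 * \<delta>" by auto
  obtain P \<sigma> where P: "P \<in> primes_above F E ?p" and \<sigma>: "\<sigma> \<in> Gal"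
    and frob: "\<And>x. x \<in> \<O> E \<Longrightarrow> \<sigma> x - x ^ (p ^ 2) \<in> P"
    and val: "frobenius_value F \<psi> ?p = \<psi> \<sigma>"
    using ex_frobenius_deg2[OF noroot odd tame_unramified[OF d d' notin two]] by metis
  obtain e where e: "e \<in> {- 1, 1}" "\<psi> \<sigma> = of_int e"
    using psi_of_int[OF \<sigma>] by blast
  have 1: "elem a b ^ ((p ^ 2 - 1) div 2) - \<psi> \<sigma> \<in> ?p"
    using tame_frobenius[OF P \<sigma> frob _ d d' notin] odd by (simp add: sq)
  have exp: "(p ^ 2 - 1) div 2 = (p + 1) * ((p - 1) div 2)"
  proof -
    obtain k where "p = 2 * k + 1" using odd by (rule oddE)
    then show ?thesis
      by (simp add: power2_eq_square algebra_simps)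
  qed
  have "elem a b * elem a b ^ p - elem a b * elem (a + t * b) (- b) \<in> ?p"
    using P.prime_mult[OF frobenius_deg2[OF p noroot odd, of a b] elem_int[of a b]] by (simp add: algebra_simps)
  then have "elem a b ^ (p + 1) - of_int (nrm a b) \<in> ?p"
    by (simp add: elem_conj)
  then have 2: "(elem a b ^ (p + 1)) ^ ((p - 1) div 2) - of_int (nrm a b) ^ ((p - 1) div 2) \<in> ?p"
    by (intro P.prime_cong_power power_int) auto
  have "of_int (nrm a b) ^ ((p - 1) div 2) - \<psi> \<sigma> \<in> ?p"
    using P.prime_trans[OF P.prime_minus_commute[OF 2]] 1 unfolding exp power_mult by blast
  then have "of_int (nrm a b ^ ((p - 1) div 2) - e) \<in> ?p"
    by (simp add: e)
  then show ?thesis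
    unfolding val e(2) of_int_mem_deg2 using Legendre_eqI[OF odd nz e(1)] by simp
qed

end

lemma frobenius_value_2:
  assumes r: "root_mod 2 r" and x: "x \<in> \<O> E" "x \<notin> F"
    and eq: "x ^ 2 - elem a b * x + elem c d = 0" and odd: "odd (a + b * r)"
  shows "frobenius_value F \<psi> (deg1_prime 2 r) = (if even (c + d * r) then 1 else - 1)"
proof -
  have p2: "prime (2::nat)" by (rule two_is_prime_nat)
  have two: "2 \<in> deg1_prime 2 r"
    using of_int_mem_deg1[of 2 2 r] by simp
  have "elem a b - 1 \<in> deg1_prime 2 r"
    using odd elem_diff[of a b 1 0] elem_of_int[of 1] by simp
  note D = dyadic_unramified[OF x elem_int this elem_int eq two]
  obtain P \<sigma> where P: "P \<in> primes_above F E (deg1_prime 2 r)" and \<sigma>: "\<sigma> \<in> Gal"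
    and frob: "\<And>x. x \<in> \<O> E \<Longrightarrow> \<sigma> x - x ^ 2 \<in> P"
    and val: "frobenius_value F \<psi> (deg1_prime 2 r) = \<psi> \<sigma>"
    using ex_frobenius_deg1[OF p2 r D(1)] by metis
  show ?thesis
    using D(2)[OF P \<sigma> frob[OF x(1)]] by (simp add: val)
qed

end

subsection \<open>Euler products over quadratic fields\<close>

text \<open>Logarithms turn the product into an absolutely convergent sum; the bound
  \<open>1 / 2\<close> gives \<open>norm (Ln (1 - g i))\<close> at most twice
  \<open>norm (g i)\<close> and keeps the factors away from their poles.\<close>

lemma convergent_euler_product:
  fixes g :: "'a \<Rightarrow> complex"
  assumes sum: "(\<lambda>i. norm (g i)) summable_on A" and small: "\<And>i. i \<in> A \<Longrightarrow> norm (g i) < 1 / 2"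
  obtains l where "((\<lambda>S. \<Prod>i\<in>S. inverse (1 - g i)) \<longlongrightarrow> l) (finite_subsets_at_top A)"
proof -
  define h where "h i = Ln (1 - g i)" for i
  have "(\<lambda>i. norm (2 * g i)) summable_on A"
    using summable_on_cmult_right[OF sum, of 2] by (simp add: norm_mult)
  then have "(\<lambda>i. norm (h i)) summable_on A"
  proof (rule Infinite_Sum.abs_summable_on_comparison_test)
    show "norm (h i) \<le> norm (2 * g i)" if "i \<in> A" for i
      using norm_Ln_le[of "- g i"] small[OF that] by (simp add: h_def norm_mult)
  qed
  then have "h summable_on A"
    by (rule abs_summable_summable)
  then have "(sum h \<longlongrightarrow> infsum h A) (finite_subsets_at_top A)"
    using has_sum_infsum has_sum_def by blast
  then have lim: "((\<lambda>S. exp (- sum h S)) \<longlongrightarrow> exp (- infsum h A)) (finite_subsets_at_top A)"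
    by (intro tendsto_intros)
  have "exp (- h i) = inverse (1 - g i)" if "i \<in> A" for i
  proof -
    have "1 - g i \<noteq> 0"
      using small[OF that] by auto
    then show ?thesis
      by (simp add: h_def exp_minus)
  qed
  then have "exp (- sum h S) = (\<Prod>i\<in>S. inverse (1 - g i))" if "finite S" "S \<subseteq> A" for S
    using that by (simp add: exp_sum subset_iff flip: sum_negf)
  then have "\<forall>\<^sub>F S in finite_subsets_at_top A. exp (- sum h S) = (\<Prod>i\<in>S. inverse (1 - g i))"
    by (intro eventually_finite_subsets_at_top_weakI)
  then show ?thesis
    using that Lim_transform_eventually[OF lim] by blast
qed

context quadratic_order
begin

definition primes_over :: "nat \<Rightarrow> complex set set" where
  "primes_over p = {P \<in> primes_of F. of_nat p \<in> P}"

context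
  fixes p :: nat assumes p: "prime p"
begin

lemma primes_over_split: "root_mod p r \<Longrightarrow> primes_over p = {deg1_prime p r, deg1_prime p (t - r)}"
proof -
  assume r: "root_mod p r"
  have "of_nat p \<in> deg1_prime p s" for s
    using of_int_mem_deg1[of "int p" p s] by simp
  then show ?thesis
    using prime_over_cases[OF p _ _ r] deg1_prime_mem[OF p r] deg1_prime_mem[OF p root_mod_conj[OF r]]
    unfolding primes_over_def by blast
qed

lemma primes_over_inert: "(\<And>r. \<not> root_mod p r) \<Longrightarrow> primes_over p = {deg2_prime p}"
proof -
  assume noroot: "\<And>r. \<not> root_mod p r"
  have "of_nat p \<in> deg2_prime p"
    using of_int_mem_deg2[of "int p" p] by simp
  then show ?thesis
    using prime_over_inert[OF p _ _ noroot] deg2_prime_mem[OF p noroot]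
    unfolding primes_over_def by blast
qed

lemma deg1_prime_neq: "\<not> int p dvd 2 * r - t \<Longrightarrow> deg1_prime p r \<noteq> deg1_prime p (t - r)"
proof
  assume n: "\<not> int p dvd 2 * r - t" and eq: "deg1_prime p r = deg1_prime p (t - r)"
  have "elem (- r) 1 \<in> deg1_prime p (t - r)"
    unfolding eq[symmetric] by simp
  then have "int p dvd - (2 * r - t)"
    by (simp add: algebra_simps)
  then show False
    using n by (simp only: dvd_minus_iff)
qed

lemma finite_primes_over: "finite (primes_over p)"
  and card_primes_over: "card (primes_over p) \<le> 2"
  and ideal_norm_primes_over: "P \<in> primes_over p \<Longrightarrow> ideal_norm F P \<ge> p"
proof -
  have "finite (primes_over p) \<and> card (primes_over p) \<le> 2 \<and> (\<forall>P\<in>primes_over p. ideal_norm F P \<ge> p)"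
  proof (cases "\<exists>r. root_mod p r")
    case True
    then obtain r where r: "root_mod p r" ..
    show ?thesis
      unfolding primes_over_split[OF r]
      using ideal_norm_deg1[OF p r] ideal_norm_deg1[OF p root_mod_conj[OF r]]
      by (auto simp: card_insert_if)
  next
    case False
    then have r: "\<And>r. \<not> root_mod p r" by blast
    show ?thesis
      unfolding primes_over_inert[OF r]
      using ideal_norm_deg2[OF p r] by (simp add: power2_eq_square)
  qed
  then show "finite (primes_over p)" "card (primes_over p) \<le> 2"
    "P \<in> primes_over p \<Longrightarrow> ideal_norm F P \<ge> p" by auto
qed

end

text \<open>At most two primes lie over each rational prime, with norm at least that prime, so twice
  a zeta series bounds the finite sums.\<close>

lemma summable_ideal_norm_powr:
  fixes \<sigma> :: real
  assumes "\<sigma> > 1"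
  shows "(\<lambda>P. real (ideal_norm F P) powr (- \<sigma>)) summable_on primes_of F"
proof (rule nonneg_bdd_above_summable_on)
  define pr where "pr P = (SOME p. prime p \<and> of_nat p \<in> P)" for P :: "complex set"
  have pr: "prime (pr P)" "of_nat (pr P) \<in> P" if "P \<in> primes_of F" for P
    using someI_ex[of "\<lambda>p. prime p \<and> of_nat p \<in> P"] ex_prime_below[OF that]
    unfolding pr_def by blast+
  have sm: "summable (\<lambda>k. real k powr (- \<sigma>))"
    using assms by (simp add: summable_real_powr_iff)
  have "(\<Sum>P\<in>S. real (ideal_norm F P) powr (- \<sigma>)) \<le> 2 * (\<Sum>k. real k powr (- \<sigma>))"
    if S: "S \<subseteq> primes_of F" "finite S" for S
  proof -
    have "(\<Sum>P\<in>S. real (ideal_norm F P) powr (- \<sigma>)) \<le> (\<Sum>P\<in>S. real (pr P) powr (- \<sigma>))"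
    proof (rule sum_mono)
      fix P assume "P \<in> S"
      then have P: "P \<in> primes_of F" using S by blast
      then have "pr P \<le> ideal_norm F P"
        using ideal_norm_primes_over[OF pr(1)[OF P]] pr(2)[OF P] by (simp add: primes_over_def)
      then show "real (ideal_norm F P) powr (- \<sigma>) \<le> real (pr P) powr (- \<sigma>)"
        using prime_gt_0_nat[OF pr(1)[OF P]] assms by (intro powr_mono2') auto
    qed
    also have "\<dots> = (\<Sum>k\<in>pr ` S. \<Sum>P | P \<in> S \<and> pr P = k. real (pr P) powr (- \<sigma>))"
      by (rule sum.image_gen[OF S(2)])
    also have "\<dots> \<le> (\<Sum>k\<in>pr ` S. 2 * real k powr (- \<sigma>))"
    proof (rule sum_mono)
      fix k assume "k \<in> pr ` S"
      then have k: "prime k" using pr S by auto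
      have "{P \<in> S. pr P = k} \<subseteq> primes_over k"
        using pr S by (auto simp: primes_over_def)
      then have "card {P \<in> S. pr P = k} \<le> 2"
        using card_mono[OF finite_primes_over[OF k]] card_primes_over[OF k] le_trans by blast
      then have "real (card {P \<in> S. pr P = k}) * real k powr (- \<sigma>) \<le> 2 * real k powr (- \<sigma>)"
        by (intro mult_right_mono) auto
      then show "(\<Sum>P | P \<in> S \<and> pr P = k. real (pr P) powr (- \<sigma>)) \<le> 2 * real k powr (- \<sigma>)"
        by simp
    qed
    also have "\<dots> = 2 * (\<Sum>k\<in>pr ` S. real k powr (- \<sigma>))"
      by (simp add: sum_distrib_left)
    also have "\<dots> \<le> 2 * (\<Sum>k. real k powr (- \<sigma>))"
      using S by (intro mult_left_mono sum_le_suminf[OF sm]) auto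
    finally show ?thesis .
  qed
  then show "bdd_above (sum (\<lambda>P. real (ideal_norm F P) powr (- \<sigma>)) ` {S. S \<subseteq> primes_of F \<and> finite S})"
    by (intro bdd_aboveI[of _ "2 * (\<Sum>k. real k powr (- \<sigma>))"]) auto
qed auto

end

context quadratic_order_extension
begin

text \<open>The hypothesis on 2 says that 2 is not inert: \<open>ex_frobenius_deg2\<close>, which
  controls the chosen element at inert primes, speaks of odd ones.\<close>

lemma norm_frobenius_value_le:
  assumes P: "P \<in> primes_of F" and two: "root_mod 2 r2"
  shows "norm (frobenius_value F \<psi> P) \<le> 1"
proof (cases "unramified_at F \<psi> P")
  case False
  then show ?thesis by (simp add: frobenius_value_def)
next
  case True
  have psi: "norm (\<psi> \<sigma>) \<le> 1" if "\<sigma> \<in> Gal" for \<sigma>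
    using psi_cases[OF that] by auto
  obtain p where p: "prime p" "of_nat p \<in> P"
    using ex_prime_below[OF P] .
  show ?thesis
  proof (cases "\<exists>r. root_mod p r")
    case True
    then obtain r where r: "root_mod p r" ..
    obtain r' where r': "root_mod p r'" "P = deg1_prime p r'"
      using prime_over_cases[OF p(1) P p(2) r] r root_mod_conj[OF r] by blast
    then show ?thesis
      using ex_frobenius_deg1[OF p(1) r'(1)] \<open>unramified_at F \<psi> P\<close> psi by metis
  next
    case False
    then have noroot: "\<And>r. \<not> root_mod p r" by blast
    have "p \<noteq> 2" using two noroot by blast
    then have "odd p"
      using p(1) prime_odd_nat prime_ge_2_nat[OF p(1)] by auto
    then show ?thesis
      using ex_frobenius_deg2[OF p(1) noroot] \<open>unramified_at F \<psi> P\<close> psi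
        prime_over_inert[OF p(1) P p(2) noroot] by metis
  qed
qed

definition local_factor :: "complex \<Rightarrow> nat \<Rightarrow> complex" where
  "local_factor s p = (\<Prod>P\<in>primes_over p. euler_factor s \<psi> F P)"

text \<open>Once the unordered product is known to converge, it can be evaluated along any
  exhausting sequence of finite sets. Taking all primes above \<open>p \<le> k\<close> groups the
  factors by rational primes, the common index set of the two fields.\<close>

lemma euler_product_tendsto:
  assumes s: "Re s > 1" and two: "root_mod 2 r2"
  shows "(\<lambda>k. \<Prod>p | prime p \<and> p \<le> k. local_factor s p) \<longlonglongrightarrow> euler_product s \<psi> F"
proof -
  define g where "g P = frobenius_value F \<psi> P * of_nat (ideal_norm F P) powr (- s)" for P
  have g: "norm (g P) \<le> real (ideal_norm F P) powr (- Re s)" if P: "P \<in> primes_of F" for P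
  proof -
    have "norm (g P) = norm (frobenius_value F \<psi> P) * real (ideal_norm F P) powr (- Re s)"
      by (simp add: g_def norm_mult norm_powr_real_powr)
    also have "\<dots> \<le> 1 * real (ideal_norm F P) powr (- Re s)"
      by (intro mult_right_mono norm_frobenius_value_le[OF P two]) auto
    finally show ?thesis by simp
  qed
  have "(\<lambda>P. norm (g P)) summable_on primes_of F"
  proof (rule Infinite_Sum.abs_summable_on_comparison_test)
    show "(\<lambda>P. norm (real (ideal_norm F P) powr (- Re s))) summable_on primes_of F"
      using summable_ideal_norm_powr[OF s] by simp
  qed (use g in simp)
  moreover have "norm (g P) < 1 / 2" if P: "P \<in> primes_of F" for P
  proof -
    obtain p where p: "prime p" "of_nat p \<in> P"
      using ex_prime_below[OF P] .
    then have N: "ideal_norm F P \<ge> 2"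
      using ideal_norm_primes_over[OF p(1), of P] P prime_ge_2_nat[OF p(1)] by (simp add: primes_over_def)
    have "norm (g P) \<le> real (ideal_norm F P) powr (- Re s)" by (rule g[OF P])
    also have "\<dots> < real (ideal_norm F P) powr (- 1)"
      using N s by (intro powr_less_mono) auto
    also have "\<dots> \<le> 1 / 2"
      using N by (simp add: powr_minus_divide field_simps)
    finally show ?thesis .
  qed
  ultimately obtain l where l: "((\<lambda>S. \<Prod>P\<in>S. inverse (1 - g P)) \<longlongrightarrow> l) (finite_subsets_at_top (primes_of F))"
    using convergent_euler_product by metis
  have eul: "euler_product s \<psi> F = l"
    unfolding euler_product_def euler_factor_def
    using l by (intro tendsto_Lim) (auto simp: g_def)
  define S where "S k = (\<Union>p\<in>{p. prime p \<and> p \<le> k}. primes_over p)" for k :: nat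
  have fin: "finite {p::nat. prime p \<and> p \<le> k}" for k
    by simp
  have "filterlim S (finite_subsets_at_top (primes_of F)) sequentially"
    unfolding filterlim_finite_subsets_at_top
  proof (intro allI impI)
    fix X assume X: "finite X \<and> X \<subseteq> primes_of F"
    have "\<forall>P\<in>X. \<exists>p. prime p \<and> of_nat p \<in> P"
      using X ex_prime_below by blast
    then obtain pr where pr: "\<And>P. P \<in> X \<Longrightarrow> prime (pr P) \<and> of_nat (pr P) \<in> P"
      by metis
    show "\<forall>\<^sub>F k in sequentially. finite (S k) \<and> X \<subseteq> S k \<and> S k \<subseteq> primes_of F"
      using eventually_ge_at_top[of "Max (pr ` X)"]
    proof eventually_elim
      case (elim k)
      have "pr P \<le> k" if "P \<in> X" for P
        using elim X that by (meson Max_ge finite_imageI image_eqI le_trans)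
      then have "X \<subseteq> S k"
        using X pr unfolding S_def primes_over_def by blast
      moreover have "finite (S k)"
        unfolding S_def using finite_primes_over by auto
      moreover have "S k \<subseteq> primes_of F"
        by (auto simp: S_def primes_over_def)
      ultimately show ?case by blast
    qed
  qed
  then have "(\<lambda>k. \<Prod>P\<in>S k. inverse (1 - g P)) \<longlonglongrightarrow> l"
    by (rule filterlim_compose[OF l])
  moreover have "(\<Prod>P\<in>S k. inverse (1 - g P)) = (\<Prod>p | prime p \<and> p \<le> k. local_factor s p)" for k
    unfolding S_def local_factor_def euler_factor_def g_def
    using finite_primes_over prime_below_unique
    by (subst prod.UNION_disjoint) (auto simp: primes_over_def)
  ultimately show ?thesis
    by (simp add: eul)
qed

lemma local_factor_split:
  assumes p: "prime p" and r: "root_mod p r" and "\<not> int p dvd 2 * r - t"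
  shows "local_factor s p = inverse (1 - frobenius_value F \<psi> (deg1_prime p r) * of_nat p powr (- s)) *
    inverse (1 - frobenius_value F \<psi> (deg1_prime p (t - r)) * of_nat p powr (- s))"
  unfolding local_factor_def primes_over_split[OF p r] euler_factor_def
  using deg1_prime_neq[OF p assms(3)] ideal_norm_deg1[OF p r] ideal_norm_deg1[OF p root_mod_conj[OF r]]
  by simp

text \<open>The two roots agree modulo \<open>p\<close>, so \<open>primes_over p\<close> is a
  singleton and its factor is counted once.\<close>

lemma local_factor_double:
  assumes p: "prime p" and r: "root_mod p r" and "int p dvd 2 * r - t"
  shows "local_factor s p = inverse (1 - frobenius_value F \<psi> (deg1_prime p r) * of_nat p powr (- s))"
proof -
  have "deg1_prime p (t - r) = deg1_prime p r"
    using assms(3) by (intro deg1_prime_cong) (simp add: dvd_diff_commute algebra_simps)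
  then show ?thesis
    unfolding local_factor_def primes_over_split[OF p r] euler_factor_def
    using ideal_norm_deg1[OF p r] by simp
qed

lemma local_factor_inert:
  assumes p: "prime p" and noroot: "\<And>r. \<not> root_mod p r"
  shows "local_factor s p = inverse (1 - frobenius_value F \<psi> (deg2_prime p) * (of_nat p powr (- s)) ^ 2)"
proof -
  have "(of_nat p * of_nat p) powr (- s) = of_nat p powr (- s) * (of_nat p powr (- s) :: complex)"
    by (rule powr_times_real) auto
  then show ?thesis
    unfolding local_factor_def primes_over_inert[OF p noroot] euler_factor_def
    using ideal_norm_deg2[OF p noroot] by (simp add: power2_eq_square)
qed

end

subsection \<open>Legendre symbols and sums of two squares\<close>

context
  fixes p :: nat assumes p: "prime p" and odd: "odd p"
begin

lemma odd_prime_gt_2: "p > 2"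
  using p odd prime_gt_1_nat[OF p] by (cases "p = 2") auto

lemma Legendre_sign: "\<not> int p dvd a \<Longrightarrow> Legendre a (int p) \<in> {- 1, 1}"
  by (auto simp: Legendre_def cong_0_iff)

lemma Legendre_cong_power: "int p dvd a ^ ((p - 1) div 2) - Legendre a (int p)"
  using euler_criterion[OF p odd_prime_gt_2, of a] by (simp add: cong_iff_dvd_diff dvd_diff_commute)

lemma Legendre_eq_if_cong:
  assumes "int p dvd a - b"
  shows "Legendre a (int p) = Legendre b (int p)"
proof -
  have ab: "[a = b] (mod int p)"
    using assms by (simp add: cong_iff_dvd_diff)
  then have "[c = a] (mod int p) \<longleftrightarrow> [c = b] (mod int p)" for c
    using cong_trans cong_sym by blast
  then have "[a = 0] (mod int p) \<longleftrightarrow> [b = 0] (mod int p)" "QuadRes (int p) a \<longleftrightarrow> QuadRes (int p) b"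
    by (simp_all add: QuadRes_def cong_sym_eq[of _ 0])
  then show ?thesis
    by (simp add: Legendre_def)
qed

lemma Legendre_mult:
  assumes "\<not> int p dvd a" "\<not> int p dvd b"
  shows "Legendre (a * b) (int p) = Legendre a (int p) * Legendre b (int p)"
proof -
  let ?h = "(p - 1) div 2" and ?L = "\<lambda>a. Legendre a (int p)"
  have ab: "\<not> int p dvd a * b"
    using assms prime_dvd_multD[of "int p" a b] p by auto
  have L: "[c ^ ?h = ?L c] (mod int p)" for c
    using Legendre_cong_power by (simp add: cong_iff_dvd_diff)
  have "[?L (a * b) = a ^ ?h * b ^ ?h] (mod int p)"
    using cong_sym[OF L[of "a * b"]] by (simp add: power_mult_distrib)
  then have "[?L (a * b) = ?L a * ?L b] (mod int p)"
    by (rule cong_trans) (intro cong_mult L)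
  then show ?thesis
    using Legendre_sign[OF assms(1)] Legendre_sign[OF assms(2)] Legendre_sign[OF ab]
    by (intro eq_if_cong_sign[OF _ _ _ odd_prime_gt_2]) (auto simp: cong_iff_dvd_diff)
qed

lemma Legendre_square: "\<not> int p dvd a \<Longrightarrow> Legendre (a ^ 2) (int p) = 1"
  using Legendre_mult[of a a] Legendre_sign[of a] by (auto simp: power2_eq_square)

text \<open>The form in which polynomial identities enter: a product congruent to a nonzero square
  forces two signs with product 1.\<close>

lemma Legendre_eq_if_mult_square:
  assumes "\<not> int p dvd a" "\<not> int p dvd b" "int p dvd a * b - c ^ 2"
  shows "Legendre a (int p) = Legendre b (int p)"
proof -
  have pp: "prime (int p)" using p by simp
  have "\<not> int p dvd c"
  proof
    assume "int p dvd c"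
    then have "int p dvd a * b"
      using assms(3) by (metis dvd_add_right_iff diff_add_cancel dvd_power dvd_trans zero_less_numeral add.commute)
    then show False
      using assms prime_dvd_multD[OF pp] by blast
  qed
  then have "Legendre a (int p) * Legendre b (int p) = 1"
    using Legendre_mult[OF assms(1,2)] Legendre_eq_if_cong[OF assms(3)] Legendre_square by simp
  then show ?thesis
    using Legendre_sign[OF assms(1)] Legendre_sign[OF assms(2)] by auto
qed

end

lemma prime_not_square:
  assumes "prime (q::nat)"
  shows "int q \<noteq> m ^ 2"
proof
  assume "int q = m ^ 2"
  then have "q = nat \<bar>m\<bar> * nat \<bar>m\<bar>"
    by (metis abs_ge_zero abs_mult_self_eq nat_int nat_mult_distrib power2_eq_square)
  then show False
    using assms prime_product[of "nat \<bar>m\<bar>" "nat \<bar>m\<bar>"] by auto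
qed

text \<open>
  Thue's argument: if \<open>j\<^sup>2 \<equiv> - 1\<close> modulo \<open>q\<close>, the box of pairs \<open>0 \<le> u, v \<le> \<surd>q\<close> has more than \<open>q\<close>
  points, so two of them agree under \<open>u - j v\<close>.
\<close>

lemma prime_sum_two_squares:
  assumes q: "prime (q::nat)" and q4: "q mod 4 = 1"
  obtains a b :: int where "int q = a ^ 2 + b ^ 2"
proof -
  have odd: "odd q" using q4 by presburger
  have "even ((q - 1) div 2)" using q4 by presburger
  then have "Legendre (- 1) (int q) = 1"
    using Legendre_cong_power[OF q odd, of "- 1"] Legendre_sign[OF q odd, of "- 1"] odd_prime_gt_2[OF q odd]
      zdvd_imp_le[of "int q" 2] q
    by auto
  then obtain j where j: "[j ^ 2 = - 1] (mod int q)"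
    by (auto simp: Legendre_def QuadRes_def split: if_splits)
  define m where "m = nat (floor (sqrt (real q)))"
  have m: "m ^ 2 \<le> q" "q < (m + 1) ^ 2"
  proof -
    have "real m \<le> sqrt (real q)" "sqrt (real q) < real m + 1"
      unfolding m_def by (simp_all add: of_nat_nat)
    then have "real m ^ 2 \<le> real q" "real q < (real m + 1) ^ 2"
      using power_mono[of "real m" "sqrt (real q)" 2] power_strict_mono[of "sqrt (real q)" "real m + 1" 2]
      by simp_all
    then show "m ^ 2 \<le> q" "q < (m + 1) ^ 2"
      by (simp_all flip: of_nat_power of_nat_Suc add: add.commute)
  qed
  \<comment> \<open>Strictness gives \<open>a ^ 2 + b ^ 2 < 2 * int q\<close> below, so that this
    positive multiple of \<open>q\<close> is \<open>q\<close> itself.\<close>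
  have m2: "m ^ 2 < q"
  proof -
    have "m ^ 2 \<noteq> q"
      using prime_not_square[OF q, of "int m"] by auto
    then show ?thesis using m by simp
  qed
  define f where "f = (\<lambda>(u, v). (u - j * v) mod int q)"
  have "\<not> inj_on f ({0..int m} \<times> {0..int m})"
  proof
    assume inj: "inj_on f ({0..int m} \<times> {0..int m})"
    have sub: "f ` ({0..int m} \<times> {0..int m}) \<subseteq> {0..<int q}"
      using prime_gt_0_nat[OF q] by (auto simp: f_def)
    have "card ({0..int m} \<times> {0..int m}) \<le> card {0..<int q}"
      by (rule card_inj_on_le[OF inj sub]) simp
    then have "(m + 1) ^ 2 \<le> q"
      by (simp add: card_cartesian_product power2_eq_square nat_add_distrib)
    then show False using m by simp
  qed
  then obtain u v u' v' where uv: "u \<in> {0..int m}" "v \<in> {0..int m}" "u' \<in> {0..int m}" "v' \<in> {0..int m}"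
    "(u, v) \<noteq> (u', v')" "f (u, v) = f (u', v')"
    unfolding inj_on_def by blast
  define a b where "a = u - u'" and "b = v - v'"
  have "int q dvd (u - j * v) - (u' - j * v')"
    using uv(6) by (simp add: f_def mod_eq_dvd_iff)
  then have "[a = j * b] (mod int q)"
    by (simp add: a_def b_def cong_iff_dvd_diff algebra_simps)
  then have "[a ^ 2 + b ^ 2 = (j * b) ^ 2 + b ^ 2] (mod int q)"
    by (intro cong_add cong_pow cong_refl)
  also have "(j * b) ^ 2 + b ^ 2 = b ^ 2 * (j ^ 2 + 1)"
    by (simp add: power2_eq_square algebra_simps)
  also have "[b ^ 2 * (j ^ 2 + 1) = b ^ 2 * (- 1 + 1)] (mod int q)"
    by (intro cong_mult cong_add j cong_refl)
  finally have dvd: "int q dvd a ^ 2 + b ^ 2"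
    by (simp add: cong_0_iff)
  have "\<bar>a\<bar> \<le> int m" "\<bar>b\<bar> \<le> int m"
    using uv by (auto simp: a_def b_def)
  then have "a ^ 2 \<le> int m ^ 2" "b ^ 2 \<le> int m ^ 2"
    using power_mono[of "\<bar>a\<bar>" "int m" 2] power_mono[of "\<bar>b\<bar>" "int m" 2] by simp_all
  moreover have "int m ^ 2 < int q"
    using m2 by (simp flip: of_nat_power)
  ultimately have lt: "a ^ 2 + b ^ 2 < 2 * int q" by linarith
  have "a \<noteq> 0 \<or> b \<noteq> 0"
    using uv(5) by (auto simp: a_def b_def)
  then have pos: "a ^ 2 + b ^ 2 > 0"
    by (simp add: sum_power2_gt_zero_iff)
  obtain c where c: "a ^ 2 + b ^ 2 = int q * c"
    using dvd by blast
  have "c = 1"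
  proof -
    have "c > 0" using pos c prime_gt_0_nat[OF q] by (simp add: zero_less_mult_iff)
    moreover have "c < 2" using lt c prime_gt_0_nat[OF q] by (simp add: mult.commute)
    ultimately show ?thesis by simp
  qed
  then show ?thesis
    using that[of a b] c by simp
qed

lemma int_sq_mod_8: "odd (a::int) \<Longrightarrow> a ^ 2 mod 8 = 1"
proof -
  assume "odd a"
  then obtain m where m: "a = 2 * m + 1" by (rule oddE)
  have "even (m * (m + 1))" by simp
  then obtain c where "m * (m + 1) = 2 * c" by blast
  then have "a ^ 2 = 8 * c + 1"
    by (simp add: m power2_eq_square algebra_simps)
  then show ?thesis by simp
qed

lemma int_sq_mod_4: "(a::int) ^ 2 mod 4 = (if even a then 0 else 1)"
proof (cases "even a")
  case True
  then show ?thesis by (auto simp: power2_eq_square)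
next
  case False
  then show ?thesis using int_sq_mod_8[of a] by presburger
qed

text \<open>In \<open>a ^ 2 + 4 * c ^ 2\<close> with \<open>a\<close> odd, an odd \<open>c\<close>
  would give residue 5 modulo 8, so the even term is divisible by 4. The sign of \<open>a\<close> is
  then free to make it 1 modulo 4.\<close>

lemma prime_1_mod_8_normal_form:
  assumes q: "prime (q::nat)" and q8: "[q = 1] (mod 8)"
  obtains k l :: int where "int q = (4 * k + 1) ^ 2 + (4 * l) ^ 2"
proof -
  have q8: "q mod 8 = 1" using q8 by (simp add: cong_def)
  then have "q mod 4 = 1" by presburger
  then obtain a0 b0 :: int where ab0: "int q = a0 ^ 2 + b0 ^ 2"
    using prime_sum_two_squares[OF q] by metis
  have "odd (a0 ^ 2 + b0 ^ 2)"
    unfolding ab0[symmetric] using q8 by presburger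
  then have "\<exists>a b. int q = a ^ 2 + b ^ 2 \<and> odd a \<and> even b"
    using ab0 by (cases "even a0") (force simp: add.commute)+
  then obtain a b where ab: "int q = a ^ 2 + b ^ 2" "odd a" "even b" by blast
  obtain c where c: "b = 2 * c" using ab(3) by blast
  have "even c"
  proof (rule ccontr)
    assume "odd c"
    then have "c ^ 2 mod 8 = 1" by (rule int_sq_mod_8)
    moreover have "int q mod 8 = 1" using q8 by (metis of_nat_1 of_nat_mod of_nat_numeral)
    moreover have "int q = a ^ 2 + 4 * c ^ 2"
      using ab(1) by (simp add: c power_mult_distrib)
    moreover have False if "u mod 8 = 1" "v mod 8 = 1" "w mod 8 = 1" "u = v + 4 * w" for u v w :: int
      using that by presburger
    ultimately show False
      using int_sq_mod_8[OF ab(2)] by blast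
  qed
  then obtain l where l: "b = 4 * l" using c by auto
  have "\<exists>k. a = 4 * k + 1 \<or> - a = 4 * k + 1"
    using ab(2) by presburger
  then obtain k where "a = 4 * k + 1 \<or> - a = 4 * k + 1" ..
  then have "int q = (4 * k + 1) ^ 2 + (4 * l) ^ 2"
    using ab(1) unfolding l by (metis power2_minus)
  then show ?thesis using that by blast
qed

subsection \<open>The two base fields\<close>

context quadratic_order
begin

text \<open>The generator may be any \<open>c + d * \<omega>\<close> because the square root of
  \<open>q\<close> is \<open>2 * \<omega>0 - 1\<close> rather than \<open>\<omega>0\<close>.\<close>

lemma rat_adjoin_eq:
  assumes g: "g = c + d * \<omega>" "c \<in> \<rat>" "d \<in> \<rat>" "d \<noteq> 0"
  shows "rat_adjoin {g} = F"
proof -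
  let ?R = "ring_on (UNIV :: complex set)" and ?G = "rat_adjoin {g}"
  interpret R: cring ?R
  proof (intro cringI abelian_groupI comm_monoidI)
    fix x :: complex
    show "\<exists>y\<in>carrier ?R. y \<oplus>\<^bsub>?R\<^esub> x = \<zero>\<^bsub>?R\<^esub>"
      by (intro bexI[of _ "- x"]) (auto simp: ring_on_def)
  qed (auto simp: ring_on_def algebra_simps)
  have neg: "\<ominus>\<^bsub>?R\<^esub> h = - h" for h
    by (rule R.sum_zero_eq_neg[symmetric]) (auto simp: ring_on_def)
  have inv: "inv\<^bsub>?R\<^esub> h = inverse h" if "h \<noteq> 0" for h
    by (rule R.comm_inv_char) (use that in \<open>auto simp: ring_on_def\<close>)
  have zero: "\<zero>\<^bsub>?R\<^esub> = 0"
    by (simp add: ring_on_def)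
  note intros = generate_field.intros[where R = ?R and H = "{g}", folded rat_adjoin_def]
  have sub: "x \<in> F" if "x \<in> ?G" for x
    using that unfolding rat_adjoin_def
  proof (induction rule: generate_field.induct)
    case (incl h)
    then show ?case using g by (auto simp: F_def)
  next
    case (a_inv h)
    then show ?case unfolding neg by blast
  next
    case (m_inv h)
    then show ?case using inv[of h] by (cases "h = 0") (auto simp: zero)
  qed (auto simp: ring_on_def)
  have one: "1 \<in> ?G" and incl: "g \<in> ?G"
    and cl: "\<And>x y. x \<in> ?G \<Longrightarrow> y \<in> ?G \<Longrightarrow> x + y \<in> ?G" "\<And>x y. x \<in> ?G \<Longrightarrow> y \<in> ?G \<Longrightarrow> x * y \<in> ?G"
      "\<And>x. x \<in> ?G \<Longrightarrow> - x \<in> ?G"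
    using intros(1) intros(2)[of g] intros(3) intros(5,6) by (auto simp: neg) (auto simp: ring_on_def)
  have cl0: "inverse x \<in> ?G" if "x \<in> ?G" for x
    using intros(4)[OF that] inv[of x] that by (cases "x = 0") (auto simp: ring_on_def)
  interpret G: algebraic_subfield ?G
    by unfold_locales (use sub subset_Qbar one cl cl0 in auto)
  have \<omega>: "\<omega> = (g - c) / d"
    using g by simp
  have "\<omega> \<in> ?G"
    unfolding \<omega> by (intro G.divide_mem G.diff_mem incl G.Rats_mem g)
  then have "F \<subseteq> ?G"
    using G.Rats_mem by (auto simp: F_def)
  then show ?thesis
    using sub by blast
qed

text \<open>A square root inside \<open>F\<close> would be integral, and multiplicativity would make
  the norm of \<open>elem a b\<close> a square.\<close>

lemma quadratic_order_extension_csqrt: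
  assumes "\<And>m. nrm a b \<noteq> m ^ 2"
  shows "quadratic_order_extension \<omega> t n (csqrt (elem a b))"
proof
  have alg: "algebraic_int (csqrt (elem a b))"
    using elem_int[of a b] by (auto simp: ring_of_integers_def)
  then show "csqrt (elem a b) \<in> Qbar"
    by (auto simp: Qbar_def)
  show "(csqrt (elem a b))\<^sup>2 \<in> F"
    using elem_int[of a b] by (auto simp: ring_of_integers_def)
  show "csqrt (elem a b) \<notin> F"
  proof
    assume "csqrt (elem a b) \<in> F"
    then have "csqrt (elem a b) \<in> \<O> F"
      using alg by (simp add: ring_of_integers_def)
    then obtain c d where cd: "csqrt (elem a b) = elem c d"
      using elem_cases by blast
    then have "elem a b = elem c d * elem c d"
      by (metis power2_csqrt power2_eq_square)
    then have "a = c * c - n * d * d" "b = c * d + d * c + t * d * d"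
      unfolding elem_mult elem_eq_iff by auto
    then have "nrm a b = nrm c d * nrm c d"
      using nrm_mult[of c c d d] by simp
    with assms[of "nrm c d"] show False
      by (simp add: power2_eq_square)
  qed
qed

end

lemma algebraic_subfield_Rats: "algebraic_subfield \<rat>"
  by unfold_locales (auto simp: Qbar_def intro: rat_imp_algebraic)

text \<open>Combining the number with its conjugate makes \<open>2 * a\<close>, \<open>2 * b\<close>
  and \<open>a ^ 2 + b ^ 2\<close> integers, and two squares sum to a multiple of 4 only if both are
  even.\<close>

lemma quadratic_order_gaussian: "quadratic_order \<i> 0 1"
proof
  show "\<i> \<notin> \<rat>"
    by (auto simp: complex_eq_iff elim!: Rats_cases')
  fix a b :: complex assume ab: "a \<in> \<rat>" "b \<in> \<rat>" and int: "algebraic_int (a + b * \<i>)"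
  have real: "cnj a = a" "cnj b = b"
    using ab by (auto elim!: Rats_cases')
  have cnj: "algebraic_int (a - b * \<i>)"
    using algebraic_int_cnj[OF int] by (simp add: real)
  have "algebraic_int ((a + b * \<i>) + (a - b * \<i>))"
    by (rule algebraic_int_add[OF int cnj])
  then have "2 * a \<in> \<int>"
    using ab by (intro rational_algebraic_int_is_int) (auto simp: algebra_simps)
  then obtain x where x: "2 * a = of_int x" by (auto elim: Ints_cases)
  have "algebraic_int (\<i> * ((a - b * \<i>) - (a + b * \<i>)))"
    by (intro algebraic_int_mult algebraic_int_diff int cnj algebraic_int_ii)
  then have "2 * b \<in> \<int>"
    using ab by (intro rational_algebraic_int_is_int) (auto simp: algebra_simps)
  then obtain y where y: "2 * b = of_int y" by (auto elim: Ints_cases)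
  have "algebraic_int ((a + b * \<i>) * (a - b * \<i>))"
    by (rule algebraic_int_mult[OF int cnj])
  then have "a ^ 2 + b ^ 2 \<in> \<int>"
    using ab by (intro rational_algebraic_int_is_int) (auto simp: algebra_simps power2_eq_square)
  then obtain z where z: "a ^ 2 + b ^ 2 = of_int z" by (auto elim: Ints_cases)
  have "(2 * a) ^ 2 + (2 * b) ^ 2 = 4 * of_int z"
    by (simp flip: z)
  then have "of_int (x ^ 2 + y ^ 2) = (of_int (4 * z) :: complex)"
    by (simp add: x y)
  then have xy: "x ^ 2 + y ^ 2 = 4 * z"
    using of_int_eq_iff by blast
  have "even x \<and> even y"
  proof (rule ccontr)
    assume "\<not> (even x \<and> even y)"
    moreover have False if "u + v = 4 * z" "u mod 4 = U" "v mod 4 = V" "U + V = 1 \<or> U + V = 2" for u v U V :: int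
      using that by presburger
    note parity = this
    ultimately show False
      using parity[OF xy int_sq_mod_4 int_sq_mod_4] by (cases "even x"; cases "even y") auto
  qed
  then have "a \<in> \<int> " "b \<in> \<int>"
    using x y by (auto elim!: evenE)
  then show "a \<in> \<int> \<and> b \<in> \<int>" ..
qed simp

text \<open>The difference from the conjugate makes \<open>b q\<close> and \<open>b ^ 2 q\<close>
  integers. As \<open>q\<close> is prime, \<open>b\<close> is then an integer, and so is
  \<open>a\<close>, the number minus \<open>b \<omega>\<close>.\<close>

lemma quadratic_order_sqrt_prime:
  assumes q: "prime (q::nat)" and n: "1 - 4 * n = int q"
  shows "quadratic_order ((1 + of_real (sqrt (real q))) / 2) 1 n"
proof -
  define s where "s = complex_of_real (sqrt (real q))"
  have s2: "s ^ 2 = of_nat q"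
    by (simp add: s_def flip: of_real_power)
  have sint: "algebraic_int s"
    by (auto simp: s_def)
  have s_irr: "s \<notin> \<rat>"
  proof
    assume "s \<in> \<rat>"
    then have "s \<in> \<int>"
      using sint by (intro rational_algebraic_int_is_int)
    then obtain m where "s = of_int m" by (auto elim: Ints_cases)
    then have "of_int (m ^ 2) = (of_int (int q) :: complex)"
      using s2 by simp
    then have "int q = m ^ 2"
      using of_int_eq_iff by metis
    then show False
      using prime_not_square[OF q] by blast
  qed
  define \<omega> where "\<omega> = (1 + s) / 2"
  have s\<omega>: "s = 2 * \<omega> - 1"
    by (simp add: \<omega>_def field_simps)
  have nq: "of_int n = (1 - of_nat q) / (4 :: complex)"
  proof -
    have "of_int (1 - 4 * n) = (of_int (int q) :: complex)"
      using n by simp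
    then show ?thesis by (simp add: field_simps)
  qed
  have sq: "\<omega> ^ 2 = of_int 1 * \<omega> - of_int n"
    using s2 by (simp add: nq \<omega>_def power2_eq_square field_simps)
  have oint: "algebraic_int \<omega>"
  proof
    show "poly [:of_int n, - 1, 1:] \<omega> = 0"
      using sq by (simp add: power2_eq_square algebra_simps)
  qed (auto simp: coeff_pCons split: nat.splits)
  interpret Q: algebraic_subfield "\<rat>"
    by (rule algebraic_subfield_Rats)
  have sQ: "s \<in> Qbar"
    using sint by (auto simp: Qbar_def)
  \<comment> \<open>Complex conjugation fixes the real number \<open>s\<close>, so the conjugation
    is taken from the automorphisms of \<open>Qbar\<close> over the rationals.\<close>
  obtain \<sigma> where \<sigma>: "\<sigma> \<in> Q.Gal" "\<sigma> s \<noteq> s"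
    using Q.ex_automorphism_moving[OF sQ s_irr] .
  have "\<sigma> s ^ 2 = s ^ 2"
    using Q.gal_mult[OF \<sigma>(1) sQ sQ] Q.gal_fix[OF \<sigma>(1), of "of_nat q"] s2 by (simp add: power2_eq_square)
  then have \<sigma>s: "\<sigma> s = - s"
    using \<sigma>(2) by (auto simp: power2_eq_iff)
  have "quadratic_order \<omega> 1 n"
  proof
    show "\<omega> ^ 2 = of_int 1 * \<omega> - of_int n"
      by (rule sq)
    show "\<omega> \<notin> \<rat>"
      using s_irr s\<omega> by auto
    fix a b :: complex assume ab: "a \<in> \<rat>" "b \<in> \<rat>" and int: "algebraic_int (a + b * \<omega>)"
    have ex: "a + b * \<omega> = (a + b / 2) + (b / 2) * s"
      by (simp add: \<omega>_def field_simps)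
    have "\<sigma> ((a + b / 2) + (b / 2) * s) = (a + b / 2) - (b / 2) * s"
    proof -
      have rat: "a + b / 2 \<in> \<rat>" "b / 2 \<in> \<rat>"
        using ab by auto
      then have Qb: "a + b / 2 \<in> Qbar" "b / 2 \<in> Qbar"
        using Q.subset_Qbar by auto
      have "\<sigma> ((a + b / 2) + (b / 2) * s) = \<sigma> (a + b / 2) + \<sigma> (b / 2) * \<sigma> s"
        using Q.gal_add[OF \<sigma>(1) Qb(1) Qbar_closed(2)[OF Qb(2) sQ]] Q.gal_mult[OF \<sigma>(1) Qb(2) sQ]
        by simp
      then show ?thesis
        by (simp add: Q.gal_fix[OF \<sigma>(1) rat(1)] Q.gal_fix[OF \<sigma>(1) rat(2)] \<sigma>s)
    qed
    then have conj: "algebraic_int ((a + b / 2) - (b / 2) * s)"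
      using Q.gal_algebraic_int[OF \<sigma>(1) int] unfolding ex by simp
    have "algebraic_int (((a + b / 2) + (b / 2) * s - ((a + b / 2) - (b / 2) * s)) * s)"
      using int unfolding ex by (intro algebraic_int_mult algebraic_int_diff conj sint)
    moreover have "((a + b / 2) + (b / 2) * s - ((a + b / 2) - (b / 2) * s)) * s = b * of_nat q"
      by (simp add: power2_eq_square[symmetric] s2 algebra_simps)
    ultimately have "algebraic_int (b * of_nat q)"
      by (simp only:)
    then have "b * of_nat q \<in> \<int>"
      using ab by (intro rational_algebraic_int_is_int) auto
    then obtain d where d: "b * of_nat q = of_int d" by (auto elim: Ints_cases)
    have "algebraic_int (((a + b / 2) + (b / 2) * s - ((a + b / 2) - (b / 2) * s)) ^ 2)"
      using int unfolding ex by (intro algebraic_int_power algebraic_int_diff conj)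
    moreover have "((a + b / 2) + (b / 2) * s - ((a + b / 2) - (b / 2) * s)) ^ 2 = b ^ 2 * of_nat q"
      by (simp add: power_mult_distrib s2)
    ultimately have "algebraic_int (b ^ 2 * of_nat q)"
      by (simp only:)
    then have "b ^ 2 * of_nat q \<in> \<int>"
      using ab by (intro rational_algebraic_int_is_int) auto
    then obtain e where e: "b ^ 2 * of_nat q = of_int e" by (auto elim: Ints_cases)
    have "(b * of_nat q) ^ 2 = (b ^ 2 * of_nat q) * of_nat q"
      by (simp add: power2_eq_square)
    then have "of_int (d ^ 2) = (of_int (e * int q) :: complex)"
      unfolding d e by simp
    then have "d ^ 2 = e * int q"
      using of_int_eq_iff by blast
    then have "int q dvd d"
      using q by (metis dvd_triv_right prime_dvd_power prime_nat_int_transfer)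
    then obtain f where "d = int q * f" by blast
    then have "b = of_int f"
      using d prime_gt_0_nat[OF q] by (simp add: mult.commute)
    moreover have "algebraic_int a"
    proof -
      have "algebraic_int (a + b * \<omega> - b * \<omega>)"
        using \<open>b = of_int f\<close>
        by (intro algebraic_int_diff[OF int algebraic_int_mult[OF int_imp_algebraic_int oint]]) simp
      then show ?thesis by simp
    qed
    ultimately show "a \<in> \<int> \<and> b \<in> \<int>"
      using rational_algebraic_int_is_int ab by auto
  qed
  then show ?thesis
    by (simp add: \<omega>_def s_def)
qed

subsection \<open>Matching the two characters\<close>

lemma (in quadratic_order_extension) delta_int: "\<delta> ^ 2 = elem a b \<Longrightarrow> \<delta> \<in> \<O> E"
proof -
  assume "\<delta> ^ 2 = elem a b"
  then have "algebraic_int (\<delta> ^ 2)"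
    using elem_int[of a b] by (auto simp: ring_of_integers_def)
  then have "algebraic_int \<delta>"
    by (rule algebraic_int_if_square)
  then show ?thesis
    using delta_mem_E by (simp add: ring_of_integers_def)
qed

locale dihedral_setup =
  fixes q :: nat and k l :: int
  assumes q: "prime q" and q_eq: "int q = (4 * k + 1) ^ 2 + (4 * l) ^ 2"
begin

abbreviation "A \<equiv> 4 * k + 1"
abbreviation "B \<equiv> 4 * l"

text \<open>The norm \<open>(1 - q) / 4\<close> of \<open>\<omega>0\<close>, rewritten in
  \<open>k\<close> and \<open>l\<close>.\<close>

definition n0 :: int where "n0 = - (4 * k ^ 2 + 2 * k + 4 * l ^ 2)"

definition \<omega>0 :: complex where "\<omega>0 = (1 + of_real (sqrt (real q))) / 2"

definition \<delta>K :: complex where "\<delta>K = csqrt (of_int A + of_int B * \<i>)"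

text \<open>The radicand is (A + sqrt q) / 2 in the basis \<open>1, \<omega>0\<close>; its norm is -
  (2 l)^2.\<close>

definition \<delta>M :: complex where "\<delta>M = csqrt (of_int (2 * k) + of_int 1 * \<omega>0)"

lemma disc: "1 - 4 * n0 = int q"
  by (simp add: q_eq n0_def power2_eq_square algebra_simps)

lemma l_nonzero: "l \<noteq> 0"
  using prime_not_square[OF q, of A] q_eq by auto

lemma extK: "quadratic_order_extension \<i> 0 1 \<delta>K"
proof -
  interpret K: quadratic_order "\<i>" 0 1 by (rule quadratic_order_gaussian)
  have "K.nrm A B = int q"
    by (simp add: K.nrm_def q_eq)
  then show ?thesis
    using K.quadratic_order_extension_csqrt[of A B] prime_not_square[OF q]
    by (simp add: K.elem_def \<delta>K_def)
qed

lemma extM: "quadratic_order_extension \<omega>0 1 n0 \<delta>M"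
proof -
  interpret M: quadratic_order \<omega>0 1 n0
    unfolding \<omega>0_def by (rule quadratic_order_sqrt_prime[OF q disc])
  have "M.nrm (2 * k) 1 = - ((2 * l) ^ 2)"
    unfolding M.nrm_def by (simp add: n0_def power2_eq_square algebra_simps)
  then have "M.nrm (2 * k) 1 < 0"
    using l_nonzero by simp
  then have "M.nrm (2 * k) 1 \<noteq> m ^ 2" for m
    by (metis not_less zero_le_power2)
  then show ?thesis
    using M.quadratic_order_extension_csqrt[of "2 * k" 1] by (simp add: M.elem_def \<delta>M_def)
qed

sublocale K: quadratic_order_extension "\<i>" 0 1 \<delta>K
  by (rule extK)

sublocale M: quadratic_order_extension \<omega>0 1 n0 \<delta>M
  by (rule extM)

lemma deltaK_square: "\<delta>K ^ 2 = K.elem A B"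
  by (simp add: \<delta>K_def K.elem_def)

lemma deltaM_square: "\<delta>M ^ 2 = M.elem (2 * k) 1"
  by (simp add: \<delta>M_def M.elem_def)

lemma omega0_square: "\<omega>0 ^ 2 = \<omega>0 - of_int n0"
  using M.omega_square by simp

lemma rootK_iff: "K.root_mod p r \<longleftrightarrow> int p dvd r ^ 2 + 1"
  by (simp add: K.root_mod_def)

lemma rootM_iff: "M.root_mod p r \<longleftrightarrow> int p dvd r ^ 2 - r + n0"
  by (simp add: M.root_mod_def)

abbreviation "valK \<equiv> frobenius_value K.F K.\<psi>"
abbreviation "valM \<equiv> frobenius_value M.F M.\<psi>"

section \<open>The odd primes other than q\<close>

context
  fixes p :: nat assumes p: "prime p" and odd: "odd p"
begin

abbreviation "chi a \<equiv> Legendre a (int p)"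

lemma pp: "prime (int p)"
  using p by simp

lemma not_dvd_2: "\<not> int p dvd 2"
  using odd_prime_gt_2[OF p odd] zdvd_imp_le[of "int p" 2] by auto

lemma not_dvd_q: "p \<noteq> q \<Longrightarrow> \<not> int p dvd int q"
  using primes_dvd_imp_eq[OF p q] by auto

lemma valK_deg1:
  assumes "K.root_mod p j" "\<not> int p dvd A + B * j"
  shows "valK (K.deg1_prime p j) = of_int (chi (A + B * j))"
  using K.frobenius_value_deg1[OF p assms(1) odd K.delta_int[OF deltaK_square] K.one_mem _ deltaK_square assms(2)]
  by simp

text \<open>The square of \<open>\<delta>M\<close> reduces to \<open>r + 2 * k\<close>. Where this
  vanishes, \<open>\<kappa>\<close>, which is minus the conjugate of that square, represents the
  same class modulo squares and reduces to \<open>r - 1 - 2 * k\<close>. Both cannot vanish: their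
  sum is \<open>2 * r - 1\<close>, whose square is \<open>q\<close> modulo \<open>p\<close>.\<close>

lemma valM_deg1:
  assumes r: "M.root_mod p r" and pq: "p \<noteq> q"
  obtains w where "w = r + 2 * k \<or> w = r - 1 - 2 * k" "\<not> int p dvd w"
    "valM (M.deg1_prime p r) = of_int (chi w)"
proof (cases "int p dvd r + 2 * k")
  case False
  then show ?thesis
    using M.frobenius_value_deg1[OF p r odd M.delta_int[OF deltaM_square] M.one_mem _ deltaM_square]
      that[of "r + 2 * k"] by (simp add: add.commute)
next
  case True
  have nd: "\<not> int p dvd r - 1 - 2 * k"
  proof
    assume d: "int p dvd r - 1 - 2 * k"
    have "int q = (2 * r - 1) ^ 2 - 4 * (r ^ 2 - r + n0)"
      unfolding disc[symmetric] by (simp add: power2_eq_square algebra_simps)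
    also have "(2 * r - 1) = (r + 2 * k) + (r - 1 - 2 * k)"
      by simp
    finally have "int p dvd int q"
      using r dvd_add[OF True d] unfolding rootM_iff
      by (metis dvd_diff dvd_mult dvd_mult2 power2_eq_square)
    then show False
      using not_dvd_q[OF pq] by simp
  qed
  define \<kappa> where "\<kappa> = M.elem (- 1 - 2 * k) 1"
  \<comment> \<open>Chosen so that \<open>(v * \<delta>M) ^ 2 = \<kappa>\<close>, given that
    \<open>\<kappa> * \<delta>M ^ 2\<close> is the square of \<open>2 * l\<close>.\<close>
  define v where "v = \<kappa> / of_int (2 * l)"
  have \<kappa>: "\<kappa> * \<delta>M ^ 2 = of_int ((2 * l) ^ 2)"
    unfolding \<kappa>_def deltaM_square M.elem_mult M.elem_of_int M.elem_eq_iff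
    by (simp add: n0_def power2_eq_square algebra_simps)
  have v: "v \<in> M.F"
    unfolding v_def \<kappa>_def using M.elem_int[of "- 1 - 2 * k" 1]
    by (intro M.divide_mem M.of_int_mem) (auto simp: ring_of_integers_def)
  have sq: "(v * \<delta>M) ^ 2 = \<kappa>"
  proof -
    have "(v * \<delta>M) ^ 2 = \<kappa> * (\<kappa> * \<delta>M ^ 2) / of_int ((2 * l) ^ 2)"
      by (simp add: v_def power_mult_distrib power_divide) (simp add: power2_eq_square)
    then show ?thesis
      using l_nonzero unfolding \<kappa> by simp
  qed
  have "algebraic_int \<kappa>"
    using M.elem_int[of "- 1 - 2 * k" 1] by (simp add: ring_of_integers_def \<kappa>_def)
  then have "algebraic_int (v * \<delta>M)"
    unfolding sq[symmetric] by (rule algebraic_int_if_square)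
  then have int: "v * \<delta>M \<in> \<O> M.E"
    using v M.F_subset_E M.delta_mem_E by (auto simp: ring_of_integers_def)
  have "valM (M.deg1_prime p r) = of_int (chi (- 1 - 2 * k + 1 * r))"
    using M.frobenius_value_deg1[OF p r odd int v refl sq[unfolded \<kappa>_def]] nd
    by (simp add: algebra_simps)
  moreover have "- 1 - 2 * k + 1 * r = r - 1 - 2 * k"
    by simp
  ultimately show ?thesis
    using that nd by metis
qed

text \<open>The identity 2 (A + sqrt q) alpha = (A + sqrt q + B i)^2, reduced modulo
  \<open>p\<close> with \<open>2 * r - 1\<close> for sqrt q and \<open>j\<close> for i and divided
  by 4, says that \<open>w * (A + B * j)\<close> is the square of
  \<open>w + 2 * l * j\<close>.\<close>

lemma chi_match:
  assumes r: "M.root_mod p r" and j: "K.root_mod p j"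
    and w: "w = r + 2 * k \<or> w = r - 1 - 2 * k" "\<not> int p dvd w" and nd: "\<not> int p dvd A + B * j"
  shows "chi w = chi (A + B * j)"
proof -
  from w(1) show ?thesis
  proof
    assume w1: "w = r + 2 * k"
    have "w * (A + B * j) - (w + 2 * l * j) ^ 2 = - (r ^ 2 - r + n0) - 4 * l ^ 2 * (j ^ 2 + 1)"
      by (simp add: w1 n0_def power2_eq_square algebra_simps)
    also have "int p dvd \<dots>"
      using r j unfolding rootM_iff rootK_iff by (intro dvd_diff dvd_mult) (simp_all only: dvd_minus_iff)
    finally show ?thesis
      by (rule Legendre_eq_if_mult_square[OF p odd w(2) nd])
  next
    assume w2: "w = r - 1 - 2 * k"
    \<comment> \<open>The same identity with - sqrt q for sqrt q, where A - sqrt q becomes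
      \<open>- 2 * w\<close>; the resulting sign is absorbed by \<open>j\<close>, a square root of
      \<open>- 1\<close>.\<close>
    have "w * (A + B * j) - (j * (w - 2 * l * j)) ^ 2 =
      (r ^ 2 - r + n0) - (w ^ 2 - 4 * w * l * j + 4 * l ^ 2 * j ^ 2 - 4 * l ^ 2) * (j ^ 2 + 1)"
      by (simp add: w2 n0_def power2_eq_square algebra_simps)
    also have "int p dvd \<dots>"
      using r j unfolding rootM_iff rootK_iff by (intro dvd_diff dvd_mult)
    finally show ?thesis
      by (rule Legendre_eq_if_mult_square[OF p odd w(2) nd])
  qed
qed

text \<open>The norm of \<open>\<delta>M ^ 2\<close> is minus a square. Concretely, the candidates
  for \<open>- w'\<close> are those for \<open>w\<close>, and their product is
  \<open>(2 * l) ^ 2\<close> modulo \<open>p\<close>, so \<open>w\<close> and \<open>- w'\<close>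
  have the same symbol in all cases.\<close>

lemma chi_conj:
  assumes r: "M.root_mod p r"
    and w: "w = r + 2 * k \<or> w = r - 1 - 2 * k" "\<not> int p dvd w"
    and w': "w' = (1 - r) + 2 * k \<or> w' = (1 - r) - 1 - 2 * k" "\<not> int p dvd w'"
  shows "chi w * chi w' = chi (- 1)"
proof -
  have m1: "\<not> int p dvd - 1"
    using p by (auto simp: prime_nat_iff)
  have ww: "\<not> int p dvd - w'"
    using w'(2) by (simp only: dvd_minus_iff not_False_eq_True)
  have "chi w = chi (- w')"
  proof (cases "w = - w'")
    case False
    then have "w = r + 2 * k \<and> w' = - (r - 1 - 2 * k) \<or> w = r - 1 - 2 * k \<and> w' = - (r + 2 * k)"
      using w(1) w'(1) by auto
    then have "w * - w' = (r + 2 * k) * (r - 1 - 2 * k)"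
      by (elim disjE conjE; hypsubst) (simp_all only: minus_minus mult.commute)
    then have "w * - w' - (2 * l) ^ 2 = r ^ 2 - r + n0"
      by (simp add: n0_def power2_eq_square algebra_simps)
    then show ?thesis
      using r unfolding rootM_iff by (intro Legendre_eq_if_mult_square[OF p odd w(2) ww, of "2 * l"]) simp
  qed simp
  moreover have "chi (- w') = chi (- 1) * chi w'"
    using Legendre_mult[OF p odd m1 w'(2)] by simp
  moreover have "chi w' * chi w' = 1"
    using Legendre_sign[OF p odd w'(2)] by auto
  ultimately show ?thesis by simp
qed

lemma chi_minus_1_eq_1: "K.root_mod p j \<Longrightarrow> chi (- 1) = 1"
proof -
  assume j: "K.root_mod p j"
  have "\<not> int p dvd - 1"
    using p by (auto simp: prime_nat_iff)
  moreover have "[j ^ 2 = - 1] (mod int p)"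
    using j by (simp add: rootK_iff cong_iff_dvd_diff)
  ultimately show ?thesis
    by (auto simp: Legendre_def QuadRes_def cong_0_iff)
qed

lemma chi_nonresidue:
  assumes "int p dvd a ^ ((p - 1) div 2) + 1" "\<not> int p dvd a"
  shows "chi a = - 1"
proof -
  have "- 1 = chi a"
    by (rule M.Legendre_eqI[OF p odd assms(2)]) (use assms(1) in auto)
  then show ?thesis by simp
qed

lemma chi_minus_1_eq_minus_1: "(\<And>j. \<not> K.root_mod p j) \<Longrightarrow> chi (- 1) = - 1"
proof -
  assume no: "\<And>j. \<not> K.root_mod p j"
  have m1: "\<not> int p dvd - 1"
    using p by (auto simp: prime_nat_iff)
  have two: "\<not> int p dvd 2 ^ 2"
    using not_dvd_2 prime_dvd_power[OF pp] by blast
  have m4: "\<not> int p dvd - 4"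
    using two by simp
  have "chi (- 4) = - 1"
    by (rule chi_nonresidue[OF _ m4]) (use K.disc_nonresidue[OF p no odd] in simp)
  moreover have "chi (- 4) = chi (- 1) * chi (2 ^ 2)"
    using Legendre_mult[OF p odd m1 two] by simp
  ultimately show ?thesis
    using Legendre_square[OF p odd not_dvd_2] by simp
qed

lemma chi_q_eq_minus_1: "(\<And>r. \<not> M.root_mod p r) \<Longrightarrow> p \<noteq> q \<Longrightarrow> chi (int q) = - 1"
proof -
  assume no: "\<And>r. \<not> M.root_mod p r" and pq: "p \<noteq> q"
  have "\<not> int p dvd int q"
    using not_dvd_q[OF pq] by simp
  then show ?thesis
    by (rule chi_nonresidue[rotated]) (use M.disc_nonresidue[OF p no odd] disc in simp)
qed

lemma not_root_K_double: "K.root_mod p j \<Longrightarrow> \<not> int p dvd 2 * j - 0"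
proof
  assume j: "K.root_mod p j" and "int p dvd 2 * j - 0"
  then have "int p dvd j"
    using prime_dvd_multD[OF pp, of 2 j] not_dvd_2 by auto
  then have "int p dvd j ^ 2 + 1 - j * j"
    using j unfolding rootK_iff by (intro dvd_diff dvd_mult2)
  then show False
    using p by (simp add: power2_eq_square prime_nat_iff)
qed

text \<open>The relevant norm is \<open>- ((2 * l) ^ 2)\<close>. It is nonzero modulo
  \<open>p\<close>, since for \<open>p\<close> dividing \<open>l\<close> the number
  \<open>2 * k + 1\<close> would be a root and \<open>p\<close> not inert.\<close>

lemma valM_deg2:
  assumes no: "\<And>r. \<not> M.root_mod p r"
  shows "valM (M.deg2_prime p) = of_int (chi (- 1))"
proof -
  have m1: "\<not> int p dvd - 1"
    using p by (auto simp: prime_nat_iff)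
  have nrm: "M.nrm (2 * k) 1 = - 1 * (2 * l) ^ 2"
    unfolding M.nrm_def by (simp add: n0_def power2_eq_square algebra_simps)
  have "\<not> int p dvd l"
  proof
    assume "int p dvd l"
    then have "M.root_mod p (2 * k + 1)"
      unfolding rootM_iff by (simp add: n0_def power2_eq_square algebra_simps)
    then show False using no by blast
  qed
  then have l: "\<not> int p dvd 2 * l"
    using prime_dvd_multD[OF pp] not_dvd_2 by blast
  then have l2: "\<not> int p dvd (2 * l) ^ 2"
    using prime_dvd_power[OF pp] by blast
  have nd: "\<not> int p dvd M.nrm (2 * k) 1"
    unfolding nrm using l2 by simp
  have "valM (M.deg2_prime p) = of_int (chi (M.nrm (2 * k) 1))"
    by (rule M.frobenius_value_deg2[OF p no odd M.delta_int[OF deltaM_square] deltaM_square nd])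
  also have "chi (M.nrm (2 * k) 1) = chi (- 1)"
    unfolding nrm using Legendre_mult[OF p odd m1 l2] Legendre_square[OF p odd l] by simp
  finally show ?thesis .
qed

lemma valK_deg2:
  assumes no: "\<And>j. \<not> K.root_mod p j" and pq: "p \<noteq> q"
  shows "valK (K.deg2_prime p) = of_int (chi (int q))"
proof -
  have nrm: "K.nrm A B = int q"
    by (simp add: K.nrm_def q_eq)
  have nd: "\<not> int p dvd K.nrm A B"
    unfolding nrm using not_dvd_q[OF pq] by simp
  show ?thesis
    using K.frobenius_value_deg2[OF p no odd K.delta_int[OF deltaK_square] deltaK_square nd]
    unfolding nrm .
qed

lemma conj_product: "K.root_mod p j \<Longrightarrow> int p dvd (A + B * j) * (A + B * (0 - j)) - int q"
proof -
  assume j: "K.root_mod p j"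
  have "(A + B * j) * (A + B * (0 - j)) - int q = - (B ^ 2) * (j ^ 2 + 1)"
    by (simp add: q_eq power2_eq_square algebra_simps)
  then show ?thesis
    using j unfolding rootK_iff by (metis dvd_mult)
qed

lemma conj_nonzero:
  assumes j: "K.root_mod p j" and pq: "p \<noteq> q"
  shows "\<not> int p dvd A + B * j" "\<not> int p dvd A + B * (0 - j)"
proof -
  have "\<not> int p dvd int q"
    using not_dvd_q[OF pq] by simp
  then have "\<not> int p dvd (A + B * j) * (A + B * (0 - j))"
    using conj_product[OF j] by (metis dvd_diff diff_diff_eq2 add_diff_cancel_left' add.commute)
  then show "\<not> int p dvd A + B * j" "\<not> int p dvd A + B * (0 - j)"
    by (metis dvd_mult2, metis dvd_mult)
qed

text \<open>If \<open>p\<close> splits in both fields, \<open>chi_match\<close> equates the values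
  prime by prime. If it splits in just one, the two values there are 1 and \<open>- 1\<close> and
  the inert side has value 1, so both factors invert \<open>1 - x ^ 2\<close>. If it is inert in
  both, \<open>chi (- 1)\<close> and \<open>chi (int q)\<close> are both \<open>- 1\<close> and both
  factors invert \<open>1 + x ^ 2\<close>.\<close>

lemma local_factor_eq_odd:
  assumes pq: "p \<noteq> q"
  shows "K.local_factor s p = M.local_factor s p"
proof -
  define x :: complex where "x = of_nat p powr (- s)"
  have rM2: "\<not> int p dvd 2 * r - 1" if r: "M.root_mod p r" for r
  proof
    assume d: "int p dvd 2 * r - 1"
    have "int q = (2 * r - 1) * (2 * r - 1) - 4 * (r ^ 2 - r + n0)"
      unfolding disc[symmetric] by (simp add: power2_eq_square algebra_simps)
    then have "int p dvd int q"
      using d r unfolding rootM_iff by (metis dvd_diff dvd_mult)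
    then show False
      using not_dvd_q[OF pq] by simp
  qed
  have K1: "K.local_factor s p = inverse (1 - of_int (chi (A + B * j)) * x) * inverse (1 - of_int (chi (A + B * (0 - j))) * x)"
    if j: "K.root_mod p j" for j
    unfolding K.local_factor_split[OF p j not_root_K_double[OF j]] x_def
      valK_deg1[OF j conj_nonzero(1)[OF j pq]] valK_deg1[OF K.root_mod_conj[OF j] conj_nonzero(2)[OF j pq]] ..
  have K2: "K.local_factor s p = inverse (1 - of_int (chi (int q)) * x ^ 2)" if no: "\<And>j. \<not> K.root_mod p j"
    using K.local_factor_inert[OF p no] valK_deg2[OF no pq] by (simp only: x_def)
  have M2: "M.local_factor s p = inverse (1 - of_int (chi (- 1)) * x ^ 2)" if no: "\<And>r. \<not> M.root_mod p r"
    using M.local_factor_inert[OF p no] valM_deg2[OF no] by (simp only: x_def)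
  have prod: "inverse (1 - x) * inverse (1 + x) = inverse (1 - x ^ 2)"
    by (simp add: power2_eq_square algebra_simps flip: inverse_mult_distrib)
  show ?thesis
  proof (cases "\<exists>r. M.root_mod p r")
    case True
    then obtain r where r: "M.root_mod p r" ..
    obtain w where w: "w = r + 2 * k \<or> w = r - 1 - 2 * k" "\<not> int p dvd w"
      "valM (M.deg1_prime p r) = of_int (chi w)"
      using valM_deg1[OF r pq] .
    obtain w' where w': "w' = (1 - r) + 2 * k \<or> w' = (1 - r) - 1 - 2 * k" "\<not> int p dvd w'"
      "valM (M.deg1_prime p (1 - r)) = of_int (chi w')"
      using valM_deg1[OF M.root_mod_conj[OF r] pq] .
    have M1: "M.local_factor s p = inverse (1 - of_int (chi w) * x) * inverse (1 - of_int (chi w') * x)"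
      using M.local_factor_split[OF p r rM2[OF r]] w(3) w'(3) by (simp only: x_def)
    show ?thesis
    proof (cases "\<exists>j. K.root_mod p j")
      case True
      then obtain j where j: "K.root_mod p j" ..
      note nd = conj_nonzero[OF j pq]
      show ?thesis
        unfolding K1[OF j] M1 chi_match[OF r j w(1,2) nd(1)]
          chi_match[OF M.root_mod_conj[OF r] K.root_mod_conj[OF j] w'(1,2) nd(2)] ..
    next
      case False
      then have no: "\<And>j. \<not> K.root_mod p j" by blast
      have "chi w * chi w' = - 1"
        using chi_conj[OF r w(1,2) w'(1,2)] chi_minus_1_eq_minus_1[OF no] by simp
      then have "chi w = 1 \<and> chi w' = - 1 \<or> chi w = - 1 \<and> chi w' = 1"
        using Legendre_sign[OF p odd w(2)] Legendre_sign[OF p odd w'(2)] by auto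
      then have "M.local_factor s p = inverse (1 - x ^ 2)"
        unfolding M1 using prod by (auto simp: mult.commute)
      moreover have "chi (int q) = 1"
      proof -
        have "int q - (2 * r - 1) ^ 2 = - 4 * (r ^ 2 - r + n0)"
          unfolding disc[symmetric] by (simp add: power2_eq_square algebra_simps)
        then have "int p dvd int q - (2 * r - 1) ^ 2"
          using r unfolding rootM_iff by (metis dvd_mult)
        then show ?thesis
          using Legendre_eq_if_cong[OF p odd] Legendre_square[OF p odd rM2[OF r]] by simp
      qed
      ultimately show ?thesis
        using K2[OF no] by simp
    qed
  next
    case False
    then have noM: "\<And>r. \<not> M.root_mod p r" by blast
    note q1 = chi_q_eq_minus_1[OF noM pq]
    show ?thesis
    proof (cases "\<exists>j. K.root_mod p j")
      case True
      then obtain j where j: "K.root_mod p j" ..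
      note nd = conj_nonzero[OF j pq]
      have "chi (A + B * j) * chi (A + B * (0 - j)) = - 1"
        using Legendre_mult[OF p odd nd] Legendre_eq_if_cong[OF p odd conj_product[OF j]] q1 by simp
      then have "chi (A + B * j) = 1 \<and> chi (A + B * (0 - j)) = - 1 \<or>
          chi (A + B * j) = - 1 \<and> chi (A + B * (0 - j)) = 1"
        using Legendre_sign[OF p odd nd(1)] Legendre_sign[OF p odd nd(2)] by auto
      then have "K.local_factor s p = inverse (1 - x ^ 2)"
        unfolding K1[OF j] using prod by (elim disjE conjE) (simp_all add: mult.commute)
      then show ?thesis
        unfolding M2[OF noM] using chi_minus_1_eq_1[OF j] by simp
    next
      case False
      then have no: "\<And>j. \<not> K.root_mod p j" by blast
      show ?thesis
        unfolding K2[OF no] M2[OF noM] q1 chi_minus_1_eq_minus_1[OF no] ..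
    qed
  qed
qed

end

end

section \<open>The prime q\<close>

context dihedral_setup
begin

lemma q_gt_1: "q > 1"
  using q prime_gt_1_nat by blast

lemma odd_q: "odd q"
proof -
  have "odd (int q)"
    unfolding q_eq by simp
  then show ?thesis by simp
qed

lemma not_q_dvd: "\<not> int q dvd A" "\<not> int q dvd B"
proof -
  have lt: "\<not> int q dvd c" if c: "c \<noteq> 0" "c ^ 2 \<le> int q" for c :: int
  proof
    assume "int q dvd c"
    then have "int q \<le> \<bar>c\<bar>"
      using c(1) zdvd_imp_le[of "int q" "\<bar>c\<bar>"] by simp
    then have "int q ^ 2 \<le> c ^ 2"
      using power_mono[of "int q" "\<bar>c\<bar>" 2] by simp
    then have "int q * int q \<le> int q"
      using c(2) by (simp add: power2_eq_square)
    then show False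
      using q_gt_1 by simp
  qed
  have "A \<noteq> 0" by presburger
  then show "\<not> int q dvd A"
    using lt[of A] q_eq by simp
  show "\<not> int q dvd B"
    using lt[of B] q_eq l_nonzero by simp
qed

text \<open>This prime is generated by \<open>\<alpha>\<close>, of norm \<open>q\<close>. If
  \<open>v ^ 2 * \<alpha>\<close> is integral, then \<open>z = v * \<alpha>\<close> has its square
  in the prime, so \<open>z\<close> lies in it and is divisible by \<open>\<alpha>\<close>. Hence
  \<open>v\<close> is integral and \<open>v ^ 2 * \<alpha>\<close> lies in the prime.\<close>

lemma ramified_K:
  assumes j: "K.root_mod q j" and jA: "int q dvd A + B * j"
  shows "valK (K.deg1_prime q j) = 0"
proof (rule K.frobenius_value_ramified[OF K.primes_above_deg1[OF q j]])
  fix v s n assume v: "v \<in> K.F" "s \<in> \<O> K.F" "n \<in> \<O> K.F"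
    and eq: "v ^ 2 * \<delta>K ^ 2 = s ^ 2 - 4 * n"
  let ?P = "K.deg1_prime q j"
  interpret P: integral_prime K.F ?P
    by unfold_locales (rule K.deg1_prime_mem[OF q j])
  define \<alpha> where "\<alpha> = K.elem A B"
  have \<alpha>P: "\<alpha> \<in> ?P"
    using jA by (simp add: \<alpha>_def)
  have \<alpha>O: "\<alpha> \<in> \<O> K.F"
    by (simp add: \<alpha>_def)
  have y: "v ^ 2 * \<alpha> \<in> \<O> K.F"
  proof -
    have "(4::complex) \<in> \<O> K.F"
      using K.of_nat_int[of 4] by simp
    then have "s ^ 2 - 4 * n \<in> \<O> K.F"
      using v by blast
    then show ?thesis
      using eq by (simp add: deltaK_square \<alpha>_def)
  qed
  define z where "z = v * \<alpha>"
  have z2: "z ^ 2 = \<alpha> * (v ^ 2 * \<alpha>)"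
    by (simp add: z_def power2_eq_square)
  have "algebraic_int (z ^ 2)"
    unfolding z2 using y \<alpha>O by (auto simp: ring_of_integers_def intro!: algebraic_int_mult)
  then have "algebraic_int z"
    by (rule algebraic_int_if_square)
  then have zO: "z \<in> \<O> K.F"
    using v(1) \<alpha>O by (auto simp: ring_of_integers_def z_def)
  have "z ^ 2 \<in> ?P"
    unfolding z2 by (rule P.prime_mult'[OF \<alpha>P y])
  then have zP: "z \<in> ?P"
    by (rule P.prime_power[OF zO])
  obtain c d where z: "z = K.elem c d"
    using K.elem_cases[OF zO] by blast
  have cd: "int q dvd c + d * j"
    using zP by (simp add: z)
  \<comment> \<open>The left sides of \<open>e1\<close> and \<open>e2\<close> are the coordinates of
    \<open>z\<close> times the conjugate of \<open>\<alpha>\<close>; divisibility of both by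
    \<open>q\<close> is divisibility of \<open>z\<close> by \<open>\<alpha>\<close>.\<close>
  have e1: "c * A + B * d = A * (c + d * j) - d * j * (A + B * j) + d * B * (j ^ 2 + 1)"
    by (simp add: power2_eq_square algebra_simps)
  have e2: "d * A - c * B = d * (A + B * j) - B * (c + d * j)"
    by (simp add: algebra_simps)
  have "int q dvd c * A + B * d"
    unfolding e1
    by (rule dvd_add[OF dvd_diff[OF dvd_mult[OF cd] dvd_mult[OF jA]] dvd_mult[OF j[unfolded rootK_iff]]])
  moreover have "int q dvd d * A - c * B"
    unfolding e2 by (rule dvd_diff[OF dvd_mult[OF jA] dvd_mult[OF cd]])
  ultimately obtain e f where ef: "c * A + B * d = int q * e" "d * A - c * B = int q * f"
    by (auto elim!: dvdE)
  have "z * K.elem A (- B) = of_nat q * K.elem e f"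
    unfolding z K.elem_of_nat K.elem_mult K.elem_eq_iff
    using ef by (simp add: algebra_simps)
  moreover have "\<alpha> * K.elem A (- B) = of_nat q"
    unfolding \<alpha>_def K.elem_of_nat K.elem_mult K.elem_eq_iff
    by (simp add: q_eq power2_eq_square algebra_simps)
  then have "z * K.elem A (- B) = of_nat q * v"
    by (simp add: z_def mult.assoc)
  ultimately have "v = K.elem e f"
    using q_gt_1 by simp
  then have "v ^ 2 * \<alpha> \<in> ?P"
    by (intro P.prime_mult \<alpha>P) auto
  then show "v ^ 2 * \<delta>K ^ 2 \<in> ?P"
    by (simp add: deltaK_square \<alpha>_def)
qed

text \<open>In K the prime generated by alpha contributes 1, and at the conjugate prime alpha is
  congruent to \<open>2 * A\<close>. In M there is one prime above \<open>q\<close>, at which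
  \<open>\<omega>0\<close> is 1/2 and \<open>\<delta>M ^ 2\<close> is A / 2, differing from
  \<open>2 * A\<close> by the square 4.\<close>

lemma local_factor_eq_q: "K.local_factor s q = M.local_factor s q"
proof -
  have two: "\<not> int q dvd 2"
    by (rule not_dvd_2[OF q odd_q])
  have pq: "prime (int q)" using q by simp
  have A2: "\<not> int q dvd 2 * A"
    using two not_q_dvd(1) prime_dvd_multD[OF pq] by blast
  have "Rings.coprime B (int q)"
    using prime_imp_coprime[OF pq not_q_dvd(2)] by (simp add: coprime_commute)
  then obtain c where c: "[B * c = 1] (mod int q)"
    using cong_solve_coprime_int by blast
  \<comment> \<open>The root \<open>- A / B\<close> modulo \<open>q\<close>, at which alpha
    vanishes.\<close>
  define j where "j = - A * c"
  have jA: "int q dvd A + B * j"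
  proof -
    have "A + B * j = - A * (B * c - 1)"
      by (simp add: j_def algebra_simps)
    then show ?thesis
      using c by (metis cong_iff_dvd_diff dvd_mult)
  qed
  have j: "K.root_mod q j"
  proof -
    have "B ^ 2 * (j ^ 2 + 1) = (A + B * j) * (B * j - A) + int q"
      by (simp add: q_eq power2_eq_square algebra_simps)
    then have "int q dvd B ^ 2 * (j ^ 2 + 1)"
      using jA by simp
    then show ?thesis
      using not_q_dvd(2) prime_dvd_multD[OF pq] prime_dvd_power[OF pq] unfolding rootK_iff by blast
  qed
  have w: "\<not> int q dvd A + B * (0 - j)"
  proof
    assume "int q dvd A + B * (0 - j)"
    then have "int q dvd (A + B * j) + (A + B * (0 - j))"
      using jA by (rule dvd_add[rotated])
    then show False
      using A2 by (simp add: algebra_simps)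
  qed
  have eqK: "Legendre (A + B * (0 - j)) (int q) = Legendre (2 * A) (int q)"
  proof (rule Legendre_eq_if_cong[OF q odd_q])
    have "A + B * (0 - j) - 2 * A = - 1 * (A + B * j)"
      by (simp add: algebra_simps)
    then show "int q dvd A + B * (0 - j) - 2 * A"
      using jA by (metis dvd_mult)
  qed
  have KF: "K.local_factor s q = inverse (1 - of_int (Legendre (2 * A) (int q)) * of_nat q powr (- s))"
    unfolding K.local_factor_split[OF q j not_root_K_double[OF q odd_q j]] ramified_K[OF j jA]
      valK_deg1[OF q odd_q K.root_mod_conj[OF j] w] eqK by simp
  obtain m :: nat where m: "q = 2 * m + 1"
    using odd_q by (rule oddE)
  \<comment> \<open>The inverse of 2 modulo \<open>q\<close>, which is the double root of the
    polynomial of \<open>\<omega>0\<close>.\<close>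
  define r where "r = int m + 1"
  have r2: "2 * r - 1 = int q"
    by (simp add: r_def m)
  have "4 * (r ^ 2 - r + n0) = (2 * r - 1) ^ 2 - int q"
    unfolding disc[symmetric] by (simp add: power2_eq_square algebra_simps)
  also have "\<dots> = int q * (int q - 1)"
    unfolding r2 by (simp add: power2_eq_square algebra_simps)
  finally have "int q dvd 2 * (2 * (r ^ 2 - r + n0))"
    by simp
  then have r: "M.root_mod q r"
    using two prime_dvd_multD[OF pq] unfolding rootM_iff by blast
  have wA: "2 * (r + 2 * k) - A = int q"
    using r2 by simp
  have w: "\<not> int q dvd r + 2 * k"
  proof
    assume "int q dvd r + 2 * k"
    then have "int q dvd 2 * (r + 2 * k) - int q"
      by (intro dvd_diff dvd_mult) auto
    moreover have "2 * (r + 2 * k) - int q = A"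
      using wA by linarith
    ultimately show False
      using not_q_dvd(1) by metis
  qed
  have "Legendre (r + 2 * k) (int q) = Legendre (2 * A) (int q)"
  proof (rule Legendre_eq_if_mult_square[OF q odd_q w A2])
    have "(r + 2 * k) * (2 * A) - A ^ 2 = A * (2 * (r + 2 * k) - A)"
      by (simp add: power2_eq_square algebra_simps)
    then show "int q dvd (r + 2 * k) * (2 * A) - A ^ 2"
      unfolding wA by simp
  qed
  moreover have "valM (M.deg1_prime q r) = of_int (Legendre (2 * k + 1 * r) (int q))"
    using M.frobenius_value_deg1[OF q r odd_q M.delta_int[OF deltaM_square] M.one_mem _ deltaM_square] w
    by (simp add: add.commute)
  moreover have "M.local_factor s q = inverse (1 - valM (M.deg1_prime q r) * of_nat q powr (- s))"
    by (rule M.local_factor_double[OF q r]) (simp add: r2)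
  ultimately show ?thesis
    using KF by (simp add: add.commute)
qed

section \<open>The prime 2\<close>

lemma n0_even: "even n0"
  by (simp add: n0_def)

lemma root_K_2: "K.root_mod 2 1"
  by (simp add: rootK_iff)

lemma root_M_2: "M.root_mod 2 1"
  using n0_even by (simp add: rootM_iff)

text \<open>This is where \<open>A\<close> being 1 and \<open>B\<close> being 0 modulo 4 pays off:
  (alpha - 1) / 4 is \<open>k + l \<i>\<close>, so \<open>x\<close> is integral with trace 1, and
  the value is read off from \<open>k + l \<i>\<close> modulo the prime, where \<open>\<i>\<close>
  is 1.\<close>

lemma valK_2: "valK (K.deg1_prime 2 1) = (if even (k + l) then 1 else - 1)"
proof -
  define x where "x = (1 + \<delta>K) / 2"
  have \<delta>: "\<delta>K = 2 * x - 1"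
    by (simp add: x_def field_simps)
  have eq: "x ^ 2 - x = of_int k + of_int l * \<i>"
  proof -
    have "4 * (x ^ 2 - x) = \<delta>K ^ 2 - 1"
      by (simp add: \<delta> power2_eq_square algebra_simps)
    also have "\<dots> = 4 * (of_int k + of_int l * \<i>)"
      by (simp add: deltaK_square K.elem_def algebra_simps)
    finally show ?thesis
      by (metis mult_cancel_left zero_neq_numeral)
  qed
  have "algebraic_int x"
  proof
    \<comment> \<open>The norm to the integers of the quadratic equation of \<open>x\<close>;
      expanding it gives the quartic below.\<close>
    have "(x ^ 2 - x - of_int k) ^ 2 + of_int l ^ 2 = 0"
      unfolding eq by (simp add: power_mult_distrib)
    then show "poly [:of_int (k ^ 2 + l ^ 2), of_int (2 * k), of_int (1 - 2 * k), - 2, 1:] x = 0"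
      by (simp add: power2_eq_square algebra_simps)
  qed (auto simp: coeff_pCons split: nat.splits)
  then have x: "x \<in> \<O> K.E"
    unfolding ring_of_integers_def x_def using K.delta_mem_E K.E.of_int_mem[of 2] by auto
  have xF: "x \<notin> K.F"
  proof
    assume "x \<in> K.F"
    then have "2 * x - 1 \<in> K.F"
      using K.of_int_mem[of 2] by auto
    then show False
      using K.delta_notin \<delta> by simp
  qed
  have "x ^ 2 - K.elem 1 0 * x + K.elem (- k) (- l) = 0"
    using eq by (simp add: K.elem_def algebra_simps)
  then have "valK (K.deg1_prime 2 1) = (if even (- k + - l * 1) then 1 else - 1)"
    by (rule K.frobenius_value_2[OF root_K_2 x xF]) simp
  then show ?thesis by simp
qed

text \<open>The quarter \<open>(\<omega>0 ^ 2 - \<delta>M ^ 2) / 4\<close> equals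
  \<open>k ^ 2 + l ^ 2\<close>, since \<open>\<omega>0\<close> cancels. So \<open>x\<close> has
  trace \<open>\<omega>0\<close>, which is 1 modulo this prime, and the constant term has the parity
  of \<open>k + l\<close> found for K.\<close>

lemma valM_2_1: "valM (M.deg1_prime 2 1) = (if even (k + l) then 1 else - 1)"
proof -
  define x where "x = (\<omega>0 + \<delta>M) / 2"
  have \<delta>: "\<delta>M = 2 * x - \<omega>0"
    by (simp add: x_def field_simps)
  have eq: "x ^ 2 - \<omega>0 * x + of_int (k ^ 2 + l ^ 2) = 0"
  proof -
    have "4 * (x ^ 2 - \<omega>0 * x) = \<delta>M ^ 2 - \<omega>0 ^ 2"
      by (simp add: \<delta> power2_eq_square algebra_simps)
    also have "\<dots> = 4 * - of_int (k ^ 2 + l ^ 2)"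
      unfolding deltaM_square omega0_square by (simp add: M.elem_def n0_def algebra_simps)
    finally have "x ^ 2 - \<omega>0 * x = - of_int (k ^ 2 + l ^ 2)"
      by (metis mult_cancel_left zero_neq_numeral)
    then show ?thesis by simp
  qed
  have "algebraic_int x"
  proof
    define c :: complex where "c = of_int (k ^ 2 + l ^ 2)"
    \<comment> \<open>Squaring this relation eliminates \<open>\<omega>0\<close> and leaves an
      integer quartic for \<open>x\<close>.\<close>
    have "\<omega>0 * x = x ^ 2 + c"
      using eq unfolding c_def by (simp add: algebra_simps)
    then have "(x ^ 2 + c) ^ 2 = \<omega>0 ^ 2 * x ^ 2"
      by (metis power_mult_distrib)
    also have "\<dots> = x * (\<omega>0 * x) - of_int n0 * x ^ 2"
      unfolding omega0_square by (simp add: power2_eq_square algebra_simps)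
    also have "\<dots> = x * (x ^ 2 + c) - of_int n0 * x ^ 2"
      by (simp only: \<open>\<omega>0 * x = x ^ 2 + c\<close>)
    finally have "(x ^ 2 + c) ^ 2 - x * (x ^ 2 + c) + of_int n0 * x ^ 2 = 0"
      by simp
    then show "poly [:c ^ 2, - c, 2 * c + of_int n0, - 1, 1:] x = 0"
      by (simp add: power2_eq_square algebra_simps)
    show "\<forall>i. coeff [:c ^ 2, - c, 2 * c + of_int n0, - 1, 1:] i \<in> \<int>"
      by (auto simp: coeff_pCons c_def split: nat.splits)
  qed simp
  moreover have "\<omega>0 \<in> M.F"
    using M.elem_int[of 0 1] by (simp add: ring_of_integers_def M.elem_def)
  ultimately have x: "x \<in> \<O> M.E"
    unfolding ring_of_integers_def x_def
    using M.delta_mem_E M.F_subset_E M.E.of_int_mem[of 2] by auto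
  have xF: "x \<notin> M.F"
  proof
    assume "x \<in> M.F"
    then have "2 * x - \<omega>0 \<in> M.F"
      using M.of_int_mem[of 2] \<open>\<omega>0 \<in> M.F\<close> by auto
    then show False
      using M.delta_notin \<delta> by simp
  qed
  have "x ^ 2 - M.elem 0 1 * x + M.elem (k ^ 2 + l ^ 2) 0 = 0"
    using eq by (simp add: M.elem_def)
  then have "valM (M.deg1_prime 2 1) = (if even (k ^ 2 + l ^ 2 + 0 * 1) then 1 else - 1)"
    by (rule M.frobenius_value_2[OF root_M_2 x xF]) simp
  then show ?thesis by simp
qed

text \<open>
  Multiplying by \<open>\<kappa> = \<omega>0 - 1 - 2 k\<close>, for which \<open>\<kappa> \<delta>M\<^sup>2 = (2 l)\<^sup>2\<close>, and mapping \<open>\<omega>0\<close> to \<open>n0\<close> gives a ring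
  homomorphism to the integers modulo \<open>4\<close> under which \<open>\<kappa>\<close> becomes \<open>- 1\<close>, a non-square.
\<close>

lemma valM_2_0: "valM (M.deg1_prime 2 0) = 0"
proof (rule M.frobenius_value_ramified)
  have p2: "prime (2::nat)" by (rule two_is_prime_nat)
  have r: "M.root_mod 2 0"
    using n0_even by (simp add: rootM_iff)
  show "primes_above M.F M.E (M.deg1_prime 2 0) \<noteq> {}"
    by (rule M.primes_above_deg1[OF p2 r])
  fix v s n assume v: "v \<in> M.F" "s \<in> \<O> M.F" "n \<in> \<O> M.F"
    and eq: "v ^ 2 * \<delta>M ^ 2 = s ^ 2 - 4 * n"
  obtain a b c d where s: "s = M.elem a b" and n: "n = M.elem c d"
    using M.elem_cases v(2,3) by meson
  define a' where "a' = a ^ 2 - n0 * b ^ 2 - 4 * c"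
  define b' where "b' = 2 * a * b + b ^ 2 - 4 * d"
  have y: "v ^ 2 * \<delta>M ^ 2 = M.elem a' b'"
  proof -
    have "s ^ 2 = M.elem (a ^ 2 - n0 * b ^ 2) (2 * a * b + b ^ 2)"
      unfolding s power2_eq_square M.elem_mult M.elem_eq_iff by (simp add: algebra_simps)
    moreover have "4 * n = M.elem (4 * c) (4 * d)"
      by (simp add: n M.elem_def algebra_simps)
    ultimately show ?thesis
      unfolding eq by (simp add: M.elem_diff a'_def b'_def)
  qed
  define \<kappa> where "\<kappa> = M.elem (- 1 - 2 * k) 1"
  have \<kappa>: "\<kappa> * \<delta>M ^ 2 = of_int ((2 * l) ^ 2)"
    unfolding \<kappa>_def deltaM_square M.elem_mult M.elem_of_int M.elem_eq_iff
    by (simp add: n0_def power2_eq_square algebra_simps)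
  define z where "z = of_int (2 * l) * v"
  have "z ^ 2 = v ^ 2 * (\<kappa> * \<delta>M ^ 2)"
    unfolding \<kappa> by (simp add: z_def power_mult_distrib)
  also have "\<dots> = \<kappa> * (v ^ 2 * \<delta>M ^ 2)"
    by simp
  also have "\<dots> = M.elem (- 1 - 2 * k) 1 * M.elem a' b'"
    unfolding y \<kappa>_def ..
  finally have z2: "z ^ 2 = M.elem (- 1 - 2 * k) 1 * M.elem a' b'" .
  have "algebraic_int (z ^ 2)"
    unfolding z2 M.elem_mult using M.elem_int by (auto simp: ring_of_integers_def)
  then have "algebraic_int z"
    by (rule algebraic_int_if_square)
  moreover have "z \<in> M.F"
    unfolding z_def by (rule M.mult_mem[OF M.of_int_mem v(1)])
  ultimately have "z \<in> \<O> M.F"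
    by (simp add: ring_of_integers_def)
  then obtain e f where "z = M.elem e f"
    using M.elem_cases by blast
  then have "M.elem e f * M.elem e f = M.elem (- 1 - 2 * k) 1 * M.elem a' b'"
    using z2 by (simp add: power2_eq_square)
  then have ef: "e * e - n0 * f * f = (- 1 - 2 * k) * a' - n0 * b'"
    "2 * (e * f) + f * f = (- 1 - 2 * k) * b' + a' + b'"
    unfolding M.elem_mult M.elem_eq_iff by (simp_all add: algebra_simps)
  obtain h where h: "n0 = 2 * h" "h = - (2 * k ^ 2 + k + 2 * l ^ 2)"
    by (simp add: n0_def)
  \<comment> \<open>\<open>e + n0 * f\<close> and \<open>a + n0 * b\<close> are the images of
    \<open>z\<close> and \<open>s\<close>. Products are respected modulo \<open>n0 ^ 2\<close>,
    hence modulo 4, because \<open>n0\<close> is a root of the polynomial of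
    \<open>\<omega>0\<close> there. With \<open>\<kappa>\<close> mapped to \<open>- 1\<close>, the
    two squares sum to 0 modulo 4, so both images are even.\<close>
  have "(e + n0 * f) ^ 2 = (e * e - n0 * f * f) + n0 * (2 * (e * f) + f * f) + n0 ^ 2 * f ^ 2"
    by (simp add: power2_eq_square algebra_simps)
  also have "\<dots> = (n0 - 1 - 2 * k) * (a' + n0 * b') - n0 ^ 2 * b' + n0 ^ 2 * f ^ 2"
    unfolding ef by (simp add: power2_eq_square algebra_simps)
  also have "n0 - 1 - 2 * k = 4 * (- (k ^ 2) - k - l ^ 2) - 1"
    by (simp add: n0_def algebra_simps)
  also have "a' + n0 * b' = (a + n0 * b) ^ 2 - 4 * (c + n0 * d) + n0 * (b ^ 2 * (1 - n0)) - n0 * b ^ 2"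
    by (simp add: a'_def b'_def power2_eq_square algebra_simps)
  finally have "(e + n0 * f) ^ 2 = (4 * (- (k ^ 2) - k - l ^ 2) - 1) *
    ((a + n0 * b) ^ 2 - 4 * (c + n0 * d) + n0 * (b ^ 2 * (1 - n0)) - n0 * b ^ 2) - n0 ^ 2 * b' + n0 ^ 2 * f ^ 2" .
  then have "(e + n0 * f) ^ 2 + (a + n0 * b) ^ 2 = 4 * ((- (k ^ 2) - k - l ^ 2) *
    ((a + n0 * b) ^ 2 - 4 * (c + n0 * d) - n0 ^ 2 * b ^ 2) + (c + n0 * d) + h ^ 2 * (b ^ 2 - b' + f ^ 2))"
    unfolding h(1) by (simp add: power2_eq_square algebra_simps)
  then have four: "(e + n0 * f) ^ 2 mod 4 = 0 \<and> (a + n0 * b) ^ 2 mod 4 = 0"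
  proof -
    assume e: "(e + n0 * f) ^ 2 + (a + n0 * b) ^ 2 = 4 * ((- (k ^ 2) - k - l ^ 2) *
      ((a + n0 * b) ^ 2 - 4 * (c + n0 * d) - n0 ^ 2 * b ^ 2) + (c + n0 * d) + h ^ 2 * (b ^ 2 - b' + f ^ 2))"
    have aux: "u mod 4 = 0 \<and> w mod 4 = 0"
      if "u + w = 4 * m" "u mod 4 = 0 \<or> u mod 4 = 1" "w mod 4 = 0 \<or> w mod 4 = 1" for u w m :: int
      using that by presburger
    show ?thesis
      by (rule aux[OF e]) (simp_all add: int_sq_mod_4)
  qed
  have "even (a + n0 * b)"
  proof (rule ccontr)
    assume "odd (a + n0 * b)"
    then have "(a + n0 * b) ^ 2 mod 8 = 1" by (rule int_sq_mod_8)
    then show False using four by presburger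
  qed
  then have "even a'"
    using n0_even by (simp add: a'_def)
  then show "v ^ 2 * \<delta>M ^ 2 \<in> M.deg1_prime 2 0"
    unfolding y by simp
qed

text \<open>In K the prime 2 ramifies and gives a single factor. In M it splits; the prime for the
  root 0 contributes 1, and the one for the root 1 matches the factor of K.\<close>

lemma local_factor_eq_2: "K.local_factor s 2 = M.local_factor s 2"
proof -
  have p2: "prime (2::nat)" by (rule two_is_prime_nat)
  have "M.local_factor s 2 = inverse (1 - valM (M.deg1_prime 2 1) * of_nat 2 powr (- s)) *
      inverse (1 - valM (M.deg1_prime 2 (1 - 1)) * of_nat 2 powr (- s))"
    by (rule M.local_factor_split[OF p2 root_M_2]) simp
  moreover have "K.local_factor s 2 = inverse (1 - valK (K.deg1_prime 2 1) * of_nat 2 powr (- s))"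
    by (rule K.local_factor_double[OF p2 root_K_2]) simp
  ultimately show ?thesis
    using valM_2_0 by (simp add: valK_2 valM_2_1)
qed

section \<open>Equality of the L-functions\<close>

lemma local_factor_eq: "prime p \<Longrightarrow> K.local_factor s p = M.local_factor s p"
  using local_factor_eq_2 local_factor_eq_q local_factor_eq_odd[of p] prime_odd_nat[of p] prime_ge_2_nat[of p]
  by (cases "p = 2"; cases "p = q") auto

lemma euler_product_eq: "Re s > 1 \<Longrightarrow> euler_product s K.\<psi> K.F = euler_product s M.\<psi> M.F"
proof -
  assume s: "Re s > 1"
  have "(\<lambda>k. \<Prod>p | prime p \<and> p \<le> k. M.local_factor s p) =
      (\<lambda>k. \<Prod>p | prime p \<and> p \<le> k. K.local_factor s p)"
    by (intro ext prod.cong) (auto simp: local_factor_eq)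
  then show ?thesis
    using LIMSEQ_unique[OF K.euler_product_tendsto[OF s root_K_2]] M.euler_product_tendsto[OF s root_M_2]
    by simp
qed

text \<open>The Euler products agree for real part above 1, so elsewhere both sides apply THE to
  equivalent predicates.\<close>

lemma L_function_eq: "L_function s K.\<psi> K.F = L_function s M.\<psi> M.F"
proof -
  have "(\<forall>z. Re z > 1 \<longrightarrow> f z = euler_product z K.\<psi> K.F) \<longleftrightarrow>
      (\<forall>z. Re z > 1 \<longrightarrow> f z = euler_product z M.\<psi> M.F)" for f
    using euler_product_eq by auto
  then show ?thesis
    unfolding L_function_def using euler_product_eq[of s] by simp
qed

lemma rat_adjoin_K: "rat_adjoin {\<i>} = K.F"
  by (rule K.rat_adjoin_eq[of _ 0 1]) auto

lemma rat_adjoin_M: "rat_adjoin {complex_of_real (sqrt (real q))} = M.F"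
  by (rule M.rat_adjoin_eq[of _ "- 1" 2]) (auto simp: \<omega>0_def field_simps)

end

theorem mainTheorem2:
  fixes q :: nat and K M :: "complex set"
  assumes "Factorial_Ring.prime q" and "[q = 1] (mod 8)"
    and "K = rat_adjoin {\<i>}" and "M = rat_adjoin {complex_of_real (sqrt (real q))}"
  shows "\<exists>\<psi> \<eta>. quadratic_character K \<psi> \<and> quadratic_character M \<eta> \<and>
               (\<forall>s. L_function s \<psi> K = L_function s \<eta> M)"
proof -
  obtain k l :: int where "int q = (4 * k + 1) ^ 2 + (4 * l) ^ 2"
    using prime_1_mod_8_normal_form[OF assms(1,2)] .
  then interpret D: dihedral_setup q k l
    by unfold_locales (use assms in auto)
  show ?thesis
    unfolding assms(3,4) D.rat_adjoin_K D.rat_adjoin_M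
    using D.K.quadratic_character_psi D.M.quadratic_character_psi D.L_function_eq by blast
qed

end
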